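(* Let $n\geq 1$ and let $(\mathrm{Spec}(B),\underline{f})$, $\underline{f}=(f_1,\dots,f_n)\in B^n$, be an $n$-dimensional affine Landau-Ginzburg model over $S=\mathrm{Spec}(A)$. Then every object in the dg category of relative singularities $\mathbf{Sing}(B,\underline{f})$ is a homotopy retract (i.e. a retract in the homotopy category of $\mathbf{Sing}(B,\underline{f})$) of an object represented by a $K(B,\underline{f})$-dg module concentrated in $n+1$ (consecutive) degrees.
   Context: Standing assumptions: all rings are commutative and Noetherian; $A$ is a local, Noetherian, regular ring of finite Krull dimension, $S=\mathrm{Spec}(A)$. An $n$-dimensional affine Landau-Ginzburg model over $S$ is a pair $(\mathrm{Spec}(B),\underline f)$ with $B$ a flat $A$-algebra of finite type and $\underline f=(f_1,\dots,f_n)\in B^n$ (equivalently a morphism $\mathrm{Spec}(B)\to\mathbb A^n_S$); no regularity is assumed on $B$ or $\underline f$. Koszul algebra: $K(B,\underline f)$ is the commutative dg algebra $B[\varepsilon_1,\dots,\varepsilon_n]$ with $\varepsilon_i$ in cohomological degree $-1$, $\varepsilon_i^2=0$, $\varepsilon_i\varepsilon_j=-\varepsilon_j\varepsilon_i$, $d(\varepsilon_i)=f_i$. A $K(B,\underline f)$-dg module is a cochain complex of $B$-modules $(E,d)$ with $B$-linear maps $h^1,\dots,h^n$ of degree $-1$ (the actions of the $\varepsilon_i$) such that $(h^i)^2=0$, $dh^i+h^id=f_i\cdot\mathrm{id}$, $h^ih^j+h^jh^i=0$. dg categories: everything takes place in the $\infty$-category of (small, $A$-linear) idempotent complete triangulated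 dg categories, i.e. the localization of $A$-linear dg categories at Morita equivalences; a quotient $T/T'$ is the pushout $T\amalg_{T'}0$ there (so its homotopy category is the idempotent completion of the Verdier quotient). Relative singularities: let $X=\mathrm{Spec}(B)$, $X_0=X\times^h_{\mathbb A^n_S}S$ the derived zero locus of $\underline f$ (i.e. the derived scheme $\mathrm{Spec}\,K(B,\underline f)$), and $\mathfrak i:X_0\to X$ the canonical map. For $Z=X,X_0$, $\mathbf{Sing}(Z)=\mathbf{Coh}^b(Z)/\mathbf{Perf}(Z)$, and $\mathbf{Sing}(B,\underline f)=\mathrm{Ker}(\mathfrak i_*:\mathbf{Sing}(X_0)\to\mathbf{Sing}(X))$, which is canonically equivalent to $\mathbf{Coh}^b(X_0)_{\mathbf{Perf}(X)}/\mathbf{Perf}(X_0)$, where $\mathbf{Coh}^b(X_0)_{\mathbf{Perf}(X)}$ consists of those $E\in\mathbf{Coh}^b(X_0)$ with $\mathfrak i_*E$ perfect on $X$. Strict model: let $\mathrm{Coh}^s(B,\underline f)$ be the dg category of $K(B,\underline f)$-dg modules whose underlying complex of $B$-modules is strictly perfect (strictly bounded and degreewise finitely generated projective), and $\mathrm{Perf}^s(B,\underline f)$ its full sub-dg category of modules that are perfect over $K(B,\underline f)$; then $\mathrm{Coh}^s(B,\underline f)/\mathrm{Perf}^s(B,\underline f)\simeq\mathbf{Sing}(B,\underline f)$. An object of $\mathbf{Sing}(B,\underline f)$ is represented by a $K(B,\underline f)$-dg module $E$ if it is equivalent to the image of $E$ under this quotient. *)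

theory Defs
  imports "HOL-Algebra.Ring_Divisibility" "HOL-Algebra.Generated_Rings" "HOL-Algebra.Module"
    "HOL-Algebra.Free_Abelian_Groups" "HOL-Library.Nat_Bijection"
begin

section \<open>Commutative algebra\<close>

definition lin_maps ::
  "('r, 'x) ring_scheme \<Rightarrow> ('r, 'm) module \<Rightarrow> ('r, 'k) module \<Rightarrow> ('m \<Rightarrow> 'k) set" where
  "lin_maps R M N = {g. g \<in> carrier M \<rightarrow> carrier N \<and>
     (\<forall>x\<in>carrier M. \<forall>y\<in>carrier M. g (x \<oplus>\<^bsub>M\<^esub> y) = g x \<oplus>\<^bsub>N\<^esub> g y) \<and>
     (\<forall>r\<in>carrier R. \<forall>x\<in>carrier M. g (r \<odot>\<^bsub>M\<^esub> x) = r \<odot>\<^bsub>N\<^esub> g x)}"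

definition prime_chain :: "('a, 'x) ring_scheme \<Rightarrow> nat \<Rightarrow> bool" where
  "prime_chain R d \<longleftrightarrow> (\<exists>P. (\<forall>i\<le>d. primeideal (P i) R) \<and> (\<forall>i<d. P i \<subset> P (Suc i)))"

definition has_krull_dim :: "('a, 'x) ring_scheme \<Rightarrow> nat \<Rightarrow> bool" where
  "has_krull_dim R d \<longleftrightarrow> prime_chain R d \<and> (\<forall>e. prime_chain R e \<longrightarrow> e \<le> d)"

definition regular_local_ring :: "('a, 'x) ring_scheme \<Rightarrow> bool" where
  "regular_local_ring R \<longleftrightarrow> cring R \<and> noetherian_ring R \<and>
     (\<exists>!\<mm>. maximalideal \<mm> R) \<and>
     (\<exists>d S. has_krull_dim R d \<and> S \<subseteq> carrier R \<and> finite S \<and> card S = d \<and>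
            maximalideal (genideal R S) R)"

definition finite_type_algebra :: "('a, 'x) ring_scheme \<Rightarrow> ('a, 'b) module \<Rightarrow> bool" where
  "finite_type_algebra A B \<longleftrightarrow> (\<exists>S. finite S \<and> S \<subseteq> carrier B \<and>
     generate_ring B (S \<union> (\<lambda>a. a \<odot>\<^bsub>B\<^esub> \<one>\<^bsub>B\<^esub>) ` carrier A) = carrier B)"

definition tensor_rel ::
  "('r, 'x) ring_scheme \<Rightarrow> ('r, 'm) module \<Rightarrow> ('r, 'k) module \<Rightarrow> ('m \<times> 'k \<Rightarrow>\<^sub>0 int) set" where
  "tensor_rel R M N = generate (free_Abelian_group (carrier M \<times> carrier N))
     ({frag_of (x \<oplus>\<^bsub>M\<^esub> x', y) - frag_of (x, y) - frag_of (x', y) | x x' y.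
         x \<in> carrier M \<and> x' \<in> carrier M \<and> y \<in> carrier N} \<union>
      {frag_of (x, y \<oplus>\<^bsub>N\<^esub> y') - frag_of (x, y) - frag_of (x, y') | x y y'.
         x \<in> carrier M \<and> y \<in> carrier N \<and> y' \<in> carrier N} \<union>
      {frag_of (r \<odot>\<^bsub>M\<^esub> x, y) - frag_of (x, r \<odot>\<^bsub>N\<^esub> y) | r x y.
         r \<in> carrier R \<and> x \<in> carrier M \<and> y \<in> carrier N})"

definition tensor_product ::
  "('r, 'x) ring_scheme \<Rightarrow> ('r, 'm) module \<Rightarrow> ('r, 'k) module \<Rightarrow> ('m \<times> 'k \<Rightarrow>\<^sub>0 int) set monoid" where
  "tensor_product R M N =
     free_Abelian_group (carrier M \<times> carrier N) Mod tensor_rel R M N"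

text \<open>\<open>u \<otimes> id : M \<otimes> L \<rightarrow> N \<otimes> L\<close>; the union is over cosets that all coincide.\<close>

definition tensor_map_left ::
  "('r, 'x) ring_scheme \<Rightarrow> ('r, 'k) module \<Rightarrow> ('r, 'l) module \<Rightarrow> ('m \<Rightarrow> 'k)
     \<Rightarrow> ('m \<times> 'l \<Rightarrow>\<^sub>0 int) set \<Rightarrow> ('k \<times> 'l \<Rightarrow>\<^sub>0 int) set" where
  "tensor_map_left R N L u X =
     (\<Union>x\<in>X. r_coset (free_Abelian_group (carrier N \<times> carrier L)) (tensor_rel R N L)
              (frag_extend (\<lambda>(m, l). frag_of (u m, l)) x))"

text \<open>
  Flatness: tensoring preserves injections. The test modules have carriers in \<open>nat \<Rightarrow> 'a\<close>; up to
  isomorphism these include all finitely generated modules, which suffice to test flatness.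
\<close>

definition flat_module :: "('a, 'x) ring_scheme \<Rightarrow> ('a, 'b) module \<Rightarrow> bool" where
  "flat_module A L \<longleftrightarrow> (\<forall>(M :: ('a, nat \<Rightarrow> 'a) module) (N :: ('a, nat \<Rightarrow> 'a) module) u.
     module A M \<and> module A N \<and> u \<in> lin_maps A M N \<and> inj_on u (carrier M) \<longrightarrow>
     inj_on (tensor_map_left A N L u) (carrier (tensor_product A M L)))"

text \<open>
  Throughout, modules over a ring with elements in \<open>'b\<close> have their carrier in the type
  \<open>nat \<Rightarrow> 'b\<close>. Up to isomorphism this includes every finitely generated module, and the
  type is large enough for all the constructions below (direct sums are encoded by interleaving
  sequences), so that one obtains a small model of each of the categories involved.
\<close>

type_synonym 'b bmod = "('b, nat \<Rightarrow> 'b) module"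

definition fin_gen_module :: "('b, 'x) ring_scheme \<Rightarrow> 'b bmod \<Rightarrow> bool" where
  "fin_gen_module R M \<longleftrightarrow> module R M \<and>
     (\<exists>S. finite S \<and> S \<subseteq> carrier M \<and> (\<forall>H. submodule H R M \<and> S \<subseteq> H \<longrightarrow> H = carrier M))"

definition projective_module :: "('b, 'x) ring_scheme \<Rightarrow> 'b bmod \<Rightarrow> bool" where
  "projective_module R M \<longleftrightarrow> module R M \<and>
     (\<forall>(N :: 'b bmod) (L :: 'b bmod) p g.
        module R N \<and> module R L \<and> p \<in> lin_maps R N L \<and> p ` carrier N = carrier L \<and>
        g \<in> lin_maps R M L \<longrightarrow>
        (\<exists>g'\<in>lin_maps R M N. \<forall>x\<in>carrier M. p (g' x) = g x))"

definition interleave :: "(nat \<Rightarrow> 'b) \<Rightarrow> (nat \<Rightarrow> 'b) \<Rightarrow> nat \<Rightarrow> 'b" where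
  "interleave u v k = (if even k then u (k div 2) else v (k div 2))"

definition seq_fst :: "(nat \<Rightarrow> 'b) \<Rightarrow> nat \<Rightarrow> 'b" where "seq_fst w k = w (2 * k)"

definition seq_snd :: "(nat \<Rightarrow> 'b) \<Rightarrow> nat \<Rightarrow> 'b" where "seq_snd w k = w (2 * k + 1)"

text \<open>The fields \<open>mult\<close> and \<open>one\<close> of a module record carry no meaning for modules.\<close>

definition dsum :: "'b bmod \<Rightarrow> 'b bmod \<Rightarrow> 'b bmod" where
  "dsum M N =
     \<lparr>carrier = {interleave x y | x y. x \<in> carrier M \<and> y \<in> carrier N},
      mult = undefined, one = undefined,
      ring.zero = interleave \<zero>\<^bsub>M\<^esub> \<zero>\<^bsub>N\<^esub>,
      add = (\<lambda>u v. interleave (seq_fst u \<oplus>\<^bsub>M\<^esub> seq_fst v) (seq_snd u \<oplus>\<^bsub>N\<^esub> seq_snd v)),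
      smult = (\<lambda>r u. interleave (r \<odot>\<^bsub>M\<^esub> seq_fst u) (r \<odot>\<^bsub>N\<^esub> seq_snd u))\<rparr>"


section \<open>Categories\<close>

record ('o, 'm) category =
  Obj :: "'o set"
  Mor :: "'o \<Rightarrow> 'o \<Rightarrow> 'm set"
  Ident :: "'o \<Rightarrow> 'm"
  Cmp :: "'o \<Rightarrow> 'o \<Rightarrow> 'o \<Rightarrow> 'm \<Rightarrow> 'm \<Rightarrow> 'm"
    \<comment> \<open>\<open>Cmp C X Y Z g f\<close> is the composite of \<open>f : X \<rightarrow> Y\<close> and \<open>g : Y \<rightarrow> Z\<close>\<close>

definition retract_of :: "('o, 'm) category \<Rightarrow> 'o \<Rightarrow> 'o \<Rightarrow> bool" where
  "retract_of C X Y \<longleftrightarrow> X \<in> Obj C \<and> Y \<in> Obj C \<and>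
     (\<exists>i\<in>Mor C X Y. \<exists>r\<in>Mor C Y X. Cmp C X Y X r i = Ident C X)"

definition isomorphic :: "('o, 'm) category \<Rightarrow> 'o \<Rightarrow> 'o \<Rightarrow> bool" where
  "isomorphic C X Y \<longleftrightarrow> X \<in> Obj C \<and> Y \<in> Obj C \<and>
     (\<exists>f\<in>Mor C X Y. \<exists>g\<in>Mor C Y X. Cmp C X Y X g f = Ident C X \<and> Cmp C Y X Y f g = Ident C Y)"

text \<open>
  The localization \<open>C[W\<inverse>]\<close>: morphisms are zigzags, written in diagrammatic order, modulo the
  smallest congruence which makes \<open>C \<rightarrow> C[W\<inverse>]\<close> a functor inverting \<open>W\<close>. The step
  \<open>Bwd X Y w\<close> is the formal inverse \<open>X \<rightarrow> Y\<close> of an element \<open>w: Y \<rightarrow> X\<close> of \<open>W\<close>.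
\<close>

datatype ('o, 'm) step = Fwd 'o 'o 'm | Bwd 'o 'o 'm

inductive zigzag ::
  "('o, 'm) category \<Rightarrow> ('o \<Rightarrow> 'o \<Rightarrow> 'm set) \<Rightarrow> 'o \<Rightarrow> ('o, 'm) step list \<Rightarrow> 'o \<Rightarrow> bool"
  for C W where
  nil: "X \<in> Obj C \<Longrightarrow> zigzag C W X [] X"
| fwd: "X \<in> Obj C \<Longrightarrow> Y \<in> Obj C \<Longrightarrow> f \<in> Mor C X Y \<Longrightarrow> zigzag C W Y p Z \<Longrightarrow>
    zigzag C W X (Fwd X Y f # p) Z"
| bwd: "X \<in> Obj C \<Longrightarrow> Y \<in> Obj C \<Longrightarrow> w \<in> W Y X \<Longrightarrow> zigzag C W Y p Z \<Longrightarrow>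
    zigzag C W X (Bwd X Y w # p) Z"

inductive zigzag_eq ::
  "('o, 'm) category \<Rightarrow> ('o \<Rightarrow> 'o \<Rightarrow> 'm set) \<Rightarrow> 'o \<Rightarrow> 'o \<Rightarrow>
     ('o, 'm) step list \<Rightarrow> ('o, 'm) step list \<Rightarrow> bool"
  for C W where
  refl: "zigzag C W X p Y \<Longrightarrow> zigzag_eq C W X Y p p"
| sym: "zigzag_eq C W X Y p q \<Longrightarrow> zigzag_eq C W X Y q p"
| trans: "zigzag_eq C W X Y p q \<Longrightarrow> zigzag_eq C W X Y q r \<Longrightarrow> zigzag_eq C W X Y p r"
| cong: "zigzag_eq C W X Y p p' \<Longrightarrow> zigzag_eq C W Y Z q q' \<Longrightarrow>
    zigzag_eq C W X Z (p @ q) (p' @ q')"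
| ident: "X \<in> Obj C \<Longrightarrow> zigzag_eq C W X X [Fwd X X (Ident C X)] []"
| comp: "X \<in> Obj C \<Longrightarrow> Y \<in> Obj C \<Longrightarrow> Z \<in> Obj C \<Longrightarrow> f \<in> Mor C X Y \<Longrightarrow> g \<in> Mor C Y Z \<Longrightarrow>
    zigzag_eq C W X Z [Fwd X Y f, Fwd Y Z g] [Fwd X Z (Cmp C X Y Z g f)]"
| inv_right: "X \<in> Obj C \<Longrightarrow> Y \<in> Obj C \<Longrightarrow> w \<in> W X Y \<Longrightarrow>
    zigzag_eq C W X X [Fwd X Y w, Bwd Y X w] []"
| inv_left: "X \<in> Obj C \<Longrightarrow> Y \<in> Obj C \<Longrightarrow> w \<in> W X Y \<Longrightarrow>
    zigzag_eq C W Y Y [Bwd Y X w, Fwd X Y w] []"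

definition zigzag_rel ::
  "('o, 'm) category \<Rightarrow> ('o \<Rightarrow> 'o \<Rightarrow> 'm set) \<Rightarrow> 'o \<Rightarrow> 'o \<Rightarrow> ('o, 'm) step list rel" where
  "zigzag_rel C W X Y = {(p, q). zigzag_eq C W X Y p q}"

text \<open>\<open>W X Y\<close> is meant to be a subset of \<open>Mor C X Y\<close>.\<close>

definition localization ::
  "('o, 'm) category \<Rightarrow> ('o \<Rightarrow> 'o \<Rightarrow> 'm set) \<Rightarrow> ('o, ('o, 'm) step list set) category" where
  "localization C W =
     \<lparr>Obj = Obj C,
      Mor = (\<lambda>X Y. {p. zigzag C W X p Y} // zigzag_rel C W X Y),
      Ident = (\<lambda>X. zigzag_rel C W X X `` {[]}),
      Cmp = (\<lambda>X Y Z \<beta> \<alpha>. zigzag_rel C W X Z `` {p @ q | p q. p \<in> \<alpha> \<and> q \<in> \<beta>})\<rparr>"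

text \<open>Idempotent completion (Karoubi envelope).\<close>

definition idem_completion :: "('o, 'm) category \<Rightarrow> ('o \<times> 'm, 'm) category" where
  "idem_completion C =
     \<lparr>Obj = {(X, e). X \<in> Obj C \<and> e \<in> Mor C X X \<and> Cmp C X X X e e = e},
      Mor = (\<lambda>(X, e) (Y, e'). {f \<in> Mor C X Y. Cmp C X X Y f e = f \<and> Cmp C X Y Y e' f = f}),
      Ident = (\<lambda>(X, e). e),
      Cmp = (\<lambda>(X, _) (Y, _) (Z, _). Cmp C X Y Z)\<rparr>"


section \<open>Dg modules over the Koszul algebra\<close>

record 'b kdg =
  deg :: "int \<Rightarrow> 'b bmod"
  dif :: "int \<Rightarrow> (nat \<Rightarrow> 'b) \<Rightarrow> (nat \<Rightarrow> 'b)" \<comment> \<open>\<open>dif E k : deg E k \<rightarrow> deg E (k + 1)\<close>\<close>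
  eps :: "nat \<Rightarrow> int \<Rightarrow> (nat \<Rightarrow> 'b) \<Rightarrow> (nat \<Rightarrow> 'b)"
    \<comment> \<open>\<open>eps E i k : deg E k \<rightarrow> deg E (k - 1)\<close>, the action of \<open>\<epsilon>\<^sub>i\<close>\<close>

definition koszul_dg_module ::
  "('b, 'x) ring_scheme \<Rightarrow> nat \<Rightarrow> (nat \<Rightarrow> 'b) \<Rightarrow> 'b kdg \<Rightarrow> bool" where
  "koszul_dg_module B n f E \<longleftrightarrow>
     (\<forall>k. module B (deg E k)) \<and>
     (\<forall>k. dif E k \<in> lin_maps B (deg E k) (deg E (k + 1))) \<and>
     (\<forall>k. \<forall>x\<in>carrier (deg E k). dif E (k + 1) (dif E k x) = \<zero>\<^bsub>deg E (k + 2)\<^esub>) \<and>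
     (\<forall>i\<in>{1..n}. \<forall>k. eps E i k \<in> lin_maps B (deg E k) (deg E (k - 1))) \<and>
     (\<forall>i\<in>{1..n}. \<forall>k. \<forall>x\<in>carrier (deg E k).
        eps E i (k - 1) (eps E i k x) = \<zero>\<^bsub>deg E (k - 2)\<^esub> \<and>
        dif E (k - 1) (eps E i k x) \<oplus>\<^bsub>deg E k\<^esub> eps E i (k + 1) (dif E k x) = f i \<odot>\<^bsub>deg E k\<^esub> x) \<and>
     (\<forall>i\<in>{1..n}. \<forall>j\<in>{1..n}. \<forall>k. \<forall>x\<in>carrier (deg E k).
        eps E i (k - 1) (eps E j k x) \<oplus>\<^bsub>deg E (k - 2)\<^esub> eps E j (k - 1) (eps E i k x)
          = \<zero>\<^bsub>deg E (k - 2)\<^esub>)"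

definition mod_sign :: "'b bmod \<Rightarrow> int \<Rightarrow> (nat \<Rightarrow> 'b) \<Rightarrow> (nat \<Rightarrow> 'b)" where
  "mod_sign M k x = (if even k then x else \<ominus>\<^bsub>M\<^esub> x)"

text \<open>
  The Hom complexes: \<open>dg_hom B n E F k\<close> consists of the graded maps \<open>\<phi>\<close> of degree \<open>k\<close>, linear over
  the Koszul algebra, i.e. \<open>\<phi> (\<epsilon>\<^sub>i x) = (-1)\<^sup>k \<epsilon>\<^sub>i (\<phi> x)\<close>, and the differential is
  \<open>\<phi> \<mapsto> d \<circ> \<phi> - (-1)\<^sup>k \<phi> \<circ> d\<close>. Values outside the carriers are irrelevant: they are identified
  by \<open>homotopic\<close> below.
\<close>

definition dg_hom ::
  "('b, 'x) ring_scheme \<Rightarrow> nat \<Rightarrow> 'b kdg \<Rightarrow> 'b kdg \<Rightarrow> int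
     \<Rightarrow> (int \<Rightarrow> (nat \<Rightarrow> 'b) \<Rightarrow> (nat \<Rightarrow> 'b)) set" where
  "dg_hom B n E F k = {\<phi>.
     (\<forall>j. \<phi> j \<in> lin_maps B (deg E j) (deg F (j + k))) \<and>
     (\<forall>i\<in>{1..n}. \<forall>j. \<forall>x\<in>carrier (deg E j).
        \<phi> (j - 1) (eps E i j x) = mod_sign (deg F (j + k - 1)) k (eps F i (j + k) (\<phi> j x)))}"

definition dg_diff ::
  "'b kdg \<Rightarrow> 'b kdg \<Rightarrow> int \<Rightarrow> (int \<Rightarrow> (nat \<Rightarrow> 'b) \<Rightarrow> (nat \<Rightarrow> 'b))
     \<Rightarrow> int \<Rightarrow> (nat \<Rightarrow> 'b) \<Rightarrow> (nat \<Rightarrow> 'b)" where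
  "dg_diff E F k \<phi> j x =
     dif F (j + k) (\<phi> j x) \<ominus>\<^bsub>deg F (j + k + 1)\<^esub>
       mod_sign (deg F (j + k + 1)) k (\<phi> (j + 1) (dif E j x))"

definition closed_maps ::
  "('b, 'x) ring_scheme \<Rightarrow> nat \<Rightarrow> 'b kdg \<Rightarrow> 'b kdg
     \<Rightarrow> (int \<Rightarrow> (nat \<Rightarrow> 'b) \<Rightarrow> (nat \<Rightarrow> 'b)) set" where
  "closed_maps B n E F = {\<phi> \<in> dg_hom B n E F 0.
     \<forall>j. \<forall>x\<in>carrier (deg E j). dg_diff E F 0 \<phi> j x = \<zero>\<^bsub>deg F (j + 1)\<^esub>}"

definition homotopic ::
  "('b, 'x) ring_scheme \<Rightarrow> nat \<Rightarrow> 'b kdg \<Rightarrow> 'b kdg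
     \<Rightarrow> (int \<Rightarrow> (nat \<Rightarrow> 'b) \<Rightarrow> (nat \<Rightarrow> 'b)) rel" where
  "homotopic B n E F = {(\<phi>, \<psi>). \<phi> \<in> closed_maps B n E F \<and> \<psi> \<in> closed_maps B n E F \<and>
     (\<exists>\<sigma>\<in>dg_hom B n E F (-1). \<forall>j. \<forall>x\<in>carrier (deg E j).
        \<phi> j x \<ominus>\<^bsub>deg F j\<^esub> \<psi> j x = dg_diff E F (-1) \<sigma> j x)}"

text \<open>The homotopy category \<open>H\<^sup>0\<close> of the full dg category of dg modules on a set \<open>U\<close> of objects.\<close>

definition homotopy_cat ::
  "('b, 'x) ring_scheme \<Rightarrow> nat \<Rightarrow> 'b kdg set
     \<Rightarrow> ('b kdg, (int \<Rightarrow> (nat \<Rightarrow> 'b) \<Rightarrow> (nat \<Rightarrow> 'b)) set) category" where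
  "homotopy_cat B n U =
     \<lparr>Obj = U,
      Mor = (\<lambda>E F. closed_maps B n E F // homotopic B n E F),
      Ident = (\<lambda>E. homotopic B n E E `` {\<lambda>j x. x}),
      Cmp = (\<lambda>E F G \<beta> \<alpha>. homotopic B n E G `` {\<lambda>j x. \<psi> j (\<phi> j x) | \<psi> \<phi>. \<psi> \<in> \<beta> \<and> \<phi> \<in> \<alpha>})\<rparr>"

definition shift_dg :: "int \<Rightarrow> 'b kdg \<Rightarrow> 'b kdg" where
  "shift_dg m E =
     \<lparr>deg = (\<lambda>k. deg E (k + m)),
      dif = (\<lambda>k x. mod_sign (deg E (k + m + 1)) m (dif E (k + m) x)),
      eps = (\<lambda>i k x. mod_sign (deg E (k + m - 1)) m (eps E i (k + m) x))\<rparr>"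

definition cone_dg :: "'b kdg \<Rightarrow> 'b kdg \<Rightarrow> (int \<Rightarrow> (nat \<Rightarrow> 'b) \<Rightarrow> (nat \<Rightarrow> 'b)) \<Rightarrow> 'b kdg" where
  "cone_dg E F s =
     \<lparr>deg = (\<lambda>k. dsum (deg E (k + 1)) (deg F k)),
      dif = (\<lambda>k w. interleave
               (\<ominus>\<^bsub>deg E (k + 2)\<^esub> dif E (k + 1) (seq_fst w))
               (s (k + 1) (seq_fst w) \<oplus>\<^bsub>deg F (k + 1)\<^esub> dif F k (seq_snd w))),
      eps = (\<lambda>i k w. interleave
               (\<ominus>\<^bsub>deg E k\<^esub> eps E i (k + 1) (seq_fst w))
               (eps F i k (seq_snd w)))\<rparr>"

text \<open>
  The Koszul algebra as a dg module over itself. Its basis in degree \<open>-p\<close> consists of the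
  monomials \<open>\<epsilon>\<^sub>I = \<epsilon>\<^bsub>i\<^sub>1\<^esub> \<dots> \<epsilon>\<^bsub>i\<^sub>p\<^esub>\<close>, \<open>i\<^sub>1 < \<dots> < i\<^sub>p\<close>, for \<open>I \<subseteq> {1..n}\<close> with \<open>p\<close> elements. An element
  is given by its coefficients \<open>v\<close>, that of \<open>\<epsilon>\<^sub>I\<close> being \<open>v (set_encode I)\<close>. With
  \<open>sgn i I = (-1)^|{j \<in> I. j < i}|\<close> one has \<open>\<epsilon>\<^sub>i \<epsilon>\<^sub>I = sgn i I \<epsilon>\<^bsub>I \<union> {i}\<^esub>\<close> for \<open>i \<notin> I\<close>,
  and \<open>d \<epsilon>\<^sub>I = \<Sum>i\<in>I. sgn i I f\<^sub>i \<epsilon>\<^bsub>I - {i}\<^esub>\<close>.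
\<close>

definition koszul_sign :: "('b, 'x) ring_scheme \<Rightarrow> nat \<Rightarrow> nat set \<Rightarrow> 'b \<Rightarrow> 'b" where
  "koszul_sign B i I b = (if even (card {j\<in>I. j < i}) then b else \<ominus>\<^bsub>B\<^esub> b)"

definition koszul_algebra ::
  "('b, 'x) ring_scheme \<Rightarrow> nat \<Rightarrow> (nat \<Rightarrow> 'b) \<Rightarrow> 'b kdg" where
  "koszul_algebra B n f =
     \<lparr>deg = (\<lambda>k.
        \<lparr>carrier = {v. \<forall>c. v c \<in> carrier B \<and>
            (v c \<noteq> \<zero>\<^bsub>B\<^esub> \<longrightarrow> set_decode c \<subseteq> {1..n} \<and> int (card (set_decode c)) = - k)},
         mult = undefined, one = undefined,
         ring.zero = (\<lambda>c. \<zero>\<^bsub>B\<^esub>),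
         add = (\<lambda>u v c. u c \<oplus>\<^bsub>B\<^esub> v c),
         smult = (\<lambda>b v c. b \<otimes>\<^bsub>B\<^esub> v c)\<rparr>),
      dif = (\<lambda>k v c. finsum B
        (\<lambda>i. koszul_sign B i (set_decode c)
               (f i \<otimes>\<^bsub>B\<^esub> v (set_encode (insert i (set_decode c)))))
        ({1..n} - set_decode c)),
      eps = (\<lambda>i k v c. if i \<in> set_decode c
        then koszul_sign B i (set_decode c) (v (set_encode (set_decode c - {i})))
        else \<zero>\<^bsub>B\<^esub>)\<rparr>"


section \<open>Relative singularities\<close>

text \<open>Quasi-isomorphism: the induced maps on cohomology are injective and surjective.\<close>

definition quasi_iso ::
  "'b kdg \<Rightarrow> 'b kdg \<Rightarrow> (int \<Rightarrow> (nat \<Rightarrow> 'b) \<Rightarrow> (nat \<Rightarrow> 'b)) \<Rightarrow> bool" where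
  "quasi_iso E F s \<longleftrightarrow> (\<forall>k.
     (\<forall>x\<in>carrier (deg E k). dif E k x = \<zero>\<^bsub>deg E (k + 1)\<^esub> \<and>
        (\<exists>y\<in>carrier (deg F (k - 1)). s k x = dif F (k - 1) y) \<longrightarrow>
        (\<exists>z\<in>carrier (deg E (k - 1)). x = dif E (k - 1) z)) \<and>
     (\<forall>y\<in>carrier (deg F k). dif F k y = \<zero>\<^bsub>deg F (k + 1)\<^esub> \<longrightarrow>
        (\<exists>x\<in>carrier (deg E k). dif E k x = \<zero>\<^bsub>deg E (k + 1)\<^esub> \<and>
           (\<exists>z\<in>carrier (deg F (k - 1)). y = s k x \<oplus>\<^bsub>deg F k\<^esub> dif F (k - 1) z))))"

text \<open>The derived category of the Koszul algebra.\<close>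

definition derived_cat ::
  "('b, 'x) ring_scheme \<Rightarrow> nat \<Rightarrow> (nat \<Rightarrow> 'b) \<Rightarrow>
     ('b kdg, ('b kdg, (int \<Rightarrow> (nat \<Rightarrow> 'b) \<Rightarrow> (nat \<Rightarrow> 'b)) set) step list set) category" where
  "derived_cat B n f = localization (homotopy_cat B n {E. koszul_dg_module B n f E})
     (\<lambda>E F. {\<alpha> \<in> closed_maps B n E F // homotopic B n E F. \<exists>s\<in>\<alpha>. quasi_iso E F s})"

text \<open>
  Perfect dg modules: the thick subcategory of the derived category generated by the Koszul
  algebra. Every distinguished triangle of the derived category is isomorphic to one given by the
  cone of an actual map of dg modules; closure under isomorphism is contained in closure
  under retracts.
\<close>

inductive perfect_dg ::
  "('b, 'x) ring_scheme \<Rightarrow> nat \<Rightarrow> (nat \<Rightarrow> 'b) \<Rightarrow> 'b kdg \<Rightarrow> bool"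
  for B n f where
  koszul: "perfect_dg B n f (koszul_algebra B n f)"
| shift: "perfect_dg B n f E \<Longrightarrow> perfect_dg B n f (shift_dg m E)"
| cone: "perfect_dg B n f E \<Longrightarrow> perfect_dg B n f F \<Longrightarrow> s \<in> closed_maps B n E F \<Longrightarrow>
    perfect_dg B n f (cone_dg E F s)"
| retract: "perfect_dg B n f F \<Longrightarrow> retract_of (derived_cat B n f) E F \<Longrightarrow> perfect_dg B n f E"

definition concentrated_in :: "'b kdg \<Rightarrow> int set \<Rightarrow> bool" where
  "concentrated_in E D \<longleftrightarrow> (\<forall>k. k \<notin> D \<longrightarrow> carrier (deg E k) = {\<zero>\<^bsub>deg E k\<^esub>})"

definition strictly_perfect :: "('b, 'x) ring_scheme \<Rightarrow> 'b kdg \<Rightarrow> bool" where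
  "strictly_perfect B E \<longleftrightarrow>
     (\<exists>a b. concentrated_in E {a..b}) \<and>
     (\<forall>k. fin_gen_module B (deg E k) \<and> projective_module B (deg E k))"

text \<open>The objects of the dg categories \<open>Coh\<^sup>s(B,f)\<close> and \<open>Perf\<^sup>s(B,f)\<close>.\<close>

definition coh_s :: "('b, 'x) ring_scheme \<Rightarrow> nat \<Rightarrow> (nat \<Rightarrow> 'b) \<Rightarrow> 'b kdg set" where
  "coh_s B n f = {E. koszul_dg_module B n f E \<and> strictly_perfect B E}"

definition perf_s :: "('b, 'x) ring_scheme \<Rightarrow> nat \<Rightarrow> (nat \<Rightarrow> 'b) \<Rightarrow> 'b kdg set" where
  "perf_s B n f = {E \<in> coh_s B n f. perfect_dg B n f E}"

text \<open>
  The Verdier quotient of the homotopy category of \<open>Coh\<^sup>s(B,f)\<close> by that of \<open>Perf\<^sup>s(B,f)\<close>, i.e. its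
  localization at the maps whose cone is in \<open>Perf\<^sup>s(B,f)\<close>.
\<close>

definition verdier_quotient_s ::
  "('b, 'x) ring_scheme \<Rightarrow> nat \<Rightarrow> (nat \<Rightarrow> 'b) \<Rightarrow>
     ('b kdg, ('b kdg, (int \<Rightarrow> (nat \<Rightarrow> 'b) \<Rightarrow> (nat \<Rightarrow> 'b)) set) step list set) category" where
  "verdier_quotient_s B n f = localization (homotopy_cat B n (coh_s B n f))
     (\<lambda>E F. {\<alpha> \<in> closed_maps B n E F // homotopic B n E F. \<exists>s\<in>\<alpha>. cone_dg E F s \<in> perf_s B n f})"

text \<open>
  The homotopy category of the dg category \<open>Sing(B,f)\<close> of relative singularities, the quotient
  \<open>Coh\<^sup>s(B,f) / Perf\<^sup>s(B,f)\<close> in idempotent complete triangulated dg categories.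
\<close>

definition sing_cat ::
  "('b, 'x) ring_scheme \<Rightarrow> nat \<Rightarrow> (nat \<Rightarrow> 'b) \<Rightarrow>
     ('b kdg \<times> ('b kdg, (int \<Rightarrow> (nat \<Rightarrow> 'b) \<Rightarrow> (nat \<Rightarrow> 'b)) set) step list set,
      ('b kdg, (int \<Rightarrow> (nat \<Rightarrow> 'b) \<Rightarrow> (nat \<Rightarrow> 'b)) set) step list set) category" where
  "sing_cat B n f = idem_completion (verdier_quotient_s B n f)"

definition represented_by ::
  "('b, 'x) ring_scheme \<Rightarrow> nat \<Rightarrow> (nat \<Rightarrow> 'b) \<Rightarrow>
     'b kdg \<times> ('b kdg, (int \<Rightarrow> (nat \<Rightarrow> 'b) \<Rightarrow> (nat \<Rightarrow> 'b)) set) step list set \<Rightarrow> 'b kdg \<Rightarrow> bool" where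
  "represented_by B n f Y E \<longleftrightarrow> E \<in> coh_s B n f \<and>
     isomorphic (sing_cat B n f) Y (E, Ident (verdier_quotient_s B n f) E)"

definition affine_LG_model ::
  "('a, 'x) ring_scheme \<Rightarrow> nat \<Rightarrow> ('a, 'b) module \<Rightarrow> (nat \<Rightarrow> 'b) \<Rightarrow> bool" where
  "affine_LG_model A n B f \<longleftrightarrow> algebra A B \<and> flat_module A B \<and> finite_type_algebra A B \<and>
     (\<forall>i\<in>{1..n}. f i \<in> carrier B)"

end

theory Submission
  imports Defs
begin

text \<open>
  Write \<open>K\<close> for the Koszul algebra and let \<open>X\<close> be an object of \<open>Coh\<^sup>s\<close> in degrees \<open>a..b\<close> with \<open>b - a > n\<close>.
  Every \<open>x\<close> of degree \<open>b\<close> is a cycle, so it defines a map \<open>K[-b] \<rightarrow> X\<close>, \<open>1 \<mapsto> x\<close>. Its cone \<open>C\<close> is again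
  in degrees \<open>a..b\<close>, because \<open>K\<close> is in degrees \<open>-n..0\<close>; in \<open>C\<close> the class of \<open>x\<close> modulo boundaries is
  killed; and \<open>X \<rightarrow> C\<close> becomes invertible in the Verdier quotient, its cone being quasi-isomorphic to
  \<open>K[1-b]\<close>. Doing this for finitely many generators makes the last differential surjective. Its
  target being projective, it splits, so the truncation obtained by replacing the last two terms
  with the kernel is in \<open>Coh\<^sup>s\<close> and in degrees \<open>a..b - 1\<close>; its inclusion is a quasi-isomorphism, so
  it has an acyclic, hence perfect, cone. By induction \<open>X\<close> becomes isomorphic to an object in \<open>n + 1\<close>
  degrees, and an object of the idempotent completion is a retract of some \<open>X\<close>.
\<close>

section \<open>Zigzags and localizations\<close>

text \<open>The bound comes from the index shift in a cone: \<open>K[-b]\<close> occupies degrees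
  \<open>b - n\<close> to \<open>b\<close>, so it contributes to the cone in degrees
  \<open>b - n - 1\<close> to \<open>b - 1\<close>. Nothing is added at the top, and the bottom
  stays at \<open>a\<close> exactly while \<open>b - a > n\<close>. The top is the convenient end
  for strict models: a kernel of a surjection onto a projective module is a direct summand, while
  truncation at the bottom would form cokernels, which need not be projective. The
  \<open>\<epsilon>\<^sub>i\<close> lower degrees, so they respect the truncation as well. The main
  obstacle is that \<open>perfect_dg\<close> offers only shifts, cones and retracts in the derived
  category. Quasi-isomorphism invariance is gained by reading a quasi-isomorphism as a retract,
  acyclic modules are compared with the cone of the identity of \<open>K\<close>, and the rotated
  triangle gets an explicit quasi-isomorphism. The map \<open>K -> X\<close> must commute strictly
  with the differential and every \<open>\<epsilon>\<^sub>i\<close>, whence the sign computations on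
  monomials. Invertible maps are followed only as one-sided retracts, which is what the claim asks
  for.\<close>

lemma zigzag_Obj:
  assumes "zigzag C W X p Y"
  shows "X \<in> Obj C" "Y \<in> Obj C"
  using assms by (induction rule: zigzag.induct) auto

lemma zigzag_append:
  assumes "zigzag C W X p Y" and "zigzag C W Y q Z"
  shows "zigzag C W X (p @ q) Z"
  using assms by (induction rule: zigzag.induct) (auto intro: zigzag.intros)

abbreviation zigzag_class ::
  "('o, 'm) category \<Rightarrow> ('o \<Rightarrow> 'o \<Rightarrow> 'm set) \<Rightarrow> 'o \<Rightarrow> 'o \<Rightarrow> ('o, 'm) step list \<Rightarrow> ('o, 'm) step list set"
  where "zigzag_class C W X Y p \<equiv> zigzag_rel C W X Y `` {p}"

lemma zigzag_class_eqI:
  "zigzag_eq C W X Y p q \<Longrightarrow> zigzag_class C W X Y p = zigzag_class C W X Y q"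
  unfolding zigzag_rel_def by (auto intro: zigzag_eq.sym zigzag_eq.trans)

text \<open>The rule of reflexivity asks for a zigzag, hence the hypothesis on \<open>q\<close>: it
  puts \<open>q\<close> into its own class and so into that of \<open>p\<close>.\<close>

lemma zigzag_eqI:
  assumes "zigzag C W X q Y" and "zigzag_class C W X Y p = zigzag_class C W X Y q"
  shows "zigzag_eq C W X Y p q"
  using assms zigzag_eq.refl[OF assms(1)] unfolding zigzag_rel_def by blast

text \<open>Composition in the localization ranges over all pairs of representatives. Congruence
  makes their concatenations equivalent, and reflexivity, available because \<open>p\<close> and
  \<open>q\<close> are zigzags, shows that \<open>p @ q\<close> is one of them.\<close>

lemma Cmp_localization:
  assumes "zigzag C W X p Y" and "zigzag C W Y q Z"
  shows "Cmp (localization C W) X Y Z (zigzag_class C W Y Z q) (zigzag_class C W X Y p)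
    = zigzag_class C W X Z (p @ q)" (is "?lhs = ?rhs")
proof
  show "?lhs \<subseteq> ?rhs"
    unfolding localization_def zigzag_rel_def
    by (auto intro: zigzag_eq.trans zigzag_eq.cong)
  show "?rhs \<subseteq> ?lhs"
    using zigzag_eq.refl[OF assms(1)] zigzag_eq.refl[OF assms(2)]
    unfolding localization_def zigzag_rel_def by auto
qed

lemma Mor_localizationI:
  "zigzag C W X p Y \<Longrightarrow> zigzag_class C W X Y p \<in> Mor (localization C W) X Y"
  unfolding localization_def by (auto intro: quotientI)

lemma Mor_localizationE:
  assumes "\<alpha> \<in> Mor (localization C W) X Y"
  obtains p where "zigzag C W X p Y" "\<alpha> = zigzag_class C W X Y p"
  using assms unfolding localization_def by (auto elim: quotientE)

lemma Ident_localization: "Ident (localization C W) X = zigzag_class C W X X []"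
  by (simp add: localization_def)

lemma Obj_localization: "Obj (localization C W) = Obj C"
  by (simp add: localization_def)

text \<open>A retract in the localization, stated on representatives, so that transitivity and
  absorption of idempotents become manipulations of lists.\<close>

definition zigzag_retract ::
  "('o, 'm) category \<Rightarrow> ('o \<Rightarrow> 'o \<Rightarrow> 'm set) \<Rightarrow> 'o \<Rightarrow> 'o \<Rightarrow> bool" where
  "zigzag_retract C W X Y \<longleftrightarrow>
     (\<exists>p q. zigzag C W X p Y \<and> zigzag C W Y q X \<and> zigzag_eq C W X X (p @ q) [])"

lemma zigzag_retract_refl: "X \<in> Obj C \<Longrightarrow> zigzag_retract C W X X"
  unfolding zigzag_retract_def
  by (rule exI[of _ "[]"], rule exI[of _ "[]"]) (auto intro: zigzag.nil zigzag_eq.refl)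

text \<open>The inner round trip through \<open>Z\<close> cancels first, then the outer one through
  \<open>Y\<close>.\<close>

lemma zigzag_retract_trans:
  assumes "zigzag_retract C W X Y" and "zigzag_retract C W Y Z"
  shows "zigzag_retract C W X Z"
proof -
  obtain p q where pq: "zigzag C W X p Y" "zigzag C W Y q X" "zigzag_eq C W X X (p @ q) []"
    using assms(1) unfolding zigzag_retract_def by blast
  obtain p' q' where pq': "zigzag C W Y p' Z" "zigzag C W Z q' Y" "zigzag_eq C W Y Y (p' @ q') []"
    using assms(2) unfolding zigzag_retract_def by blast
  have "zigzag_eq C W X X (p @ (p' @ q') @ q) (p @ [] @ q)"
    using pq pq' by (intro zigzag_eq.cong[where Y = Y] zigzag_eq.refl)
  then have "zigzag_eq C W X X ((p @ p') @ (q' @ q)) []"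
    using pq(3) by (auto intro: zigzag_eq.trans)
  moreover have "zigzag C W X (p @ p') Z" "zigzag C W Z (q' @ q) X"
    using zigzag_append[OF pq(1) pq'(1)] zigzag_append[OF pq'(2) pq(2)] .
  ultimately show ?thesis unfolding zigzag_retract_def by blast
qed

text \<open>Both orientations are needed: cones come with a map out of \<open>X\<close>, truncations
  with a map into it. Membership in \<open>Mor\<close> is a separate hypothesis because
  \<open>W\<close> is an arbitrary family.\<close>

lemma zigzag_retract_forward:
  assumes "X \<in> Obj C" "Y \<in> Obj C" "w \<in> W X Y" "w \<in> Mor C X Y"
  shows "zigzag_retract C W X Y"
  unfolding zigzag_retract_def
  using assms zigzag_eq.inv_right[of X C Y w W]
  by (intro exI[of _ "[Fwd X Y w]"] exI[of _ "[Bwd Y X w]"]) (auto intro: zigzag.intros)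

lemma zigzag_retract_backward:
  assumes "X \<in> Obj C" "Y \<in> Obj C" "w \<in> W Y X" "w \<in> Mor C Y X"
  shows "zigzag_retract C W X Y"
  unfolding zigzag_retract_def
  using assms zigzag_eq.inv_left[of Y C X w W]
  by (intro exI[of _ "[Bwd X Y w]"] exI[of _ "[Fwd Y X w]"]) (auto intro: zigzag.intros)

lemma retract_of_localization:
  assumes "zigzag_retract C W X Y"
  shows "retract_of (localization C W) X Y"
proof -
  obtain p q where pq: "zigzag C W X p Y" "zigzag C W Y q X" "zigzag_eq C W X X (p @ q) []"
    using assms unfolding zigzag_retract_def by blast
  show ?thesis
    unfolding retract_of_def Obj_localization Ident_localization
    using zigzag_Obj[OF pq(1)] Mor_localizationI[OF pq(1)] Mor_localizationI[OF pq(2)]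
      Cmp_localization[OF pq(1,2)] zigzag_class_eqI[OF pq(3)] by metis
qed

section \<open>Idempotent completion of a localization\<close>

lemma Ident_in_idem_completion:
  assumes "Y \<in> Obj C"
  shows "(Y, Ident (localization C W) Y) \<in> Obj (idem_completion (localization C W))"
proof -
  have nil: "zigzag C W Y [] Y" using assms by (rule zigzag.nil)
  show ?thesis
    using assms Mor_localizationI[OF nil] Cmp_localization[OF nil nil]
    by (simp add: idem_completion_def Obj_localization Ident_localization)
qed

lemma isomorphic_idem_completion_refl:
  assumes "Y \<in> Obj C"
  shows "isomorphic (idem_completion (localization C W))
    (Y, Ident (localization C W) Y) (Y, Ident (localization C W) Y)"
proof -
  have nil: "zigzag C W Y [] Y" using assms by (rule zigzag.nil)
  let ?i = "zigzag_class C W Y Y []"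
  have "Cmp (localization C W) Y Y Y ?i ?i = ?i" using Cmp_localization[OF nil nil] by simp
  then show ?thesis
    using Ident_in_idem_completion[OF assms, of W] Mor_localizationI[OF nil]
    unfolding isomorphic_def
    by (auto simp: idem_completion_def Ident_localization intro!: bexI[of _ ?i])
qed

text \<open>The section \<open>X \<rightarrow> Y\<close> and the retraction \<open>Y \<rightarrow> X\<close> are both composed with the idempotent \<open>e\<close>.\<close>

lemma retract_of_idem_completion:
  assumes "zigzag_retract C W X Y" and "(X, e) \<in> Obj (idem_completion (localization C W))"
  shows "retract_of (idem_completion (localization C W)) (X, e) (Y, Ident (localization C W) Y)"
proof -
  let ?L = "localization C W"
  obtain p q where pq: "zigzag C W X p Y" "zigzag C W Y q X" "zigzag_eq C W X X (p @ q) []"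
    using assms(1) unfolding zigzag_retract_def by blast
  have e: "e \<in> Mor ?L X X" "Cmp ?L X X X e e = e"
    using assms(2) unfolding idem_completion_def by auto
  obtain s where s: "zigzag C W X s X" "e = zigzag_class C W X X s"
    using e(1) by (rule Mor_localizationE)
  have "zigzag_class C W X X (s @ s) = zigzag_class C W X X s"
    using e(2) Cmp_localization[OF s(1) s(1)] s(2) by simp
  then have ss: "zigzag_eq C W X X (s @ s) s"
    by (rule zigzag_eqI[OF s(1)])
  have Y: "Y \<in> Obj C" using zigzag_Obj[OF pq(1)] by simp
  then have nil: "zigzag C W Y [] Y" by (rule zigzag.nil)
  have i: "zigzag C W X (s @ p) Y" and r: "zigzag C W Y (q @ s) X"
    using zigzag_append[OF s(1) pq(1)] zigzag_append[OF pq(2) s(1)] .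
  let ?i = "zigzag_class C W X Y (s @ p)" and ?r = "zigzag_class C W Y X (q @ s)"
  \<comment> \<open>A morphism of the Karoubi envelope must absorb the idempotents at both ends:
    \<open>e\<close> at \<open>X\<close>, here through \<open>s @ s\<close> being equivalent to
    \<open>s\<close>, and the identity at \<open>Y\<close>.\<close>
  have "zigzag_eq C W X Y ((s @ s) @ p) (s @ p)" "zigzag_eq C W Y X (q @ (s @ s)) (q @ s)"
    using zigzag_eq.cong[OF ss zigzag_eq.refl[OF pq(1)]]
      zigzag_eq.cong[OF zigzag_eq.refl[OF pq(2)] ss] .
  then have ie: "Cmp ?L X X Y ?i e = ?i" and er: "Cmp ?L Y X X e ?r = ?r"
    using Cmp_localization[OF s(1) i] Cmp_localization[OF r s(1)] s(2) zigzag_class_eqI by fastforce+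
  have i1: "Cmp ?L X Y Y (Ident ?L Y) ?i = ?i" and r1: "Cmp ?L Y Y X ?r (Ident ?L Y) = ?r"
    using Cmp_localization[OF i nil] Cmp_localization[OF nil r] by (simp_all add: Ident_localization)
  \<comment> \<open>The composite of section and retraction reduces to \<open>s @ s\<close>, hence
    to \<open>e\<close>, which is the identity of \<open>(X, e)\<close>.\<close>
  have "zigzag_eq C W X X (s @ (p @ q) @ s) (s @ [] @ s)"
    using s pq by (intro zigzag_eq.cong[where Y = X] zigzag_eq.refl)
  then have "zigzag_eq C W X X ((s @ p) @ (q @ s)) s"
    using ss by (auto intro: zigzag_eq.trans)
  then have "Cmp ?L X Y X ?r ?i = e"
    using Cmp_localization[OF i r] s(2) zigzag_class_eqI by metis
  then show ?thesis
    unfolding retract_of_def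
    using assms(2) Ident_in_idem_completion[OF Y, of W] ie er i1 r1 Mor_localizationI[OF i]
      Mor_localizationI[OF r]
    by (auto simp: idem_completion_def intro!: bexI[of _ ?i] bexI[of _ ?r])
qed

section \<open>Linear maps, direct sums, finitely generated and projective modules\<close>

context cring
begin

lemma lin_mapsI:
  assumes "\<And>x. x \<in> carrier M \<Longrightarrow> g x \<in> carrier N"
    and "\<And>x y. x \<in> carrier M \<Longrightarrow> y \<in> carrier M \<Longrightarrow> g (x \<oplus>\<^bsub>M\<^esub> y) = g x \<oplus>\<^bsub>N\<^esub> g y"
    and "\<And>r x. r \<in> carrier R \<Longrightarrow> x \<in> carrier M \<Longrightarrow> g (r \<odot>\<^bsub>M\<^esub> x) = r \<odot>\<^bsub>N\<^esub> g x"
  shows "g \<in> lin_maps R M N"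
  using assms unfolding lin_maps_def by blast

lemma lin_closed: "g \<in> lin_maps R M N \<Longrightarrow> x \<in> carrier M \<Longrightarrow> g x \<in> carrier N"
  unfolding lin_maps_def by blast

lemma lin_add:
  "g \<in> lin_maps R M N \<Longrightarrow> x \<in> carrier M \<Longrightarrow> y \<in> carrier M \<Longrightarrow> g (x \<oplus>\<^bsub>M\<^esub> y) = g x \<oplus>\<^bsub>N\<^esub> g y"
  unfolding lin_maps_def by blast

lemma lin_smult:
  "g \<in> lin_maps R M N \<Longrightarrow> r \<in> carrier R \<Longrightarrow> x \<in> carrier M \<Longrightarrow> g (r \<odot>\<^bsub>M\<^esub> x) = r \<odot>\<^bsub>N\<^esub> g x"
  unfolding lin_maps_def by blast

text \<open>\<open>lin_maps\<close> records only additivity and homogeneity; zero and negatives are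
  recovered as multiples by \<open>\<zero>\<close> and \<open>\<ominus> \<one>\<close>.\<close>

lemma lin_zero:
  assumes "module R M" "module R N" "g \<in> lin_maps R M N"
  shows "g \<zero>\<^bsub>M\<^esub> = \<zero>\<^bsub>N\<^esub>"
proof -
  interpret M: module R M by fact
  interpret N: module R N by fact
  have "g (\<zero> \<odot>\<^bsub>M\<^esub> \<zero>\<^bsub>M\<^esub>) = \<zero> \<odot>\<^bsub>N\<^esub> g \<zero>\<^bsub>M\<^esub>"
    by (rule lin_smult[OF assms(3)]) auto
  then show ?thesis using lin_closed[OF assms(3)] by simp
qed

lemma lin_neg:
  assumes "module R M" "module R N" "g \<in> lin_maps R M N" "x \<in> carrier M"
  shows "g (\<ominus>\<^bsub>M\<^esub> x) = \<ominus>\<^bsub>N\<^esub> g x"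
proof -
  interpret M: module R M by fact
  interpret N: module R N by fact
  have "g ((\<ominus> \<one>) \<odot>\<^bsub>M\<^esub> x) = (\<ominus> \<one>) \<odot>\<^bsub>N\<^esub> g x"
    using assms(4) by (intro lin_smult[OF assms(3)]) auto
  then show ?thesis using lin_closed[OF assms(3,4)] assms(4)
    by (simp add: M.smult_l_minus N.smult_l_minus)
qed

lemma lin_finsum:
  assumes "module R M" "module R N" "g \<in> lin_maps R M N" "finite A" "h \<in> A \<rightarrow> carrier M"
  shows "g (finsum M h A) = finsum N (\<lambda>a. g (h a)) A"
proof -
  interpret M: module R M by fact
  interpret N: module R N by fact
  show ?thesis using assms(4,5)
  proof (induction A rule: finite_induct)
    case empty
    then show ?case using lin_zero[OF assms(1-3)] by simp
  next
    case (insert a A)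
    then have "h a \<in> carrier M" "h \<in> A \<rightarrow> carrier M" by auto
    moreover from this have "g (h a) \<in> carrier N" "(\<lambda>a. g (h a)) \<in> A \<rightarrow> carrier N"
      using lin_closed[OF assms(3)] by auto
    ultimately show ?case using insert lin_add[OF assms(3)] by simp
  qed
qed

lemma lin_comp:
  "g \<in> lin_maps R M N \<Longrightarrow> h \<in> lin_maps R N L \<Longrightarrow> (\<lambda>x. h (g x)) \<in> lin_maps R M L"
  by (rule lin_mapsI) (auto simp: lin_closed lin_add lin_smult)

lemma lin_id: "(\<lambda>x. x) \<in> lin_maps R M M"
  by (rule lin_mapsI) auto

lemma lin_zero_map: "module R N \<Longrightarrow> (\<lambda>x. \<zero>\<^bsub>N\<^esub>) \<in> lin_maps R M N"
proof (rule lin_mapsI)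
  assume "module R N"
  then interpret N: module R N .
  show "\<zero>\<^bsub>N\<^esub> = \<zero>\<^bsub>N\<^esub> \<oplus>\<^bsub>N\<^esub> \<zero>\<^bsub>N\<^esub>" by simp
qed (auto simp: module.smult_r_null abelian_group.axioms module_def abelian_monoid.zero_closed)

lemma lin_plus_map:
  assumes "module R N" "g \<in> lin_maps R M N" "h \<in> lin_maps R M N"
  shows "(\<lambda>x. g x \<oplus>\<^bsub>N\<^esub> h x) \<in> lin_maps R M N"
proof -
  interpret N: module R N by fact
  show ?thesis
    by (rule lin_mapsI)
       (auto simp: lin_closed[OF assms(2)] lin_closed[OF assms(3)] lin_add[OF assms(2)]
          lin_add[OF assms(3)] lin_smult[OF assms(2)] lin_smult[OF assms(3)] N.smult_r_distr N.a_ac)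
qed

lemma lin_neg_map:
  assumes "module R N" "g \<in> lin_maps R M N"
  shows "(\<lambda>x. \<ominus>\<^bsub>N\<^esub> g x) \<in> lin_maps R M N"
proof -
  interpret N: module R N by fact
  show ?thesis
    by (rule lin_mapsI)
       (auto simp: lin_closed[OF assms(2)] lin_add[OF assms(2)] lin_smult[OF assms(2)]
          N.smult_r_minus N.minus_add)
qed

end


subsection \<open>Direct sums\<close>

lemma seq_fst_interleave [simp]: "seq_fst (interleave x y) = x"
  by (simp add: seq_fst_def interleave_def fun_eq_iff)

lemma seq_snd_interleave [simp]: "seq_snd (interleave x y) = y"
  by (simp add: seq_snd_def interleave_def fun_eq_iff)

lemma interleave_seq [simp]: "interleave (seq_fst w) (seq_snd w) = w"
  by (auto simp: seq_fst_def seq_snd_def interleave_def fun_eq_iff elim: oddE)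

lemma interleave_eq_iff: "interleave x y = interleave x' y' \<longleftrightarrow> x = x' \<and> y = y'"
  by (metis seq_fst_interleave seq_snd_interleave)

lemma seq_eq_iff: "u = v \<longleftrightarrow> seq_fst u = seq_fst v \<and> seq_snd u = seq_snd v"
  by (metis interleave_seq)

lemma dsum_carrier_iff:
  "w \<in> carrier (dsum M N) \<longleftrightarrow> seq_fst w \<in> carrier M \<and> seq_snd w \<in> carrier N"
  unfolding dsum_def by (auto) (metis interleave_seq)

lemma dsum_simps:
  "\<zero>\<^bsub>dsum M N\<^esub> = interleave \<zero>\<^bsub>M\<^esub> \<zero>\<^bsub>N\<^esub>"
  "u \<oplus>\<^bsub>dsum M N\<^esub> v =
     interleave (seq_fst u \<oplus>\<^bsub>M\<^esub> seq_fst v) (seq_snd u \<oplus>\<^bsub>N\<^esub> seq_snd v)"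
  "r \<odot>\<^bsub>dsum M N\<^esub> u = interleave (r \<odot>\<^bsub>M\<^esub> seq_fst u) (r \<odot>\<^bsub>N\<^esub> seq_snd u)"
  by (simp_all add: dsum_def)

context cring
begin

lemma module_dsum:
  assumes "module R M" "module R N"
  shows "module R (dsum M N)"
proof -
  interpret M: module R M by fact
  interpret N: module R N by fact
  have "abelian_group (dsum M N)"
  proof (rule abelian_groupI)
    fix x assume "x \<in> carrier (dsum M N)"
    then show "\<exists>y\<in>carrier (dsum M N). y \<oplus>\<^bsub>dsum M N\<^esub> x = \<zero>\<^bsub>dsum M N\<^esub>"
      by (intro bexI[of _ "interleave (\<ominus>\<^bsub>M\<^esub> seq_fst x) (\<ominus>\<^bsub>N\<^esub> seq_snd x)"])
         (auto simp: dsum_carrier_iff dsum_simps M.l_neg N.l_neg)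
  qed (auto simp: dsum_carrier_iff dsum_simps M.a_ac N.a_ac)
  then show ?thesis
    by (rule moduleI[OF cring_axioms])
       (auto simp: dsum_carrier_iff dsum_simps M.smult_l_distr N.smult_l_distr M.smult_r_distr
         N.smult_r_distr M.smult_assoc1 N.smult_assoc1)
qed

lemma lin_seq_fst: "seq_fst \<in> lin_maps R (dsum M N) M"
  and lin_seq_snd: "seq_snd \<in> lin_maps R (dsum M N) N"
  by (auto intro!: lin_mapsI simp: dsum_carrier_iff dsum_simps)

lemma lin_interleave:
  assumes "g \<in> lin_maps R L M" "h \<in> lin_maps R L N"
  shows "(\<lambda>x. interleave (g x) (h x)) \<in> lin_maps R L (dsum M N)"
  using assms by (auto intro!: lin_mapsI simp: dsum_carrier_iff dsum_simps lin_closed lin_add lin_smult)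

lemma lin_inl: "module R N \<Longrightarrow> (\<lambda>x. interleave x \<zero>\<^bsub>N\<^esub>) \<in> lin_maps R M (dsum M N)"
  by (intro lin_interleave lin_id lin_zero_map)

lemma lin_inr: "module R M \<Longrightarrow> (\<lambda>x. interleave \<zero>\<^bsub>M\<^esub> x) \<in> lin_maps R N (dsum M N)"
  by (intro lin_interleave lin_id lin_zero_map)


subsection \<open>Finitely generated and projective modules\<close>

lemma submoduleI':
  assumes "module R M" "H \<subseteq> carrier M" "\<zero>\<^bsub>M\<^esub> \<in> H"
    and "\<And>x y. x \<in> H \<Longrightarrow> y \<in> H \<Longrightarrow> x \<oplus>\<^bsub>M\<^esub> y \<in> H"
    and "\<And>r x. r \<in> carrier R \<Longrightarrow> x \<in> H \<Longrightarrow> r \<odot>\<^bsub>M\<^esub> x \<in> H"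
  shows "submodule H R M"
proof -
  interpret M: module R M by fact
  have "\<ominus>\<^bsub>M\<^esub> x \<in> H" if "x \<in> H" for x
    using assms(5)[of "\<ominus> \<one>" x] that assms(2) by (auto simp: M.smult_l_minus subset_iff)
  then show ?thesis using assms by (intro M.submoduleI) auto
qed

lemma submodule_vimage:
  assumes "module R M" "module R N" "g \<in> lin_maps R M N" "submodule H R N"
  shows "submodule {x \<in> carrier M. g x \<in> H} R M"
proof -
  interpret M: module R M by fact
  interpret N: module R N by fact
  note H = N.submoduleE[OF assms(4)]
  have "\<zero>\<^bsub>N\<^esub> \<in> H" using assms(4) by (metis add.comm_inv_char submodule_def subgroup.one_closed monoid.select_convs(2))
  then show ?thesis
    using H lin_zero[OF assms(1-3)] lin_add[OF assms(3)] lin_smult[OF assms(3)]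
    by (intro submoduleI'[OF assms(1)]) auto
qed

lemma submodule_image:
  assumes "module R M" "module R N" "g \<in> lin_maps R M N"
  shows "submodule (g ` carrier M) R N"
proof -
  interpret M: module R M by fact
  show ?thesis
  proof (rule submoduleI'[OF assms(2)])
    show "\<zero>\<^bsub>N\<^esub> \<in> g ` carrier M" using lin_zero[OF assms] by (metis M.zero_closed imageI)
  qed (auto simp: lin_closed[OF assms(3)] lin_add[OF assms(3), symmetric]
        lin_smult[OF assms(3), symmetric])
qed

text \<open>Generation is phrased through submodules that contain the generators. Such a submodule
  of \<open>N\<close> is pulled back along \<open>g\<close>, where it has to be everything.\<close>

lemma fin_gen_module_image:
  assumes "fin_gen_module R M" "module R N" "g \<in> lin_maps R M N" "g ` carrier M = carrier N"
  shows "fin_gen_module R N"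
proof -
  have M: "module R M" using assms(1) by (simp add: fin_gen_module_def)
  obtain S where S: "finite S" "S \<subseteq> carrier M"
    "\<And>H. submodule H R M \<Longrightarrow> S \<subseteq> H \<Longrightarrow> H = carrier M"
    using assms(1) unfolding fin_gen_module_def by blast
  have "H = carrier N" if H: "submodule H R N" "g ` S \<subseteq> H" for H
  proof -
    have "{x \<in> carrier M. g x \<in> H} = carrier M"
      using H S(2) by (intro S(3) submodule_vimage[OF M assms(2,3)]) auto
    then have "g x \<in> H" if "x \<in> carrier M" for x using that by blast
    then have "carrier N \<subseteq> H" unfolding assms(4)[symmetric] by blast
    then show ?thesis using module.submoduleE(1)[OF assms(2) H(1)] by blast
  qed
  then show ?thesis
    using S assms(2) lin_closed[OF assms(3)] unfolding fin_gen_module_def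
    by (intro conjI exI[of _ "g ` S"]) auto
qed

lemma fin_gen_module_dsum:
  assumes "fin_gen_module R M" "fin_gen_module R N"
  shows "fin_gen_module R (dsum M N)"
proof -
  have M: "module R M" and N: "module R N" using assms by (simp_all add: fin_gen_module_def)
  note D = module_dsum[OF M N]
  interpret M: module R M by (rule M)
  interpret N: module R N by (rule N)
  interpret D: module R "dsum M N" by (rule D)
  obtain S where S: "finite S" "S \<subseteq> carrier M"
    "\<And>H. submodule H R M \<Longrightarrow> S \<subseteq> H \<Longrightarrow> H = carrier M"
    using assms(1) unfolding fin_gen_module_def by blast
  obtain T where T: "finite T" "T \<subseteq> carrier N"
    "\<And>H. submodule H R N \<Longrightarrow> T \<subseteq> H \<Longrightarrow> H = carrier N"
    using assms(2) unfolding fin_gen_module_def by blast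
  let ?l = "\<lambda>x. interleave x \<zero>\<^bsub>N\<^esub>" and ?r = "\<lambda>x. interleave \<zero>\<^bsub>M\<^esub> x"
  have "H = carrier (dsum M N)" if H: "submodule H R (dsum M N)" "?l ` S \<union> ?r ` T \<subseteq> H" for H
  proof -
    have "{x \<in> carrier M. ?l x \<in> H} = carrier M" "{x \<in> carrier N. ?r x \<in> H} = carrier N"
      using H S(2) T(2)
      by (intro S(3) T(3) submodule_vimage[OF _ D] M N lin_inl lin_inr; auto)+
    then have "?l (seq_fst w) \<oplus>\<^bsub>dsum M N\<^esub> ?r (seq_snd w) \<in> H" if "w \<in> carrier (dsum M N)" for w
      using that D.submoduleE(5)[OF H(1)] by (auto simp: dsum_carrier_iff)
    moreover have "?l (seq_fst w) \<oplus>\<^bsub>dsum M N\<^esub> ?r (seq_snd w) = w" if "w \<in> carrier (dsum M N)" for w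
      using that by (auto simp: dsum_carrier_iff dsum_simps)
    ultimately show ?thesis using D.submoduleE(1)[OF H(1)] by auto
  qed
  moreover have "?l ` S \<union> ?r ` T \<subseteq> carrier (dsum M N)"
    using S(2) T(2) by (auto simp: dsum_carrier_iff)
  ultimately show ?thesis
    using S(1) T(1) D unfolding fin_gen_module_def
    by (intro conjI exI[of _ "?l ` S \<union> ?r ` T"]) auto
qed

lemma projective_moduleD:
  fixes M N L :: "'a bmod"
  assumes "projective_module R M" "module R N" "module R L" "p \<in> lin_maps R N L"
    "p ` carrier N = carrier L" "g \<in> lin_maps R M L"
  obtains g' where "g' \<in> lin_maps R M N" "\<And>x. x \<in> carrier M \<Longrightarrow> p (g' x) = g x"
  using assms unfolding projective_module_def by blast

text \<open>A map out of \<open>M'\<close> is extended to \<open>M\<close> through \<open>r\<close>,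
  lifted there, and restricted again along \<open>i\<close>.\<close>

lemma projective_module_retract:
  assumes "projective_module R M" "module R M'" "i \<in> lin_maps R M' M" "r \<in> lin_maps R M M'"
    and "\<And>x. x \<in> carrier M' \<Longrightarrow> r (i x) = x"
  shows "projective_module R M'"
  unfolding projective_module_def
proof (intro conjI allI impI)
  fix N L :: "'a bmod" and p g
  assume a: "module R N \<and> module R L \<and> p \<in> lin_maps R N L \<and> p ` carrier N = carrier L \<and>
    g \<in> lin_maps R M' L"
  then obtain h where h: "h \<in> lin_maps R M N" "\<And>x. x \<in> carrier M \<Longrightarrow> p (h x) = g (r x)"
    using projective_moduleD[OF assms(1), of N L p "\<lambda>x. g (r x)"] lin_comp[OF assms(4)] by metis
  show "\<exists>g'\<in>lin_maps R M' N. \<forall>x\<in>carrier M'. p (g' x) = g x"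
    using h lin_comp[OF assms(3) h(1)] assms(5) lin_closed[OF assms(3)]
    by (intro bexI[of _ "\<lambda>x. h (i x)"]) auto
qed (fact assms(2))

lemma projective_module_dsum:
  assumes "projective_module R M" "projective_module R N"
  shows "projective_module R (dsum M N)"
proof -
  have M: "module R M" and N: "module R N" using assms by (simp_all add: projective_module_def)
  interpret M: module R M by (rule M)
  interpret N: module R N by (rule N)
  show ?thesis unfolding projective_module_def
  proof (intro conjI allI impI)
    fix P L :: "'a bmod" and p g
    assume a: "module R P \<and> module R L \<and> p \<in> lin_maps R P L \<and> p ` carrier P = carrier L \<and>
      g \<in> lin_maps R (dsum M N) L"
    obtain h where h: "h \<in> lin_maps R M P"
      "\<And>x. x \<in> carrier M \<Longrightarrow> p (h x) = g (interleave x \<zero>\<^bsub>N\<^esub>)"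
      using projective_moduleD[OF assms(1), of P L p "\<lambda>x. g (interleave x \<zero>\<^bsub>N\<^esub>)"] a
        lin_comp[OF lin_inl[OF N]] by metis
    obtain k where k: "k \<in> lin_maps R N P"
      "\<And>x. x \<in> carrier N \<Longrightarrow> p (k x) = g (interleave \<zero>\<^bsub>M\<^esub> x)"
      using projective_moduleD[OF assms(2), of P L p "\<lambda>x. g (interleave \<zero>\<^bsub>M\<^esub> x)"] a
        lin_comp[OF lin_inr[OF M]] by metis
    have "(\<lambda>w. h (seq_fst w) \<oplus>\<^bsub>P\<^esub> k (seq_snd w)) \<in> lin_maps R (dsum M N) P"
      using a by (intro lin_plus_map lin_comp[OF lin_seq_fst h(1)] lin_comp[OF lin_seq_snd k(1)]) auto
    moreover have "p (h (seq_fst w) \<oplus>\<^bsub>P\<^esub> k (seq_snd w)) = g w" if w: "w \<in> carrier (dsum M N)" for w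
    proof -
      have "p (h (seq_fst w) \<oplus>\<^bsub>P\<^esub> k (seq_snd w))
        = g (interleave (seq_fst w) \<zero>\<^bsub>N\<^esub>) \<oplus>\<^bsub>L\<^esub> g (interleave \<zero>\<^bsub>M\<^esub> (seq_snd w))"
        using w a h k by (auto simp: dsum_carrier_iff lin_add lin_closed)
      also have "\<dots> = g (interleave (seq_fst w) \<zero>\<^bsub>N\<^esub> \<oplus>\<^bsub>dsum M N\<^esub> interleave \<zero>\<^bsub>M\<^esub> (seq_snd w))"
        using w a by (subst lin_add[where g = g and M = "dsum M N" and N = L]) (auto simp: dsum_carrier_iff)
      also have "\<dots> = g w" using w by (auto simp: dsum_carrier_iff dsum_simps)
      finally show ?thesis .
    qed
    ultimately show "\<exists>g'\<in>lin_maps R (dsum M N) P. \<forall>x\<in>carrier (dsum M N). p (g' x) = g x"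
      by (intro bexI) auto
  qed (rule module_dsum[OF M N])
qed

text \<open>\<open>strictly_perfect\<close> constrains every degree, including those in which a
  truncation has been made zero.\<close>

lemma module_trivial:
  assumes "module R M" "carrier M = {\<zero>\<^bsub>M\<^esub>}"
  shows "fin_gen_module R M" "projective_module R M"
proof -
  interpret M: module R M by fact
  show "fin_gen_module R M"
    unfolding fin_gen_module_def
    using assms M.submoduleE(1)
    by (intro conjI exI[of _ "{\<zero>\<^bsub>M\<^esub>}"]) blast+
  show "projective_module R M"
    unfolding projective_module_def
  proof (intro conjI allI impI)
    fix P L :: "'a bmod" and p g
    assume a: "module R P \<and> module R L \<and> p \<in> lin_maps R P L \<and> p ` carrier P = carrier L \<and>
      g \<in> lin_maps R M L"
    then show "\<exists>g'\<in>lin_maps R M P. \<forall>x\<in>carrier M. p (g' x) = g x"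
      using assms(2) lin_zero[of P L p] lin_zero[OF assms(1), of L g] lin_zero_map[of P M]
      by (intro bexI[of _ "\<lambda>x. \<zero>\<^bsub>P\<^esub>"]) simp_all
  qed (fact assms(1))
qed

end

section \<open>Finite free modules\<close>

text \<open>In the induction the new row and the new column cancel entry by entry. The diagonal is a
  separate hypothesis because antisymmetry gives only \<open>g a a \<oplus> g a a = \<zero>\<close>.
  This is the cancellation behind \<open>d\<^sup>2 = 0\<close> for the Koszul differential.\<close>

lemma (in abelian_group) finsum_antisymmetric:
  assumes "finite A" "\<And>a b. a \<in> A \<Longrightarrow> b \<in> A \<Longrightarrow> g a b \<in> carrier G"
    and "\<And>a. a \<in> A \<Longrightarrow> g a a = \<zero>" "\<And>a b. a \<in> A \<Longrightarrow> b \<in> A \<Longrightarrow> g a b \<oplus> g b a = \<zero>"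
  shows "finsum G (\<lambda>a. finsum G (\<lambda>b. g a b) A) A = \<zero>"
  using assms
proof (induction A rule: finite_induct)
  case (insert a A)
  note c = insert.prems(1)
  have 1: "(\<lambda>b. g a b) \<in> A \<rightarrow> carrier G" "(\<lambda>b. g b a) \<in> A \<rightarrow> carrier G"
    "(\<lambda>x. finsum G (g x) A) \<in> A \<rightarrow> carrier G"
    using c by (auto intro!: finsum_closed)
  have "finsum G (\<lambda>x. finsum G (\<lambda>b. g x b) (insert a A)) A
    = finsum G (\<lambda>x. g x a \<oplus> finsum G (\<lambda>b. g x b) A) A"
    using insert c by (intro finsum_cong') (auto intro!: finsum_insert finsum_closed)
  also have "\<dots> = finsum G (\<lambda>b. g b a) A \<oplus> \<zero>"
    using 1 insert by (simp add: finsum_addf)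
  finally have 2: "finsum G (\<lambda>x. finsum G (\<lambda>b. g x b) (insert a A)) A = finsum G (\<lambda>b. g b a) A"
    using 1 by simp
  have 3: "finsum G (g a) (insert a A) = finsum G (g a) A"
    using insert 1 by simp
  have "finsum G (g a) A \<oplus> finsum G (\<lambda>b. g b a) A = finsum G (\<lambda>b. g a b \<oplus> g b a) A"
    using 1 by (simp add: finsum_addf)
  also have "\<dots> = \<zero>" using insert by (intro add.finprod_one_eqI) auto
  finally show ?case
    using insert 1 2 3 c by (subst finsum_insert) (auto intro!: finsum_closed)
qed simp

text \<open>For finite \<open>D\<close>, the free module on \<open>D\<close>. The record repeats the
  one inside \<open>koszul_algebra\<close>, with its condition on supports replaced by membership in
  \<open>D\<close>, so that \<open>deg_koszul_algebra\<close> is an equality of records.\<close>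

definition coeff_module :: "('b, 'x) ring_scheme \<Rightarrow> nat set \<Rightarrow> 'b bmod" where
  "coeff_module R D =
     \<lparr>carrier = {v. \<forall>c. v c \<in> carrier R \<and> (v c \<noteq> \<zero>\<^bsub>R\<^esub> \<longrightarrow> c \<in> D)},
      mult = undefined, one = undefined,
      ring.zero = (\<lambda>c. \<zero>\<^bsub>R\<^esub>),
      add = (\<lambda>u v c. u c \<oplus>\<^bsub>R\<^esub> v c),
      smult = (\<lambda>b v c. b \<otimes>\<^bsub>R\<^esub> v c)\<rparr>"

context cring
begin

lemma coeff_carrier_iff:
  "v \<in> carrier (coeff_module R D) \<longleftrightarrow> (\<forall>c. v c \<in> carrier R) \<and> (\<forall>c. c \<notin> D \<longrightarrow> v c = \<zero>)"
  by (auto simp: coeff_module_def)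

lemma coeff_simps:
  "\<zero>\<^bsub>coeff_module R D\<^esub> = (\<lambda>c. \<zero>)"
  "u \<oplus>\<^bsub>coeff_module R D\<^esub> v = (\<lambda>c. u c \<oplus> v c)"
  "b \<odot>\<^bsub>coeff_module R D\<^esub> v = (\<lambda>c. b \<otimes> v c)"
  by (auto simp: coeff_module_def)

lemma module_coeff: "module R (coeff_module R D)"
proof -
  have "abelian_group (coeff_module R D)"
  proof (rule abelian_groupI)
    fix v assume "v \<in> carrier (coeff_module R D)"
    then show "\<exists>y\<in>carrier (coeff_module R D). y \<oplus>\<^bsub>coeff_module R D\<^esub> v = \<zero>\<^bsub>coeff_module R D\<^esub>"
      by (intro bexI[of _ "\<lambda>c. \<ominus> v c"]) (auto simp: coeff_carrier_iff coeff_simps l_neg)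
  qed (auto simp: coeff_carrier_iff coeff_simps a_ac)
  then show ?thesis
    by (rule moduleI[OF cring_axioms])
       (auto simp: coeff_carrier_iff coeff_simps l_distr r_distr m_assoc)
qed

lemma coeff_finsum:
  assumes "finite A" "h \<in> A \<rightarrow> carrier (coeff_module R D)"
  shows "finsum (coeff_module R D) h A c = finsum R (\<lambda>a. h a c) A"
proof -
  interpret M: module R "coeff_module R D" by (rule module_coeff)
  show ?thesis using assms
  proof (induction A rule: finite_induct)
    case (insert a A)
    then have "h a \<in> carrier (coeff_module R D)" "h \<in> A \<rightarrow> carrier (coeff_module R D)" by auto
    moreover from this have "h a c \<in> carrier R" "(\<lambda>a. h a c) \<in> A \<rightarrow> carrier R"
      by (auto simp: coeff_carrier_iff Pi_iff)
    ultimately show ?case using insert by (simp add: coeff_simps)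
  qed (simp add: coeff_simps)
qed

text \<open>As a function of \<open>v\<close>, this is the linear extension of the assignment of
  \<open>m c\<close> to the \<open>c\<close>-th basis vector.\<close>

definition lin_comb :: "nat set \<Rightarrow> 'a bmod \<Rightarrow> (nat \<Rightarrow> nat \<Rightarrow> 'a) \<Rightarrow> (nat \<Rightarrow> 'a) \<Rightarrow> (nat \<Rightarrow> 'a)" where
  "lin_comb D N m v = finsum N (\<lambda>c. v c \<odot>\<^bsub>N\<^esub> m c) D"

lemma lin_comb_lin:
  assumes "module R N" "finite D" "\<And>c. c \<in> D \<Longrightarrow> m c \<in> carrier N"
  shows "lin_comb D N m \<in> lin_maps R (coeff_module R D') N"
proof -
  interpret N: module R N by fact
  show ?thesis
  proof (rule lin_mapsI)
    fix v assume "v \<in> carrier (coeff_module R D')"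
    then show "lin_comb D N m v \<in> carrier N"
      using assms unfolding lin_comb_def by (auto intro!: N.finsum_closed simp: coeff_carrier_iff)
  next
    fix u v assume "u \<in> carrier (coeff_module R D')" "v \<in> carrier (coeff_module R D')"
    then have uv: "u c \<in> carrier R" "v c \<in> carrier R" for c by (auto simp: coeff_carrier_iff)
    then have "finsum N (\<lambda>c. (u c \<oplus> v c) \<odot>\<^bsub>N\<^esub> m c) D
      = finsum N (\<lambda>c. u c \<odot>\<^bsub>N\<^esub> m c \<oplus>\<^bsub>N\<^esub> v c \<odot>\<^bsub>N\<^esub> m c) D"
      using assms(3) by (intro N.finsum_cong') (auto simp: N.smult_l_distr)
    then show "lin_comb D N m (u \<oplus>\<^bsub>coeff_module R D'\<^esub> v) = lin_comb D N m u \<oplus>\<^bsub>N\<^esub> lin_comb D N m v"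
      using assms(3) uv unfolding lin_comb_def coeff_simps by (subst N.finsum_addf[symmetric]) auto
  next
    fix r v assume r: "r \<in> carrier R" and "v \<in> carrier (coeff_module R D')"
    then have v: "v c \<in> carrier R" for c by (auto simp: coeff_carrier_iff)
    then have "r \<odot>\<^bsub>N\<^esub> finsum N (\<lambda>c. v c \<odot>\<^bsub>N\<^esub> m c) D = finsum N (\<lambda>c. r \<odot>\<^bsub>N\<^esub> (v c \<odot>\<^bsub>N\<^esub> m c)) D"
      using assms r by (intro N.finsum_smult_ldistr) auto
    also have "\<dots> = finsum N (\<lambda>c. (r \<otimes> v c) \<odot>\<^bsub>N\<^esub> m c) D"
      using assms(3) r v by (intro N.finsum_cong') (auto simp: N.smult_assoc1)
    finally show "lin_comb D N m (r \<odot>\<^bsub>coeff_module R D'\<^esub> v) = r \<odot>\<^bsub>N\<^esub> lin_comb D N m v"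
      unfolding lin_comb_def coeff_simps by simp
  qed
qed

definition unit_coeff :: "nat \<Rightarrow> nat \<Rightarrow> 'a" where
  "unit_coeff c = (\<lambda>c'. if c' = c then \<one> else \<zero>)"

lemma unit_coeff_closed: "c \<in> D \<Longrightarrow> unit_coeff c \<in> carrier (coeff_module R D)"
  by (auto simp: coeff_carrier_iff unit_coeff_def)

lemma lin_comb_unit_coeff:
  assumes "module R N" "finite D" "\<And>c. c \<in> D \<Longrightarrow> m c \<in> carrier N" "c \<in> D"
  shows "lin_comb D N m (unit_coeff c) = m c"
proof -
  interpret N: module R N by fact
  have "lin_comb D N m (unit_coeff c) = finsum N (\<lambda>c'. if c = c' then m c' else \<zero>\<^bsub>N\<^esub>) D"
    unfolding lin_comb_def
    using assms(3) by (intro N.finsum_cong') (auto simp: unit_coeff_def)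
  also have "\<dots> = m c" using assms by (intro N.finsum_singleton) auto
  finally show ?thesis .
qed

lemma coeff_eq_lin_comb:
  assumes "finite D" "v \<in> carrier (coeff_module R D)"
  shows "lin_comb D (coeff_module R D) unit_coeff v = v"
proof
  fix c
  interpret M: module R "coeff_module R D" by (rule module_coeff)
  have v: "v c \<in> carrier R" for c using assms(2) by (simp add: coeff_carrier_iff)
  have "lin_comb D (coeff_module R D) unit_coeff v c = finsum R (\<lambda>c'. v c' \<otimes> unit_coeff c' c) D"
    unfolding lin_comb_def using assms v
    by (subst coeff_finsum) (auto simp: coeff_simps coeff_carrier_iff unit_coeff_def)
  also have "\<dots> = finsum R (\<lambda>c'. if c = c' then v c' else \<zero>) D"
    using v by (intro finsum_cong') (auto simp: unit_coeff_def)
  also have "\<dots> = v c"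
  proof (cases "c \<in> D")
    case True
    then show ?thesis using assms(1) v by (intro finsum_singleton) auto
  next
    case False
    then have "finsum R (\<lambda>c'. if c = c' then v c' else \<zero>) D = \<zero>"
      by (intro add.finprod_one_eqI) auto
    then show ?thesis using False assms(2) by (simp add: coeff_carrier_iff)
  qed
  finally show "lin_comb D (coeff_module R D) unit_coeff v c = v c" .
qed

text \<open>The uniqueness half of the universal property of a free module: expand \<open>v\<close>
  in the basis and apply \<open>g\<close> to each term.\<close>

lemma lin_maps_coeff_eq:
  assumes "finite D" "module R N" "g \<in> lin_maps R (coeff_module R D) N"
    "v \<in> carrier (coeff_module R D)"
  shows "g v = lin_comb D N (\<lambda>c. g (unit_coeff c)) v"
proof -
  interpret M: module R "coeff_module R D" by (rule module_coeff)
  interpret N: module R N by fact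
  have v: "v c \<in> carrier R" for c using assms(4) by (simp add: coeff_carrier_iff)
  have "g v = g (lin_comb D (coeff_module R D) unit_coeff v)"
    using coeff_eq_lin_comb[OF assms(1,4)] by simp
  also have "\<dots> = finsum N (\<lambda>c. g (v c \<odot>\<^bsub>coeff_module R D\<^esub> unit_coeff c)) D"
    unfolding lin_comb_def using v
    by (intro lin_finsum[OF module_coeff assms(2,3,1)]) (auto intro!: M.smult_closed unit_coeff_closed)
  also have "\<dots> = lin_comb D N (\<lambda>c. g (unit_coeff c)) v"
    unfolding lin_comb_def using v unit_coeff_closed[of _ D] lin_closed[OF assms(3)]
    by (intro N.finsum_cong') (auto simp: lin_smult[OF assms(3)])
  finally show ?thesis .
qed

lemma fin_gen_module_coeff:
  assumes "finite D"
  shows "fin_gen_module R (coeff_module R D)"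
proof -
  interpret M: module R "coeff_module R D" by (rule module_coeff)
  have "H = carrier (coeff_module R D)"
    if H: "submodule H R (coeff_module R D)" "unit_coeff ` D \<subseteq> H" for H
  proof -
    have sub: "H \<subseteq> carrier (coeff_module R D)" using M.submoduleE(1)[OF H(1)] .
    have zero: "\<zero>\<^bsub>coeff_module R D\<^esub> \<in> H"
      using H(1) by (metis submodule_def subgroup.one_closed monoid.select_convs(2))
    have "finsum (coeff_module R D) (\<lambda>c. v c \<odot>\<^bsub>coeff_module R D\<^esub> unit_coeff c) D' \<in> H"
      if "v \<in> carrier (coeff_module R D)" "D' \<subseteq> D" for v D'
    proof -
      have "finite D'" using that(2) assms by (rule finite_subset)
      then show ?thesis using that(2)
      proof (induction D' rule: finite_induct)
        case (insert c D')
        have "v c' \<odot>\<^bsub>coeff_module R D\<^esub> unit_coeff c' \<in> H" if "c' \<in> D" for c'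
          using H(2) \<open>v \<in> _\<close> that by (intro M.submoduleE(4)[OF H(1)]) (auto simp: coeff_carrier_iff)
        then show ?case
          using insert subsetD[OF sub] M.submoduleE(5)[OF H(1)] by (subst M.finsum_insert) blast+
      qed (simp add: zero)
    qed
    then have "v \<in> H" if "v \<in> carrier (coeff_module R D)" for v
      using that coeff_eq_lin_comb[OF assms that] unfolding lin_comb_def by (metis order_refl)
    then show ?thesis using sub by blast
  qed
  then show ?thesis
    unfolding fin_gen_module_def using assms
    by (intro conjI module_coeff exI[of _ "unit_coeff ` D"]) (auto intro: unit_coeff_closed)
qed

text \<open>Preimages of the values of \<open>g\<close> on the basis are chosen and extended
  linearly; the composite with \<open>p\<close> agrees with \<open>g\<close> on the basis, hence
  everywhere.\<close>

lemma projective_module_coeff: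
  assumes "finite D"
  shows "projective_module R (coeff_module R D)"
  unfolding projective_module_def
proof (intro conjI allI impI)
  fix N L :: "'a bmod" and p g
  assume a: "module R N \<and> module R L \<and> p \<in> lin_maps R N L \<and> p ` carrier N = carrier L \<and>
    g \<in> lin_maps R (coeff_module R D) L"
  then have N: "module R N" and L: "module R L" and p: "p \<in> lin_maps R N L"
    "p ` carrier N = carrier L" and g: "g \<in> lin_maps R (coeff_module R D) L" by auto
  have "\<forall>c\<in>D. \<exists>x\<in>carrier N. p x = g (unit_coeff c)"
    using p(2) lin_closed[OF g] unit_coeff_closed[of _ D] by (metis imageE)
  then obtain m where m: "\<And>c. c \<in> D \<Longrightarrow> m c \<in> carrier N" "\<And>c. c \<in> D \<Longrightarrow> p (m c) = g (unit_coeff c)"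
    by metis
  let ?h = "lin_comb D N m"
  have h: "?h \<in> lin_maps R (coeff_module R D) N" using N assms m(1) by (rule lin_comb_lin)
  have "p (?h v) = g v" if v: "v \<in> carrier (coeff_module R D)" for v
  proof -
    interpret L: module R L by (rule L)
    have "p (?h v) = lin_comb D L (\<lambda>c. p (?h (unit_coeff c))) v"
      using lin_maps_coeff_eq[OF assms L lin_comp[OF h p(1)] v] .
    also have "\<dots> = lin_comb D L (\<lambda>c. g (unit_coeff c)) v"
      unfolding lin_comb_def[of D L]
      using lin_comb_unit_coeff[of N D m, OF N assms m(1)] m(2) v lin_closed[OF g]
        unit_coeff_closed[of _ D]
      by (intro L.finsum_cong') (auto simp: coeff_carrier_iff)
    also have "\<dots> = g v" using lin_maps_coeff_eq[OF assms L g v] by simp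
    finally show ?thesis .
  qed
  then show "\<exists>g'\<in>lin_maps R (coeff_module R D) N. \<forall>x\<in>carrier (coeff_module R D). p (g' x) = g x"
    using h by (intro bexI[of _ ?h]) auto
qed (rule module_coeff)

end

section \<open>Dg modules over the Koszul algebra: shifts and cones\<close>

context cring
begin

text \<open>These laws are collected as plain facts so that they apply to \<open>deg E k\<close> for
  every \<open>k\<close> at once, without one interpretation per degree.\<close>

lemma module_group_rules:
  assumes "module R M"
  shows "\<zero>\<^bsub>M\<^esub> \<in> carrier M"
    and "x \<in> carrier M \<Longrightarrow> \<ominus>\<^bsub>M\<^esub> x \<in> carrier M"
    and "x \<in> carrier M \<Longrightarrow> y \<in> carrier M \<Longrightarrow> x \<oplus>\<^bsub>M\<^esub> y \<in> carrier M"
    and "x \<in> carrier M \<Longrightarrow> \<zero>\<^bsub>M\<^esub> \<oplus>\<^bsub>M\<^esub> x = x"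
    and "x \<in> carrier M \<Longrightarrow> x \<oplus>\<^bsub>M\<^esub> \<zero>\<^bsub>M\<^esub> = x"
    and "x \<in> carrier M \<Longrightarrow> \<ominus>\<^bsub>M\<^esub> x \<oplus>\<^bsub>M\<^esub> x = \<zero>\<^bsub>M\<^esub>"
    and "x \<in> carrier M \<Longrightarrow> x \<oplus>\<^bsub>M\<^esub> \<ominus>\<^bsub>M\<^esub> x = \<zero>\<^bsub>M\<^esub>"
    and "x \<in> carrier M \<Longrightarrow> \<ominus>\<^bsub>M\<^esub> (\<ominus>\<^bsub>M\<^esub> x) = x"
    and "\<ominus>\<^bsub>M\<^esub> \<zero>\<^bsub>M\<^esub> = \<zero>\<^bsub>M\<^esub>"
    and "a \<in> carrier R \<Longrightarrow> a \<odot>\<^bsub>M\<^esub> \<zero>\<^bsub>M\<^esub> = \<zero>\<^bsub>M\<^esub>"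
    and "x \<in> carrier M \<Longrightarrow> y \<in> carrier M \<Longrightarrow> x \<ominus>\<^bsub>M\<^esub> y = \<zero>\<^bsub>M\<^esub> \<longleftrightarrow> x = y"
proof -
  interpret M: module R M by fact
  show "x \<in> carrier M \<Longrightarrow> y \<in> carrier M \<Longrightarrow> x \<ominus>\<^bsub>M\<^esub> y = \<zero>\<^bsub>M\<^esub> \<longleftrightarrow> x = y"
    using M.minus_equality[of x "\<ominus>\<^bsub>M\<^esub> y"] by (auto simp: a_minus_def M.r_neg)
  show "x \<in> carrier M \<Longrightarrow> \<ominus>\<^bsub>M\<^esub> x \<oplus>\<^bsub>M\<^esub> x = \<zero>\<^bsub>M\<^esub>"
    "x \<in> carrier M \<Longrightarrow> x \<oplus>\<^bsub>M\<^esub> \<ominus>\<^bsub>M\<^esub> x = \<zero>\<^bsub>M\<^esub>"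
    by (auto simp: M.l_neg M.r_neg)
  show "\<zero>\<^bsub>M\<^esub> \<in> carrier M"
    "x \<in> carrier M \<Longrightarrow> \<ominus>\<^bsub>M\<^esub> x \<in> carrier M"
    "x \<in> carrier M \<Longrightarrow> y \<in> carrier M \<Longrightarrow> x \<oplus>\<^bsub>M\<^esub> y \<in> carrier M"
    "x \<in> carrier M \<Longrightarrow> \<zero>\<^bsub>M\<^esub> \<oplus>\<^bsub>M\<^esub> x = x"
    "x \<in> carrier M \<Longrightarrow> x \<oplus>\<^bsub>M\<^esub> \<zero>\<^bsub>M\<^esub> = x"
    "x \<in> carrier M \<Longrightarrow> \<ominus>\<^bsub>M\<^esub> (\<ominus>\<^bsub>M\<^esub> x) = x"
    "\<ominus>\<^bsub>M\<^esub> \<zero>\<^bsub>M\<^esub> = \<zero>\<^bsub>M\<^esub>"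
    "a \<in> carrier R \<Longrightarrow> a \<odot>\<^bsub>M\<^esub> \<zero>\<^bsub>M\<^esub> = \<zero>\<^bsub>M\<^esub>"
    by simp_all
qed

lemma module_neg_eq_zero:
  assumes "module R M" "x \<in> carrier M" "\<ominus>\<^bsub>M\<^esub> x = \<zero>\<^bsub>M\<^esub>"
  shows "x = \<zero>\<^bsub>M\<^esub>"
  using module_group_rules(8)[OF assms(1,2)] module_group_rules(9)[OF assms(1)] assms(3) by simp

lemma mod_sign_mod_sign:
  "module R M \<Longrightarrow> x \<in> carrier M \<Longrightarrow> mod_sign M m (mod_sign M m x) = x"
  by (simp add: mod_sign_def module_group_rules)

lemma mod_sign_lin:
  "module R M \<Longrightarrow> module R N \<Longrightarrow> g \<in> lin_maps R M N \<Longrightarrow> x \<in> carrier M \<Longrightarrow>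
    g (mod_sign M m x) = mod_sign N m (g x)"
  by (simp add: mod_sign_def lin_neg)

lemma mod_sign_zero: "module R M \<Longrightarrow> mod_sign M m \<zero>\<^bsub>M\<^esub> = \<zero>\<^bsub>M\<^esub>"
  by (simp add: mod_sign_def module_group_rules)

lemma lin_mod_sign_map:
  "module R N \<Longrightarrow> g \<in> lin_maps R M N \<Longrightarrow> (\<lambda>x. mod_sign N m (g x)) \<in> lin_maps R M N"
  by (cases "even m") (simp_all add: mod_sign_def lin_neg_map)

lemma koszul_dg_moduleI:
  assumes "\<And>k. module R (deg E k)"
    and "\<And>k. dif E k \<in> lin_maps R (deg E k) (deg E (k + 1))"
    and "\<And>k x. x \<in> carrier (deg E k) \<Longrightarrow> dif E (k + 1) (dif E k x) = \<zero>\<^bsub>deg E (k + 2)\<^esub>"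
    and "\<And>i k. i \<in> {1..n} \<Longrightarrow> eps E i k \<in> lin_maps R (deg E k) (deg E (k - 1))"
    and "\<And>i k x. i \<in> {1..n} \<Longrightarrow> x \<in> carrier (deg E k) \<Longrightarrow>
      eps E i (k - 1) (eps E i k x) = \<zero>\<^bsub>deg E (k - 2)\<^esub>"
    and "\<And>i k x. i \<in> {1..n} \<Longrightarrow> x \<in> carrier (deg E k) \<Longrightarrow>
      dif E (k - 1) (eps E i k x) \<oplus>\<^bsub>deg E k\<^esub> eps E i (k + 1) (dif E k x) = f i \<odot>\<^bsub>deg E k\<^esub> x"
    and "\<And>i j k x. i \<in> {1..n} \<Longrightarrow> j \<in> {1..n} \<Longrightarrow> x \<in> carrier (deg E k) \<Longrightarrow>
      eps E i (k - 1) (eps E j k x) \<oplus>\<^bsub>deg E (k - 2)\<^esub> eps E j (k - 1) (eps E i k x)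
        = \<zero>\<^bsub>deg E (k - 2)\<^esub>"
  shows "koszul_dg_module R n f E"
  using assms unfolding koszul_dg_module_def by blast

lemma koszul_dg_moduleD:
  assumes "koszul_dg_module R n f E"
  shows "module R (deg E k)"
    and "dif E k \<in> lin_maps R (deg E k) (deg E (k + 1))"
    and "x \<in> carrier (deg E k) \<Longrightarrow> dif E (k + 1) (dif E k x) = \<zero>\<^bsub>deg E (k + 2)\<^esub>"
    and "i \<in> {1..n} \<Longrightarrow> eps E i k \<in> lin_maps R (deg E k) (deg E (k - 1))"
    and "i \<in> {1..n} \<Longrightarrow> x \<in> carrier (deg E k) \<Longrightarrow>
      eps E i (k - 1) (eps E i k x) = \<zero>\<^bsub>deg E (k - 2)\<^esub>"
    and "i \<in> {1..n} \<Longrightarrow> x \<in> carrier (deg E k) \<Longrightarrow>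
      dif E (k - 1) (eps E i k x) \<oplus>\<^bsub>deg E k\<^esub> eps E i (k + 1) (dif E k x) = f i \<odot>\<^bsub>deg E k\<^esub> x"
    and "i \<in> {1..n} \<Longrightarrow> j \<in> {1..n} \<Longrightarrow> x \<in> carrier (deg E k) \<Longrightarrow>
      eps E i (k - 1) (eps E j k x) \<oplus>\<^bsub>deg E (k - 2)\<^esub> eps E j (k - 1) (eps E i k x)
        = \<zero>\<^bsub>deg E (k - 2)\<^esub>"
  using assms unfolding koszul_dg_module_def by blast+

text \<open>The differential and each \<open>\<epsilon>\<^sub>i\<close> acquire the same sign. Every
  relation of a dg module involves composites of two of these operators, so the signs cancel in
  pairs.\<close>

lemma koszul_dg_module_shift:
  assumes "koszul_dg_module R n f E"
  shows "koszul_dg_module R n f (shift_dg m E)"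
proof (rule koszul_dg_moduleI)
  note E = koszul_dg_moduleD[OF assms]
  \<comment> \<open>Degrees occur as arguments of \<open>deg E\<close>, so equal integers written
    differently have to be brought to one form; lists of this kind recur in later proofs.\<close>
  have idx: "k + 1 + m = k + m + 1" "k + 2 + m = k + m + 2" "k - 1 + m = k + m - 1"
    "k - 2 + m = k + m - 2" "k + m + 1 + 1 = k + m + 2" for k by auto
  have dif: "dif (shift_dg m E) k x = mod_sign (deg E (k + m + 1)) m (dif E (k + m) x)"
    and eps: "eps (shift_dg m E) i k x = mod_sign (deg E (k + m - 1)) m (eps E i (k + m) x)"
    and deg: "deg (shift_dg m E) k = deg E (k + m)"
    for k i x by (simp_all add: shift_dg_def)
  have E2: "dif E (k + 1) \<in> lin_maps R (deg E (k + 1)) (deg E (k + 2))"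
    "dif E (k - 1) \<in> lin_maps R (deg E (k - 1)) (deg E k)" for k
    using E(2)[of "k + 1"] E(2)[of "k - 1"] by (simp_all add: add.assoc)
  have E4: "eps E i (k - 1) \<in> lin_maps R (deg E (k - 1)) (deg E (k - 2))"
    "eps E i (k + 1) \<in> lin_maps R (deg E (k + 1)) (deg E k)" if "i \<in> {1..n}" for i k
    using E(4)[OF that, of "k - 1"] E(4)[OF that, of "k + 1"] by simp_all
  show "module R (deg (shift_dg m E) k)" for k unfolding deg by (rule E)
  show "dif (shift_dg m E) k \<in> lin_maps R (deg (shift_dg m E) k) (deg (shift_dg m E) (k + 1))" for k
    unfolding deg dif idx by (intro lin_mod_sign_map E)
  show "eps (shift_dg m E) i k \<in> lin_maps R (deg (shift_dg m E) k) (deg (shift_dg m E) (k - 1))"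
    if "i \<in> {1..n}" for i k
    unfolding deg eps idx using that by (intro lin_mod_sign_map E)
  fix k x assume "x \<in> carrier (deg (shift_dg m E) k)"
  then have x: "x \<in> carrier (deg E (k + m))" by (simp add: deg)
  note dx = lin_closed[OF E(2) x]
  show "dif (shift_dg m E) (k + 1) (dif (shift_dg m E) k x) = \<zero>\<^bsub>deg (shift_dg m E) (k + 2)\<^esub>"
    unfolding deg dif idx using E(3)[OF x] x
    by (simp add: mod_sign_lin[OF E(1) E(1) E2(1) dx] mod_sign_mod_sign[OF E(1)] mod_sign_zero[OF E(1)])
  {
    fix i j assume i: "i \<in> {1..n}" and j: "j \<in> {1..n}"
    have ex: "eps E j (k + m) x \<in> carrier (deg E (k + m - 1))" if "j \<in> {1..n}" for j
      using lin_closed[OF E(4)[OF that] x] .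
    have *: "eps (shift_dg m E) i (k - 1) (eps (shift_dg m E) j k x) = eps E i (k + m - 1) (eps E j (k + m) x)"
      if i: "i \<in> {1..n}" and j: "j \<in> {1..n}" for i j
      unfolding deg eps idx using lin_closed[OF E4(1)[OF i] ex[OF j]]
      by (simp add: mod_sign_lin[OF E(1) E(1) E4(1)[OF i] ex[OF j]] mod_sign_mod_sign[OF E(1)])
    show "eps (shift_dg m E) i (k - 1) (eps (shift_dg m E) i k x) = \<zero>\<^bsub>deg (shift_dg m E) (k - 2)\<^esub>"
      using *[OF i i] E(5)[OF i x] by (simp add: deg idx)
    show "eps (shift_dg m E) i (k - 1) (eps (shift_dg m E) j k x) \<oplus>\<^bsub>deg (shift_dg m E) (k - 2)\<^esub>
        eps (shift_dg m E) j (k - 1) (eps (shift_dg m E) i k x) = \<zero>\<^bsub>deg (shift_dg m E) (k - 2)\<^esub>"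
      using *[OF i j] *[OF j i] E(7)[OF i j x] by (simp add: deg idx)
    have "dif (shift_dg m E) (k - 1) (eps (shift_dg m E) i k x) = dif E (k + m - 1) (eps E i (k + m) x)"
      unfolding deg eps dif idx using lin_closed[OF E2(2) ex[OF i]]
      by (simp add: mod_sign_lin[OF E(1) E(1) E2(2) ex[OF i]] mod_sign_mod_sign[OF E(1)])
    moreover have "eps (shift_dg m E) i (k + 1) (dif (shift_dg m E) k x) = eps E i (k + m + 1) (dif E (k + m) x)"
      unfolding deg eps dif idx using lin_closed[OF E4(2)[OF i] dx]
      by (simp add: mod_sign_lin[OF E(1) E(1) E4(2)[OF i] dx] mod_sign_mod_sign[OF E(1)])
    ultimately show "dif (shift_dg m E) (k - 1) (eps (shift_dg m E) i k x) \<oplus>\<^bsub>deg (shift_dg m E) k\<^esub>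
        eps (shift_dg m E) i (k + 1) (dif (shift_dg m E) k x) = f i \<odot>\<^bsub>deg (shift_dg m E) k\<^esub> x"
      using E(6)[OF i x] by (simp add: deg)
  }
qed

text \<open>In degree 0 the signs in \<open>dg_hom\<close> and \<open>dg_diff\<close> are trivial,
  so a closed map commutes strictly with all the structure.\<close>

lemma closed_maps_iff:
  assumes "koszul_dg_module R n f E" "koszul_dg_module R n f F"
  shows "\<phi> \<in> closed_maps R n E F \<longleftrightarrow>
    (\<forall>j. \<phi> j \<in> lin_maps R (deg E j) (deg F j)) \<and>
    (\<forall>i\<in>{1..n}. \<forall>j. \<forall>x\<in>carrier (deg E j). \<phi> (j - 1) (eps E i j x) = eps F i j (\<phi> j x)) \<and>
    (\<forall>j. \<forall>x\<in>carrier (deg E j). dif F j (\<phi> j x) = \<phi> (j + 1) (dif E j x))" (is "_ \<longleftrightarrow> ?lin \<and> ?eps \<and> ?dif")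
proof -
  note E = koszul_dg_moduleD[OF assms(1)] and F = koszul_dg_moduleD[OF assms(2)]
  have "dif F j (\<phi> j x) \<ominus>\<^bsub>deg F (j + 1)\<^esub> \<phi> (j + 1) (dif E j x) = \<zero>\<^bsub>deg F (j + 1)\<^esub> \<longleftrightarrow>
      dif F j (\<phi> j x) = \<phi> (j + 1) (dif E j x)"
    if ?lin and x: "x \<in> carrier (deg E j)" for j x
  proof -
    interpret F: module R "deg F (j + 1)" by (rule F)
    have "\<phi> j x \<in> carrier (deg F j)" using lin_closed[of "\<phi> j"] that by blast
    then have "dif F j (\<phi> j x) \<in> carrier (deg F (j + 1))" using lin_closed[OF F(2)] by blast
    moreover have "\<phi> (j + 1) (dif E j x) \<in> carrier (deg F (j + 1))"
      using lin_closed[of "\<phi> (j + 1)"] that(1) lin_closed[OF E(2) x] by blast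
    ultimately show ?thesis by (rule module_group_rules[OF F(1)])
  qed
  then show ?thesis
    unfolding closed_maps_def dg_hom_def dg_diff_def by (auto simp: mod_sign_def)
qed

lemma closed_mapsD:
  assumes "koszul_dg_module R n f E" "koszul_dg_module R n f F" "\<phi> \<in> closed_maps R n E F"
  shows "\<phi> j \<in> lin_maps R (deg E j) (deg F j)"
    and "i \<in> {1..n} \<Longrightarrow> x \<in> carrier (deg E j) \<Longrightarrow> \<phi> (j - 1) (eps E i j x) = eps F i j (\<phi> j x)"
    and "x \<in> carrier (deg E j) \<Longrightarrow> dif F j (\<phi> j x) = \<phi> (j + 1) (dif E j x)"
  using closed_maps_iff[OF assms(1,2)] assms(3) by blast+

lemma closed_mapsI:
  assumes "koszul_dg_module R n f E" "koszul_dg_module R n f F"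
    and "\<And>j. \<phi> j \<in> lin_maps R (deg E j) (deg F j)"
    and "\<And>i j x. i \<in> {1..n} \<Longrightarrow> x \<in> carrier (deg E j) \<Longrightarrow> \<phi> (j - 1) (eps E i j x) = eps F i j (\<phi> j x)"
    and "\<And>j x. x \<in> carrier (deg E j) \<Longrightarrow> dif F j (\<phi> j x) = \<phi> (j + 1) (dif E j x)"
  shows "\<phi> \<in> closed_maps R n E F"
  using closed_maps_iff[OF assms(1,2)] assms(3-5) by blast

lemma closed_maps_id:
  assumes "koszul_dg_module R n f E"
  shows "(\<lambda>j x. x) \<in> closed_maps R n E E"
  by (rule closed_mapsI[OF assms assms]) (auto intro: lin_id)

lemma closed_maps_zero:
  assumes "koszul_dg_module R n f E" "koszul_dg_module R n f F"
  shows "(\<lambda>j x. \<zero>\<^bsub>deg F j\<^esub>) \<in> closed_maps R n E F"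
proof -
  note F = koszul_dg_moduleD[OF assms(2)]
  show ?thesis
    using lin_zero[OF F(1) F(1) F(2)] lin_zero[OF F(1) F(1) F(4)]
    by (intro closed_mapsI[OF assms] lin_zero_map F(1)) simp_all
qed

text \<open>The sign rule of a shift is absorbed by shifting the target the other way.\<close>

lemma closed_maps_unshift:
  assumes "koszul_dg_module R n f E" "koszul_dg_module R n f F"
    "\<phi> \<in> closed_maps R n E (shift_dg m F)"
  shows "(\<lambda>j. \<phi> (j - m)) \<in> closed_maps R n (shift_dg (- m) E) F"
proof -
  note F = koszul_dg_moduleD[OF assms(2)] and E = koszul_dg_moduleD[OF assms(1)]
  note \<phi> = closed_mapsD[OF assms(1) koszul_dg_module_shift[OF assms(2)] assms(3)]
  have idx: "k - m + m = k" "k - m + m + 1 = k + 1" "k - m - 1 = k - 1 - m" "k - m + 1 = k + 1 - m"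
    "k + - m = k - m" for k by auto
  show ?thesis
  proof (rule closed_mapsI[OF koszul_dg_module_shift[OF assms(1)] assms(2)])
    fix j
    show lin: "\<phi> (j - m) \<in> lin_maps R (deg (shift_dg (- m) E) j) (deg F j)" for j
      using \<phi>(1)[of "j - m"] by (simp add: shift_dg_def idx)
    fix x assume "x \<in> carrier (deg (shift_dg (- m) E) j)"
    then have x: "x \<in> carrier (deg E (j - m))" by (simp add: shift_dg_def)
    have px: "\<phi> (j - m) x \<in> carrier (deg F j)"
      using lin_closed[OF \<phi>(1) x] by (simp add: shift_dg_def idx)
    have dx: "dif E (j - m) x \<in> carrier (deg E (j + 1 - m))"
      using lin_closed[OF E(2) x] by (simp add: idx)
    have "\<phi> (j + 1 - m) (dif E (j - m) x) = mod_sign (deg F (j + 1)) m (dif F j (\<phi> (j - m) x))"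
      using \<phi>(3)[OF x] by (simp add: shift_dg_def idx)
    \<comment> \<open>Applying the sign once more moves it from the target to the source, where the
      shift by \<open>- m\<close> provides it, \<open>m\<close> and \<open>- m\<close> having the
      same parity.\<close>
    then show "dif F j (\<phi> (j - m) x) = \<phi> (j + 1 - m) (dif (shift_dg (- m) E) j x)"
      using mod_sign_lin[OF E(1) F(1) lin[of "j + 1", simplified shift_dg_def, simplified idx kdg.simps], of _ m] dx
        lin_closed[OF F(2) px]
      by (simp add: shift_dg_def mod_sign_def idx module_group_rules[OF F(1)])
    fix i assume i: "i \<in> {1..n}"
    have ex: "eps E i (j - m) x \<in> carrier (deg E (j - 1 - m))"
      using lin_closed[OF E(4)[OF i] x] by (simp add: idx)
    have "\<phi> (j - 1 - m) (eps E i (j - m) x) = mod_sign (deg F (j - 1)) m (eps F i j (\<phi> (j - m) x))"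
      using \<phi>(2)[OF i x] by (simp add: shift_dg_def idx)
    then show "\<phi> (j - 1 - m) (eps (shift_dg (- m) E) i j x) = eps F i j (\<phi> (j - m) x)"
      using mod_sign_lin[OF E(1) F(1) lin[of "j - 1", simplified shift_dg_def, simplified idx kdg.simps], of _ m] ex
        lin_closed[OF F(4)[OF i] px]
      by (simp add: shift_dg_def mod_sign_def idx module_group_rules[OF F(1)])
  qed
qed

section \<open>Cones of closed maps\<close>

lemma cone_simps:
  "deg (cone_dg E F s) k = dsum (deg E (k + 1)) (deg F k)"
  "dif (cone_dg E F s) k w = interleave (\<ominus>\<^bsub>deg E (k + 2)\<^esub> dif E (k + 1) (seq_fst w))
     (s (k + 1) (seq_fst w) \<oplus>\<^bsub>deg F (k + 1)\<^esub> dif F k (seq_snd w))"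
  "eps (cone_dg E F s) i k w =
     interleave (\<ominus>\<^bsub>deg E k\<^esub> eps E i (k + 1) (seq_fst w)) (eps F i k (seq_snd w))"
  by (simp_all add: cone_dg_def)

text \<open>On the summand from \<open>E\<close> both operators are negated, so their composites
  there are those of \<open>E\<close>. The off-diagonal terms cancel: \<open>s d\<close> against
  \<open>d s\<close> in the square of the differential, and \<open>s \<epsilon>\<^sub>i\<close>
  against \<open>\<epsilon>\<^sub>i s\<close> in the relation with \<open>f i\<close>.\<close>

lemma koszul_dg_module_cone:
  assumes "koszul_dg_module R n f E" "koszul_dg_module R n f F" "s \<in> closed_maps R n E F"
  shows "koszul_dg_module R n f (cone_dg E F s)"
proof (rule koszul_dg_moduleI)
  note E = koszul_dg_moduleD[OF assms(1)] and F = koszul_dg_moduleD[OF assms(2)]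
  note s = closed_mapsD[OF assms]
  have idx: "k + 1 + 1 = k + 2" "k + 1 + 2 = k + 3" "k + 2 + 1 = k + 3" "k - 1 + 1 = k" "k - 1 - 1 = k - 2"
    "k + 1 - 1 = k" "k - 1 + 2 = k + 1" "k + 2 - 1 = k + 1" "k + 1 - 2 = k - 1" "k - 2 + 1 = k - 1" for k :: int by auto
  note E2 = E(2)[of "k + 1" for k, unfolded idx] E(2)[of "k + 2" for k, unfolded idx] E(2)[of "k - 1" for k, unfolded idx]
  note F2 = F(2)[of "k + 1" for k, unfolded idx] F(2)[of "k - 1" for k, unfolded idx]
  note E4 = E(4)[of _ "k + 1" for k, unfolded idx] E(4)[of _ "k + 2" for k, unfolded idx] E(4)[of _ "k - 1" for k, unfolded idx]
  note F4 = F(4)[of _ "k + 1" for k, unfolded idx] F(4)[of _ "k - 1" for k, unfolded idx]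
  have cl: "\<And>k x. x \<in> carrier (deg E k) \<Longrightarrow> dif E k x \<in> carrier (deg E (k + 1))"
    "\<And>k x. x \<in> carrier (deg F k) \<Longrightarrow> dif F k x \<in> carrier (deg F (k + 1))"
    "\<And>k x. x \<in> carrier (deg E k) \<Longrightarrow> s k x \<in> carrier (deg F k)"
    "\<And>i k x. i \<in> {1..n} \<Longrightarrow> x \<in> carrier (deg E k) \<Longrightarrow> eps E i k x \<in> carrier (deg E (k - 1))"
    "\<And>i k x. i \<in> {1..n} \<Longrightarrow> x \<in> carrier (deg F k) \<Longrightarrow> eps F i k x \<in> carrier (deg F (k - 1))"
    using lin_closed[OF E(2)] lin_closed[OF F(2)] lin_closed[OF s(1)] lin_closed[OF E(4)] lin_closed[OF F(4)]
    by blast+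
  show "module R (deg (cone_dg E F s) k)" for k
    unfolding cone_simps by (intro module_dsum E F)
  show "dif (cone_dg E F s) k \<in> lin_maps R (deg (cone_dg E F s) k) (deg (cone_dg E F s) (k + 1))" for k
    unfolding cone_simps idx
    by (intro lin_interleave lin_neg_map lin_plus_map E(1) F(1) lin_comp[OF lin_seq_fst E2(1)]
        lin_comp[OF lin_seq_fst s(1)] lin_comp[OF lin_seq_snd F(2)])
  show "eps (cone_dg E F s) i k \<in> lin_maps R (deg (cone_dg E F s) k) (deg (cone_dg E F s) (k - 1))"
    if "i \<in> {1..n}" for k i
    unfolding cone_simps idx using that
    by (intro lin_interleave lin_neg_map E(1) lin_comp[OF lin_seq_fst E4(1)] lin_comp[OF lin_seq_snd F(4)])
  fix k w assume "w \<in> carrier (deg (cone_dg E F s) k)"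
  then obtain x y where w: "w = interleave x y" and x: "x \<in> carrier (deg E (k + 1))" and y: "y \<in> carrier (deg F k)"
    by (metis cone_simps(1) dsum_carrier_iff interleave_seq)
  have dx: "dif E (k + 1) x \<in> carrier (deg E (k + 2))" using cl(1)[OF x] by (simp only: idx)
  have sx: "s (k + 1) x \<in> carrier (deg F (k + 1))" using cl(3)[OF x] .
  have dy: "dif F k y \<in> carrier (deg F (k + 1))" using cl(2)[OF y] .
  have sdx: "s (k + 2) (dif E (k + 1) x) \<in> carrier (deg F (k + 2))" using cl(3)[OF dx] .
  have "dif E (k + 2) (\<ominus>\<^bsub>deg E (k + 2)\<^esub> dif E (k + 1) x) = \<zero>\<^bsub>deg E (k + 3)\<^esub>"
    using lin_neg[OF E(1) E(1) E2(2) dx] E(3)[OF x] by (simp add: idx module_group_rules[OF E(1)])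
  moreover have "s (k + 2) (\<ominus>\<^bsub>deg E (k + 2)\<^esub> dif E (k + 1) x) = \<ominus>\<^bsub>deg F (k + 2)\<^esub> s (k + 2) (dif E (k + 1) x)"
    using lin_neg[OF E(1) F(1) s(1) dx] .
  moreover have "dif F (k + 1) (s (k + 1) x \<oplus>\<^bsub>deg F (k + 1)\<^esub> dif F k y) = s (k + 2) (dif E (k + 1) x)"
    using lin_add[OF F2(1) sx dy] s(3)[OF x] F(3)[OF y] sdx
    by (simp add: idx module_group_rules[OF F(1)])
  ultimately show "dif (cone_dg E F s) (k + 1) (dif (cone_dg E F s) k w) = \<zero>\<^bsub>deg (cone_dg E F s) (k + 2)\<^esub>"
    unfolding cone_simps dsum_simps w seq_fst_interleave seq_snd_interleave idx
    using sdx by (simp add: module_group_rules[OF E(1)] module_group_rules[OF F(1)])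
  {
    fix i j assume i: "i \<in> {1..n}" and j: "j \<in> {1..n}"
    have ex: "eps E j (k + 1) x \<in> carrier (deg E k)" and ey: "eps F j k y \<in> carrier (deg F (k - 1))"
      if "j \<in> {1..n}" for j
      using cl(4)[OF that x] cl(5)[OF that y] by simp_all
    have eex: "eps E i k (eps E j (k + 1) x) \<in> carrier (deg E (k - 1))" if "i \<in> {1..n}" "j \<in> {1..n}" for i j
      using cl(4)[OF that(1) ex[OF that(2)]] .
    have *: "eps (cone_dg E F s) i (k - 1) (eps (cone_dg E F s) j k w) =
      interleave (eps E i k (eps E j (k + 1) x)) (eps F i (k - 1) (eps F j k y))"
      if i: "i \<in> {1..n}" and j: "j \<in> {1..n}" for i j
      unfolding cone_simps w seq_fst_interleave seq_snd_interleave idx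
      using lin_neg[OF E(1) E(1) E(4)[OF i] ex[OF j]] eex[OF i j]
      by (simp add: module_group_rules[OF E(1)])
    show "eps (cone_dg E F s) i (k - 1) (eps (cone_dg E F s) i k w) = \<zero>\<^bsub>deg (cone_dg E F s) (k - 2)\<^esub>"
      using *[OF i i] E(5)[OF i x] F(5)[OF i y] by (simp add: cone_simps dsum_simps)
    show "eps (cone_dg E F s) i (k - 1) (eps (cone_dg E F s) j k w) \<oplus>\<^bsub>deg (cone_dg E F s) (k - 2)\<^esub>
        eps (cone_dg E F s) j (k - 1) (eps (cone_dg E F s) i k w) = \<zero>\<^bsub>deg (cone_dg E F s) (k - 2)\<^esub>"
      using *[OF i j] *[OF j i] E(7)[OF i j x] F(7)[OF i j y] by (simp add: cone_simps dsum_simps)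
    have dex: "dif E k (eps E i (k + 1) x) \<in> carrier (deg E (k + 1))" using cl(1)[OF ex[OF i]] .
    have edx: "eps E i (k + 2) (dif E (k + 1) x) \<in> carrier (deg E (k + 1))" using cl(4)[OF i dx] by (simp only: idx)
    have sex: "s k (eps E i (k + 1) x) \<in> carrier (deg F k)" using cl(3)[OF ex[OF i]] .
    have dey: "dif F (k - 1) (eps F i k y) \<in> carrier (deg F k)" using cl(2)[OF ey[OF i]] by simp
    have edy: "eps F i (k + 1) (dif F k y) \<in> carrier (deg F k)" using cl(5)[OF i dy] by simp
    interpret Ek: module R "deg E (k + 1)" by (rule E)
    interpret Fk: module R "deg F k" by (rule F)
    have 1: "dif (cone_dg E F s) (k - 1) (eps (cone_dg E F s) i k w)
      = interleave (dif E k (eps E i (k + 1) x))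
          (\<ominus>\<^bsub>deg F k\<^esub> s k (eps E i (k + 1) x) \<oplus>\<^bsub>deg F k\<^esub> dif F (k - 1) (eps F i k y))"
      unfolding cone_simps w seq_fst_interleave seq_snd_interleave idx
      using lin_neg[OF E(1) E(1) E(2) ex[OF i]] lin_neg[OF E(1) F(1) s(1) ex[OF i]] dex
      by simp
    have "eps F i (k + 1) (s (k + 1) x \<oplus>\<^bsub>deg F (k + 1)\<^esub> dif F k y)
      = s k (eps E i (k + 1) x) \<oplus>\<^bsub>deg F k\<^esub> eps F i (k + 1) (dif F k y)"
      using lin_add[OF F4(1)[OF i] sx dy] s(2)[OF i x] by simp
    then have 2: "eps (cone_dg E F s) i (k + 1) (dif (cone_dg E F s) k w)
      = interleave (eps E i (k + 2) (dif E (k + 1) x))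
          (s k (eps E i (k + 1) x) \<oplus>\<^bsub>deg F k\<^esub> eps F i (k + 1) (dif F k y))"
      unfolding cone_simps w seq_fst_interleave seq_snd_interleave idx
      using lin_neg[OF E(1) E(1) E4(2)[OF i] dx] edx by simp
    have "\<ominus>\<^bsub>deg F k\<^esub> u \<oplus>\<^bsub>deg F k\<^esub> a \<oplus>\<^bsub>deg F k\<^esub> (u \<oplus>\<^bsub>deg F k\<^esub> b) = a \<oplus>\<^bsub>deg F k\<^esub> b"
      if "u \<in> carrier (deg F k)" "a \<in> carrier (deg F k)" "b \<in> carrier (deg F k)" for u a b
      using that by (simp add: Fk.a_ac Fk.r_neg1 Fk.r_neg2 Fk.r_neg)
    then show "dif (cone_dg E F s) (k - 1) (eps (cone_dg E F s) i k w) \<oplus>\<^bsub>deg (cone_dg E F s) k\<^esub>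
        eps (cone_dg E F s) i (k + 1) (dif (cone_dg E F s) k w) = f i \<odot>\<^bsub>deg (cone_dg E F s) k\<^esub> w"
      unfolding 1 2 using E(6)[OF i x] F(6)[OF i y] sex dey edy
      by (simp add: cone_simps dsum_simps w idx)
  }
qed

end

section \<open>Quasi-isomorphisms and perfect dg modules\<close>

definition acyclic_dg :: "'b kdg \<Rightarrow> bool" where
  "acyclic_dg E \<longleftrightarrow> (\<forall>k. \<forall>x\<in>carrier (deg E k). dif E k x = \<zero>\<^bsub>deg E (k + 1)\<^esub> \<longrightarrow>
     (\<exists>y\<in>carrier (deg E (k - 1)). x = dif E (k - 1) y))"

context cring
begin

lemma homotopic_refl:
  assumes "koszul_dg_module R n f E" "koszul_dg_module R n f F" "\<phi> \<in> closed_maps R n E F"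
  shows "(\<phi>, \<phi>) \<in> homotopic R n E F"
proof -
  note F = koszul_dg_moduleD[OF assms(2)]
  note \<phi> = closed_mapsD[OF assms]
  \<comment> \<open>The zero homotopy. The degree is written \<open>j + - 1\<close> because
    \<open>dg_hom\<close> and \<open>dg_diff\<close> at degree -1 unfold to this term.\<close>
  let ?\<sigma> = "\<lambda>j x. \<zero>\<^bsub>deg F (j + - 1)\<^esub>"
  have idx: "j - 1 + - 1 = j + - 1 - 1" "j + 1 + - 1 = j" "j + - 1 + 1 = j" for j :: int by auto
  have "?\<sigma> \<in> dg_hom R n E F (- 1)"
    unfolding dg_hom_def idx
    using lin_zero_map[OF F(1)] lin_zero[OF F(1) F(1) F(4)]
    by (auto simp: mod_sign_zero[OF F(1)])
  moreover have "\<phi> j x \<ominus>\<^bsub>deg F j\<^esub> \<phi> j x = dg_diff E F (- 1) ?\<sigma> j x"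
    if x: "x \<in> carrier (deg E j)" for j x
  proof -
    have "\<phi> j x \<ominus>\<^bsub>deg F j\<^esub> \<phi> j x = \<zero>\<^bsub>deg F j\<^esub>"
      using lin_closed[OF \<phi>(1) x] by (simp add: module_group_rules[OF F(1)])
    moreover have "dif F (j + - 1) \<zero>\<^bsub>deg F (j + - 1)\<^esub> = \<zero>\<^bsub>deg F j\<^esub>"
      using lin_zero[OF F(1) F(1) F(2)[of "j + - 1"]] by (simp only: idx)
    moreover have "\<zero>\<^bsub>deg F j\<^esub> \<ominus>\<^bsub>deg F j\<^esub> \<zero>\<^bsub>deg F j\<^esub> = \<zero>\<^bsub>deg F j\<^esub>"
      by (simp add: module_group_rules[OF F(1)])
    ultimately show ?thesis
      unfolding dg_diff_def idx by (simp add: mod_sign_zero[OF F(1)])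
  qed
  ultimately show ?thesis
    unfolding homotopic_def using assms(3) by blast
qed

text \<open>These facts link the classes that are inverted in a localization with actual maps, on
  which \<open>quasi_iso\<close> and \<open>cone_dg\<close> are defined.\<close>

lemma homotopy_class_rules:
  assumes "koszul_dg_module R n f E" "koszul_dg_module R n f F" "\<phi> \<in> closed_maps R n E F"
  shows "homotopic R n E F `` {\<phi>} \<in> closed_maps R n E F // homotopic R n E F"
    and "\<phi> \<in> homotopic R n E F `` {\<phi>}"
  using homotopic_refl[OF assms] assms(3) by (auto intro: quotientI)

lemma retract_of_derived_cat:
  assumes "koszul_dg_module R n f E" "koszul_dg_module R n f F"
    and "s \<in> closed_maps R n E F" "quasi_iso E F s"
  shows "retract_of (derived_cat R n f) E F"
  unfolding derived_cat_def
  using assms homotopy_class_rules[OF assms(1-3)]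
  by (intro retract_of_localization zigzag_retract_forward[where w = "homotopic R n E F `` {s}"])
     (auto simp: homotopy_cat_def)

text \<open>The inductive definition has no rule for quasi-isomorphisms. They enter through the rule
  for retracts, since the derived category inverts them.\<close>

lemma perfect_dg_quasi_iso:
  assumes "koszul_dg_module R n f E" "koszul_dg_module R n f F"
    and "s \<in> closed_maps R n E F" "quasi_iso E F s" "perfect_dg R n f F"
  shows "perfect_dg R n f E"
  using perfect_dg.retract[OF assms(5) retract_of_derived_cat[OF assms(1-4)]] .

text \<open>Both cohomologies vanish; the zero map is taken because it is closed between any two dg
  modules.\<close>

lemma quasi_iso_zero:
  assumes "koszul_dg_module R n f E" "koszul_dg_module R n f F" "acyclic_dg E" "acyclic_dg F"
  shows "quasi_iso E F (\<lambda>j x. \<zero>\<^bsub>deg F j\<^esub>)"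
proof -
  note E = koszul_dg_moduleD[OF assms(1)] and F = koszul_dg_moduleD[OF assms(2)]
  have "\<exists>x\<in>carrier (deg E k). dif E k x = \<zero>\<^bsub>deg E (k + 1)\<^esub> \<and>
      (\<exists>z\<in>carrier (deg F (k - 1)). y = \<zero>\<^bsub>deg F k\<^esub> \<oplus>\<^bsub>deg F k\<^esub> dif F (k - 1) z)"
    if y: "y \<in> carrier (deg F k)" "dif F k y = \<zero>\<^bsub>deg F (k + 1)\<^esub>" for k y
  proof -
    obtain z where "z \<in> carrier (deg F (k - 1))" "y = dif F (k - 1) z"
      using assms(4) y unfolding acyclic_dg_def by blast
    then show ?thesis
      using y(1) lin_zero[OF E(1) E(1) E(2)]
      by (intro bexI[of _ "\<zero>\<^bsub>deg E k\<^esub>"] conjI bexI[of _ z])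
         (auto simp: module_group_rules[OF E(1)] module_group_rules[OF F(1)])
  qed
  then show ?thesis
    using assms(3) unfolding quasi_iso_def acyclic_dg_def by blast
qed

text \<open>The long exact sequence in elements: for a cycle with components \<open>x\<close> and
  \<open>y\<close>, injectivity on cohomology bounds \<open>x\<close>, and surjectivity then
  corrects the chosen primitive so that \<open>y\<close> is reached too.\<close>

lemma cone_acyclic:
  assumes "koszul_dg_module R n f E" "koszul_dg_module R n f F" "s \<in> closed_maps R n E F"
    and "quasi_iso E F s"
  shows "acyclic_dg (cone_dg E F s)"
  unfolding acyclic_dg_def
proof (intro allI ballI impI)
  note E = koszul_dg_moduleD[OF assms(1)] and F = koszul_dg_moduleD[OF assms(2)]
  note s = closed_mapsD[OF assms(1-3)]
  fix k w assume w: "w \<in> carrier (deg (cone_dg E F s) k)"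
    and dw: "dif (cone_dg E F s) k w = \<zero>\<^bsub>deg (cone_dg E F s) (k + 1)\<^esub>"
  interpret Ek: module R "deg E k" by (rule E)
  interpret E1: module R "deg E (k + 1)" by (rule E)
  interpret E2: module R "deg E (k + 2)" by (rule E)
  interpret Fk: module R "deg F k" by (rule F)
  interpret F1: module R "deg F (k + 1)" by (rule F)
  have idx: "k + 1 + 1 = k + 2" "k + 1 - 1 = k" "k - 1 + 1 = k" "k - 1 + 2 = k + 1" for k :: int by auto
  define x y where "x = seq_fst w" and "y = seq_snd w"
  have w_eq: "w = interleave x y" by (simp add: x_def y_def)
  have x: "x \<in> carrier (deg E (k + 1))" and y: "y \<in> carrier (deg F k)"
    using w by (simp_all add: cone_simps dsum_carrier_iff x_def y_def)
  have dx: "dif E (k + 1) x \<in> carrier (deg E (k + 2))"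
    using lin_closed[OF E(2) x] by (simp only: idx)
  have sx: "s (k + 1) x \<in> carrier (deg F (k + 1))" by (rule lin_closed[OF s(1) x])
  have dy: "dif F k y \<in> carrier (deg F (k + 1))" by (rule lin_closed[OF F(2) y])
  have "\<ominus>\<^bsub>deg E (k + 2)\<^esub> dif E (k + 1) x = \<zero>\<^bsub>deg E (k + 2)\<^esub>"
    and 1: "s (k + 1) x \<oplus>\<^bsub>deg F (k + 1)\<^esub> dif F k y = \<zero>\<^bsub>deg F (k + 1)\<^esub>"
    using dw by (simp_all add: cone_simps dsum_simps w_eq idx interleave_eq_iff)
  then have dx0: "dif E (k + 1) x = \<zero>\<^bsub>deg E (k + 2)\<^esub>"
    by (intro module_neg_eq_zero[OF E(1) dx])
  have ny: "\<ominus>\<^bsub>deg F k\<^esub> y \<in> carrier (deg F k)" using y by simp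
  \<comment> \<open>The cycle condition says that \<open>s\<close> sends \<open>x\<close> to a
    boundary, so injectivity in degree \<open>k + 1\<close> applies.\<close>
  have "s (k + 1) x = dif F k (\<ominus>\<^bsub>deg F k\<^esub> y)"
    using F1.minus_equality[OF 1 dy sx] lin_neg[OF F(1) F(1) F(2) y] by simp
  then have "\<exists>z\<in>carrier (deg E k). x = dif E k z"
    using assms(4)[unfolded quasi_iso_def, THEN spec, of "k + 1", unfolded idx] x dx0 ny by blast
  then obtain z where z: "z \<in> carrier (deg E k)" "x = dif E k z" by blast
  have sz: "s k z \<in> carrier (deg F k)" by (rule lin_closed[OF s(1) z(1)])
  have "dif F k (y \<oplus>\<^bsub>deg F k\<^esub> s k z) = \<zero>\<^bsub>deg F (k + 1)\<^esub>"
    using 1 lin_add[OF F(2) y sz] s(3)[OF z(1)] z(2) sx dy by (simp add: F1.a_comm)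
  then obtain t u where t: "t \<in> carrier (deg E k)" "dif E k t = \<zero>\<^bsub>deg E (k + 1)\<^esub>"
    and u: "u \<in> carrier (deg F (k - 1))" "y \<oplus>\<^bsub>deg F k\<^esub> s k z = s k t \<oplus>\<^bsub>deg F k\<^esub> dif F (k - 1) u"
    using assms(4)[unfolded quasi_iso_def, THEN spec, of k] Fk.a_closed[OF y sz] by blast
  have st: "s k t \<in> carrier (deg F k)" by (rule lin_closed[OF s(1) t(1)])
  have du: "dif F (k - 1) u \<in> carrier (deg F k)" using lin_closed[OF F(2) u(1)] by (simp only: idx)
  \<comment> \<open>The primitive is \<open>interleave ?t u\<close>: since \<open>t\<close> is a
    cycle, \<open>- d (t - z) = x\<close>, and by the choice of \<open>u\<close> also
    \<open>s (t - z) + d u = y\<close>.\<close>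
  let ?t = "t \<oplus>\<^bsub>deg E k\<^esub> \<ominus>\<^bsub>deg E k\<^esub> z"
  have "dif E k ?t = \<ominus>\<^bsub>deg E (k + 1)\<^esub> x"
    using lin_add[OF E(2) t(1) Ek.a_inv_closed[OF z(1)]] lin_neg[OF E(1) E(1) E(2) z(1)] t z x by simp
  moreover have "s k ?t \<oplus>\<^bsub>deg F k\<^esub> dif F (k - 1) u = y"
  proof -
    have "s k ?t \<oplus>\<^bsub>deg F k\<^esub> dif F (k - 1) u
      = \<ominus>\<^bsub>deg F k\<^esub> s k z \<oplus>\<^bsub>deg F k\<^esub> (s k t \<oplus>\<^bsub>deg F k\<^esub> dif F (k - 1) u)"
      using lin_add[OF s(1) t(1) Ek.a_inv_closed[OF z(1)]] lin_neg[OF E(1) F(1) s(1) z(1)] st sz du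
      by (simp add: Fk.a_ac)
    also have "\<dots> = \<ominus>\<^bsub>deg F k\<^esub> s k z \<oplus>\<^bsub>deg F k\<^esub> (s k z \<oplus>\<^bsub>deg F k\<^esub> y)"
      using u(2) y sz by (simp add: Fk.a_comm)
    also have "\<dots> = y" using y sz by (simp add: Fk.r_neg1)
    finally show ?thesis .
  qed
  ultimately have "w = dif (cone_dg E F s) (k - 1) (interleave ?t u)"
    using x by (simp add: cone_simps w_eq idx)
  moreover have "interleave ?t u \<in> carrier (deg (cone_dg E F s) (k - 1))"
    using t z u by (simp add: cone_simps dsum_carrier_iff)
  ultimately show "\<exists>v\<in>carrier (deg (cone_dg E F s) (k - 1)). w = dif (cone_dg E F s) (k - 1) v"
    by blast
qed

lemma quasi_iso_id:
  assumes "koszul_dg_module R n f E"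
  shows "quasi_iso E E (\<lambda>j x. x)"
proof -
  note E = koszul_dg_moduleD[OF assms]
  have "\<exists>z\<in>carrier (deg E (k - 1)). x = x \<oplus>\<^bsub>deg E k\<^esub> dif E (k - 1) z"
    if "x \<in> carrier (deg E k)" for k x
    using that lin_zero[OF E(1) E(1) E(2)[of "k - 1"]]
    by (intro bexI[of _ "\<zero>\<^bsub>deg E (k - 1)\<^esub>"]) (simp_all add: module_group_rules[OF E(1)])
  then show ?thesis unfolding quasi_iso_def by blast
qed

text \<open>The cone of \<open>id\<close> on the Koszul algebra is perfect and acyclic, and the zero map to it from an
  acyclic dg module is a quasi-isomorphism.\<close>

lemma perfect_dg_acyclic:
  assumes "koszul_dg_module R n f (koszul_algebra R n f)"
    and "koszul_dg_module R n f E" "acyclic_dg E"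
  shows "perfect_dg R n f E"
proof -
  let ?K = "koszul_algebra R n f"
  let ?O = "cone_dg ?K ?K (\<lambda>j x. x)"
  note id = closed_maps_id[OF assms(1)]
  have O: "koszul_dg_module R n f ?O" by (rule koszul_dg_module_cone[OF assms(1,1) id])
  have "acyclic_dg ?O" by (rule cone_acyclic[OF assms(1,1) id quasi_iso_id[OF assms(1)]])
  moreover have "perfect_dg R n f ?O"
    by (intro perfect_dg.cone[OF perfect_dg.koszul perfect_dg.koszul id])
  ultimately show ?thesis
    using perfect_dg_quasi_iso[OF assms(2) O closed_maps_zero[OF assms(2) O]]
      quasi_iso_zero[OF assms(2) O assms(3)] by blast
qed

section \<open>The inclusion into a cone and its own cone\<close>

definition cone_inr :: "'a kdg \<Rightarrow> int \<Rightarrow> (nat \<Rightarrow> 'a) \<Rightarrow> (nat \<Rightarrow> 'a)" where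
  "cone_inr E k y = interleave \<zero>\<^bsub>deg E (k + 1)\<^esub> y"

lemma closed_maps_cone_inr:
  assumes "koszul_dg_module R n f E" "koszul_dg_module R n f F" "s \<in> closed_maps R n E F"
  shows "cone_inr E \<in> closed_maps R n F (cone_dg E F s)"
proof (rule closed_mapsI[OF assms(2) koszul_dg_module_cone[OF assms]])
  note E = koszul_dg_moduleD[OF assms(1)] and F = koszul_dg_moduleD[OF assms(2)]
  note s = closed_mapsD[OF assms(1-3)]
  fix k
  have idx: "k + 1 + 1 = k + 2" "k - 1 + 1 = k" for k :: int by auto
  show "cone_inr E k \<in> lin_maps R (deg F k) (deg (cone_dg E F s) k)"
    unfolding cone_inr_def cone_simps by (rule lin_inr[OF E(1)])
  fix y assume y: "y \<in> carrier (deg F k)"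
  show "dif (cone_dg E F s) k (cone_inr E k y) = cone_inr E (k + 1) (dif F k y)"
    using lin_zero[OF E(1) E(1) E(2)[of "k + 1"]] lin_zero[OF E(1) F(1) s(1)] lin_closed[OF F(2) y]
    by (simp add: cone_inr_def cone_simps idx module_group_rules[OF E(1)] module_group_rules[OF F(1)])
  fix i assume i: "i \<in> {1..n}"
  show "cone_inr E (k - 1) (eps F i k y) = eps (cone_dg E F s) i k (cone_inr E k y)"
    using lin_zero[OF E(1) E(1) E(4)[OF i, of "k + 1"]]
    by (simp add: cone_inr_def cone_simps idx module_group_rules[OF E(1)])
qed

text \<open>Rotation of distinguished triangles.\<close>

lemma cone_cone_inr:
  fixes E F n f s
  assumes "koszul_dg_module R n f E" "koszul_dg_module R n f F" "s \<in> closed_maps R n E F"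
  defines "C \<equiv> cone_dg F (cone_dg E F s) (cone_inr E)"
    and "p \<equiv> \<lambda>(j :: int) w. seq_fst (seq_snd w)"
  shows "p \<in> closed_maps R n C (shift_dg 1 E)" "quasi_iso C (shift_dg 1 E) p"
proof -
  note E = koszul_dg_moduleD[OF assms(1)] and F = koszul_dg_moduleD[OF assms(2)]
  note s = closed_mapsD[OF assms(1-3)]
  have idx: "k + 1 + 1 = k + 2" "k - 1 + 1 = k" "k + 1 - 1 = k" "k - 1 + 2 = k + 1" for k :: int by auto
  have C: "koszul_dg_module R n f C"
    unfolding C_def by (intro koszul_dg_module_cone closed_maps_cone_inr[of n f] assms)
  have L: "koszul_dg_module R n f (shift_dg 1 E)" by (rule koszul_dg_module_shift[OF assms(1)])
  have sh: "deg (shift_dg 1 E) k = deg E (k + 1)"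
    "dif (shift_dg 1 E) k x = \<ominus>\<^bsub>deg E (k + 2)\<^esub> dif E (k + 1) x"
    "eps (shift_dg 1 E) i k x = \<ominus>\<^bsub>deg E k\<^esub> eps E i (k + 1) x" for k i x
    by (simp_all add: shift_dg_def mod_sign_def idx)
  \<comment> \<open>An element of \<open>C\<close> is a triple \<open>u\<close>, \<open>v\<close>,
    \<open>w\<close>, and \<open>p\<close> reads off \<open>v\<close>. The triples with
    \<open>v = 0\<close> form the cone of the identity of \<open>F\<close>, which is acyclic; this
    is why \<open>p\<close> is a quasi-isomorphism.\<close>
  have Cdeg: "deg C k = dsum (deg F (k + 1)) (dsum (deg E (k + 1)) (deg F k))" for k
    by (simp add: C_def cone_simps)
  have Cdif: "dif C k (interleave u (interleave v w)) =
      interleave (\<ominus>\<^bsub>deg F (k + 2)\<^esub> dif F (k + 1) u)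
        (interleave (\<ominus>\<^bsub>deg E (k + 2)\<^esub> dif E (k + 1) v)
          (u \<oplus>\<^bsub>deg F (k + 1)\<^esub> (s (k + 1) v \<oplus>\<^bsub>deg F (k + 1)\<^esub> dif F k w)))"
    if "v \<in> carrier (deg E (k + 1))" for k u v w
  proof -
    have "dif E (k + 1) v \<in> carrier (deg E (k + 2))"
      using lin_closed[OF E(2) that] by (simp only: idx)
    then show ?thesis
      by (simp add: C_def cone_simps dsum_simps cone_inr_def idx module_group_rules[OF E(1)])
  qed
  have inC: "interleave u (interleave v w) \<in> carrier (deg C k) \<longleftrightarrow>
      u \<in> carrier (deg F (k + 1)) \<and> v \<in> carrier (deg E (k + 1)) \<and> w \<in> carrier (deg F k)" for k u v w
    by (simp add: Cdeg dsum_carrier_iff)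
  have elim: "\<exists>u v w. x = interleave u (interleave v w)" for x :: "nat \<Rightarrow> 'a"
    by (metis interleave_seq)
  show p: "p \<in> closed_maps R n C (shift_dg 1 E)"
  proof (rule closed_mapsI[OF C L])
    fix k
    show "p k \<in> lin_maps R (deg C k) (deg (shift_dg 1 E) k)"
      unfolding p_def Cdeg sh by (rule lin_comp[OF lin_seq_snd lin_seq_fst])
    fix x assume x: "x \<in> carrier (deg C k)"
    obtain u v w where uvw: "x = interleave u (interleave v w)" using elim by blast
    then have v: "v \<in> carrier (deg E (k + 1))" using x inC by blast
    show "dif (shift_dg 1 E) k (p k x) = p (k + 1) (dif C k x)"
      by (simp add: p_def sh uvw Cdif[OF v])
    show "p (k - 1) (eps C i k x) = eps (shift_dg 1 E) i k (p k x)" for i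
      by (simp add: p_def sh C_def cone_simps)
  qed
  show "quasi_iso C (shift_dg 1 E) p"
    unfolding quasi_iso_def
  proof (intro allI conjI ballI impI)
    fix k x assume x: "x \<in> carrier (deg C k)" and
      a: "dif C k x = \<zero>\<^bsub>deg C (k + 1)\<^esub> \<and>
        (\<exists>y\<in>carrier (deg (shift_dg 1 E) (k - 1)). p k x = dif (shift_dg 1 E) (k - 1) y)"
    interpret F1: module R "deg F (k + 1)" by (rule F)
    interpret Fk: module R "deg F k" by (rule F)
    obtain u v w where uvw: "x = interleave u (interleave v w)" using elim by blast
    then have u: "u \<in> carrier (deg F (k + 1))" and v: "v \<in> carrier (deg E (k + 1))"
      and w: "w \<in> carrier (deg F k)" using x inC by blast+
    obtain y where y: "y \<in> carrier (deg E k)" "v = \<ominus>\<^bsub>deg E (k + 1)\<^esub> dif E k y"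
      using a by (auto simp: sh p_def uvw idx)
    have sv: "s (k + 1) v \<in> carrier (deg F (k + 1))" by (rule lin_closed[OF s(1) v])
    have dw: "dif F k w \<in> carrier (deg F (k + 1))" by (rule lin_closed[OF F(2) w])
    have sy: "s k y \<in> carrier (deg F k)" by (rule lin_closed[OF s(1) y(1)])
    have dy: "dif E k y \<in> carrier (deg E (k + 1))" by (rule lin_closed[OF E(2) y(1)])
    have "u \<oplus>\<^bsub>deg F (k + 1)\<^esub> (s (k + 1) v \<oplus>\<^bsub>deg F (k + 1)\<^esub> dif F k w) = \<zero>\<^bsub>deg F (k + 1)\<^esub>"
      using a by (simp add: uvw Cdif[OF v]) (simp add: Cdeg dsum_simps interleave_eq_iff idx)
    then have u_eq: "\<ominus>\<^bsub>deg F (k + 1)\<^esub> (s (k + 1) v \<oplus>\<^bsub>deg F (k + 1)\<^esub> dif F k w) = u"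
      using u sv dw by (intro F1.minus_equality) auto
    \<comment> \<open>The primitive has components \<open>?u\<close>, \<open>y\<close> and zero. The
      last component of its differential is \<open>?u + s y\<close>, which must equal
      \<open>w\<close>; the first then comes out right because \<open>x\<close> is a cycle.\<close>
    let ?u = "w \<oplus>\<^bsub>deg F k\<^esub> \<ominus>\<^bsub>deg F k\<^esub> s k y"
    have "dif F k ?u = dif F k w \<oplus>\<^bsub>deg F (k + 1)\<^esub> \<ominus>\<^bsub>deg F (k + 1)\<^esub> s (k + 1) (dif E k y)"
      using lin_add[OF F(2) w Fk.a_inv_closed[OF sy]] lin_neg[OF F(1) F(1) F(2) sy] s(3)[OF y(1)] by simp
    also have "\<dots> = dif F k w \<oplus>\<^bsub>deg F (k + 1)\<^esub> s (k + 1) v"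
      using lin_neg[OF E(1) F(1) s(1) dy] y(2) by simp
    finally have "\<ominus>\<^bsub>deg F (k + 1)\<^esub> dif F k ?u = u"
      using u_eq sv dw by (simp add: F1.a_comm)
    moreover have "?u \<oplus>\<^bsub>deg F k\<^esub> (s k y \<oplus>\<^bsub>deg F k\<^esub> dif F (k - 1) \<zero>\<^bsub>deg F (k - 1)\<^esub>) = w"
      using lin_zero[OF F(1) F(1) F(2)[of "k - 1"]] w sy by (simp add: idx Fk.a_assoc Fk.l_neg)
    moreover have y': "y \<in> carrier (deg E (k - 1 + 1))" using y(1) by (simp only: idx)
    ultimately have "x = dif C (k - 1) (interleave ?u (interleave y \<zero>\<^bsub>deg F (k - 1)\<^esub>))"
      unfolding Cdif[OF y'] uvw by (simp add: idx y(2))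
    moreover have "interleave ?u (interleave y \<zero>\<^bsub>deg F (k - 1)\<^esub>) \<in> carrier (deg C (k - 1))"
      unfolding inC idx using w sy y(1) by (simp add: module_group_rules[OF F(1)])
    ultimately show "\<exists>z\<in>carrier (deg C (k - 1)). x = dif C (k - 1) z" by blast
  next
    fix k y assume "y \<in> carrier (deg (shift_dg 1 E) k)"
      and dy: "dif (shift_dg 1 E) k y = \<zero>\<^bsub>deg (shift_dg 1 E) (k + 1)\<^esub>"
    then have y: "y \<in> carrier (deg E (k + 1))" by (simp add: sh)
    interpret F1: module R "deg F (k + 1)" by (rule F)
    interpret E1: module R "deg E (k + 1)" by (rule E)
    interpret E2: module R "deg E (k + 2)" by (rule E)
    have sy: "s (k + 1) y \<in> carrier (deg F (k + 1))" by (rule lin_closed[OF s(1) y])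
    have dy': "dif E (k + 1) y \<in> carrier (deg E (k + 2))"
      using lin_closed[OF E(2) y] by (simp only: idx)
    then have dy0: "dif E (k + 1) y = \<zero>\<^bsub>deg E (k + 2)\<^esub>"
      using module_neg_eq_zero[OF E(1) dy'] dy unfolding sh idx by blast
    \<comment> \<open>A cycle \<open>y\<close> lifts with first component \<open>- s y\<close>,
      which cancels the term \<open>s y\<close> in the last component of the differential.\<close>
    let ?x = "interleave (\<ominus>\<^bsub>deg F (k + 1)\<^esub> s (k + 1) y) (interleave y \<zero>\<^bsub>deg F k\<^esub>)"
    have "dif F (k + 1) (\<ominus>\<^bsub>deg F (k + 1)\<^esub> s (k + 1) y) = \<zero>\<^bsub>deg F (k + 2)\<^esub>"
      using lin_neg[OF F(1) F(1) F(2) sy] s(3)[OF y] dy0 lin_zero[OF E(1) F(1) s(1)]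
      by (simp add: idx module_group_rules[OF F(1)])
    then have "dif C k ?x = \<zero>\<^bsub>deg C (k + 1)\<^esub>"
      unfolding Cdif[OF y] using dy0 sy lin_zero[OF F(1) F(1) F(2)[of k]]
      by (simp add: Cdeg dsum_simps idx module_group_rules[OF F(1)] module_group_rules[OF E(1)])
    moreover have "?x \<in> carrier (deg C k)"
      unfolding inC using y sy by (simp add: module_group_rules[OF F(1)])
    moreover have "y = p k ?x \<oplus>\<^bsub>deg (shift_dg 1 E) k\<^esub> dif (shift_dg 1 E) (k - 1) \<zero>\<^bsub>deg E k\<^esub>"
      using y lin_zero[OF E(1) E(1) E(2)[of k]] by (simp add: p_def sh idx)
    moreover have "\<zero>\<^bsub>deg E k\<^esub> \<in> carrier (deg (shift_dg 1 E) (k - 1))"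
      by (simp add: sh module_group_rules[OF E(1)])
    ultimately show "\<exists>x\<in>carrier (deg C k). dif C k x = \<zero>\<^bsub>deg C (k + 1)\<^esub> \<and>
        (\<exists>z\<in>carrier (deg (shift_dg 1 E) (k - 1)).
          y = p k x \<oplus>\<^bsub>deg (shift_dg 1 E) k\<^esub> dif (shift_dg 1 E) (k - 1) z)"
      by blast
  qed
qed

text \<open>This makes \<open>F -> cone_dg E F s\<close> invertible in the Verdier quotient once
  \<open>E\<close> is perfect: the cone of this map is \<open>E[1]\<close> up to
  quasi-isomorphism.\<close>

lemma perfect_dg_cone_cone_inr:
  assumes "koszul_dg_module R n f E" "koszul_dg_module R n f F" "s \<in> closed_maps R n E F"
    and "perfect_dg R n f E"
  shows "perfect_dg R n f (cone_dg F (cone_dg E F s) (cone_inr E))"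
  by (intro perfect_dg_quasi_iso[OF _ koszul_dg_module_shift[OF assms(1)] cone_cone_inr[OF assms(1-3)]]
      perfect_dg.shift assms koszul_dg_module_cone closed_maps_cone_inr[OF assms(1-3)])

end

section \<open>The Koszul algebra as a dg module\<close>

text \<open>The index set of the monomials \<open>\<epsilon>\<^sub>I\<close> of degree
  \<open>k\<close>, each \<open>I\<close> being replaced by its binary code because elements are
  sequences indexed by numbers.\<close>

definition koszul_codes :: "nat \<Rightarrow> int \<Rightarrow> nat set" where
  "koszul_codes n k = {c. set_decode c \<subseteq> {1..n} \<and> int (card (set_decode c)) = - k}"

lemma finite_koszul_codes: "finite (koszul_codes n k)"
proof -
  have "koszul_codes n k \<subseteq> set_encode ` Pow {1..n}"
  proof
    fix c assume "c \<in> koszul_codes n k"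
    then have "set_decode c \<in> Pow {1..n}" by (simp add: koszul_codes_def)
    then have "set_encode (set_decode c) \<in> set_encode ` Pow {1..n}" by (rule imageI)
    then show "c \<in> set_encode ` Pow {1..n}" by simp
  qed
  then show ?thesis by (rule finite_subset) simp
qed

lemma card_less_insert:
  fixes i m :: nat
  assumes "finite I" "m \<notin> I"
  shows "card {j \<in> insert m I. j < i} = (if m < i then 1 else 0) + card {j \<in> I. j < i}"
proof (cases "m < i")
  case True
  then have "{j \<in> insert m I. j < i} = insert m {j \<in> I. j < i}" by auto
  then show ?thesis using True assms by simp
next
  case False
  then have "{j \<in> insert m I. j < i} = {j \<in> I. j < i}" by auto
  then show ?thesis using False by simp
qed

declare set_encode_insert [simp del] \<comment> \<open>it would turn codes into sums of powers of 2\<close>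

context cring
begin

section \<open>Sign rules and anticommutation relations of the exterior algebra\<close>

lemma koszul_sign_closed: "b \<in> carrier R \<Longrightarrow> koszul_sign R i I b \<in> carrier R"
  by (simp add: koszul_sign_def)

lemma koszul_sign_insert:
  assumes "finite I" "m \<notin> I" "b \<in> carrier R"
  shows "koszul_sign R i (insert m I) b = (if m < i then \<ominus> koszul_sign R i I b else koszul_sign R i I b)"
  using card_less_insert[OF assms(1,2), of i] assms(3) by (simp add: koszul_sign_def del: insert_iff)

lemma koszul_sign_insert_self: "koszul_sign R i (insert i I) b = koszul_sign R i I b"
proof -
  have "{j \<in> insert i I. j < i} = {j \<in> I. j < i}" by auto
  then show ?thesis unfolding koszul_sign_def by simp
qed

lemma koszul_sign_remove_self: "koszul_sign R i (I - {i}) b = koszul_sign R i I b"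
proof -
  have "{j \<in> I - {i}. j < i} = {j \<in> I. j < i}" by auto
  then show ?thesis unfolding koszul_sign_def by simp
qed

lemma koszul_sign_neg: "b \<in> carrier R \<Longrightarrow> koszul_sign R i I (\<ominus> b) = \<ominus> koszul_sign R i I b"
  by (simp add: koszul_sign_def)

lemma koszul_sign_zero: "koszul_sign R i I \<zero> = \<zero>"
  by (simp add: koszul_sign_def)

lemma koszul_sign_add:
  "a \<in> carrier R \<Longrightarrow> b \<in> carrier R \<Longrightarrow>
    koszul_sign R i I (a \<oplus> b) = koszul_sign R i I a \<oplus> koszul_sign R i I b"
  by (simp add: koszul_sign_def minus_add)

lemma koszul_sign_mult:
  "a \<in> carrier R \<Longrightarrow> b \<in> carrier R \<Longrightarrow> koszul_sign R i I (a \<otimes> b) = a \<otimes> koszul_sign R i I b"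
  by (simp add: koszul_sign_def r_minus)

lemma koszul_sign_commute:
  "b \<in> carrier R \<Longrightarrow> koszul_sign R i I (koszul_sign R j J b) = koszul_sign R j J (koszul_sign R i I b)"
  by (simp add: koszul_sign_def)

lemma koszul_sign_involution:
  "b \<in> carrier R \<Longrightarrow> koszul_sign R i I (koszul_sign R i I b) = b"
  by (simp add: koszul_sign_def)

text \<open>\<open>koszul_ins i\<close> is multiplication by \<open>\<epsilon>\<^sub>i\<close> and \<open>koszul_del i\<close> the derivation \<open>\<partial>/\<partial>\<epsilon>\<^sub>i\<close>, so that the
  differential is \<open>\<Sum>i. f\<^sub>i \<partial>/\<partial>\<epsilon>\<^sub>i\<close>.\<close>

definition koszul_ins :: "nat \<Rightarrow> (nat \<Rightarrow> 'a) \<Rightarrow> nat \<Rightarrow> 'a" where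
  "koszul_ins i v c = (if i \<in> set_decode c
     then koszul_sign R i (set_decode c) (v (set_encode (set_decode c - {i}))) else \<zero>)"

definition koszul_del :: "nat \<Rightarrow> (nat \<Rightarrow> 'a) \<Rightarrow> nat \<Rightarrow> 'a" where
  "koszul_del i v c = (if i \<in> set_decode c then \<zero>
     else koszul_sign R i (set_decode c) (v (set_encode (insert i (set_decode c)))))"

lemma deg_koszul_algebra: "deg (koszul_algebra R n f) k = coeff_module R (koszul_codes n k)"
  by (simp add: koszul_algebra_def coeff_module_def koszul_codes_def)

lemma eps_koszul_algebra: "eps (koszul_algebra R n f) i k = koszul_ins i"
  by (simp add: koszul_algebra_def koszul_ins_def fun_eq_iff)

text \<open>For \<open>i \<noteq> j\<close> in the set coded by \<open>c\<close>, both terms involve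
  the same coefficient of \<open>v\<close>. The larger index counts the smaller one in exactly one
  of the two terms, so the signs are opposite. The same count settles \<open>koszul_del_del\<close>
  and \<open>koszul_del_ins\<close>.\<close>

lemma koszul_ins_ins:
  assumes "\<And>c. v c \<in> carrier R"
  shows "koszul_ins i (koszul_ins j v) c \<oplus> koszul_ins j (koszul_ins i v) c = \<zero>"
proof (cases "i \<in> set_decode c \<and> j \<in> set_decode c \<and> i \<noteq> j")
  case True
  \<comment> \<open>Both terms read \<open>v\<close> at the code of \<open>J\<close>; expressing all
    sets by insertions into \<open>J\<close> brings the signs into comparable form.\<close>
  define J where "J = set_decode c - {i, j}"
  have J: "set_decode c = insert i (insert j J)" "i \<notin> J" "j \<notin> J" "finite J"
    using True by (auto simp: J_def)
  have "insert i (insert j J) - {i} = insert j J" "insert i (insert j J) - {j} = insert i J"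
    "insert j J - {j} = J" "insert i J - {i} = J"
    using J True by auto
  then show ?thesis
    using True J assms
    unfolding koszul_ins_def
    by (auto simp: koszul_sign_insert koszul_sign_insert_self koszul_sign_neg
        koszul_sign_commute[of _ j] koszul_sign_closed l_neg r_neg)
qed (auto simp: koszul_ins_def koszul_sign_zero)

lemma koszul_ins_ins_self: "koszul_ins i (koszul_ins i v) c = \<zero>"
  by (simp add: koszul_ins_def koszul_sign_zero)

lemma koszul_del_del:
  assumes "\<And>c. v c \<in> carrier R"
  shows "koszul_del i (koszul_del j v) c \<oplus> koszul_del j (koszul_del i v) c = \<zero>"
proof (cases "i \<notin> set_decode c \<and> j \<notin> set_decode c \<and> i \<noteq> j")
  case True
  then show ?thesis
    using assms
    unfolding koszul_del_def
    by (auto simp: koszul_sign_insert koszul_sign_neg koszul_sign_commute[of _ j]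
        insert_commute[of i j] koszul_sign_closed l_neg r_neg)
qed (auto simp: koszul_del_def koszul_sign_zero)

lemma koszul_del_del_self: "koszul_del i (koszul_del i v) c = \<zero>"
  by (simp add: koszul_del_def koszul_sign_zero)

lemma koszul_del_ins:
  assumes "\<And>c. v c \<in> carrier R" "i \<noteq> j"
  shows "koszul_del i (koszul_ins j v) c \<oplus> koszul_ins j (koszul_del i v) c = \<zero>"
proof (cases "i \<notin> set_decode c \<and> j \<in> set_decode c")
  case True
  define J where "J = set_decode c - {j}"
  have J: "set_decode c = insert j J" "i \<notin> J" "j \<notin> J" "finite J"
    using True by (auto simp: J_def)
  have "insert j J - {j} = J" "insert i (insert j J) - {j} = insert i J"
    using J True assms(2) by auto
  then show ?thesis
    using True J assms
    unfolding koszul_ins_def koszul_del_def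
    by (auto simp: koszul_sign_insert koszul_sign_insert_self koszul_sign_neg
        koszul_sign_commute[of _ j] koszul_sign_closed l_neg r_neg)
qed (use assms(2) in \<open>auto simp: koszul_ins_def koszul_del_def koszul_sign_zero\<close>)

text \<open>Only one term contributes, according to whether \<open>i\<close> lies in the set coded
  by \<open>c\<close>. It carries the sign of \<open>i\<close> twice, and that sign does not depend
  on whether \<open>i\<close> itself is in the set.\<close>

lemma koszul_del_ins_self:
  assumes "\<And>c. v c \<in> carrier R"
  shows "koszul_del i (koszul_ins i v) c \<oplus> koszul_ins i (koszul_del i v) c = v c"
proof (cases "i \<in> set_decode c")
  case True
  then have "insert i (set_decode c) = set_decode c" by auto
  then show ?thesis
    using True assms koszul_sign_remove_self[of i "set_decode c"]
    by (simp add: koszul_ins_def koszul_del_def koszul_sign_involution koszul_sign_closed)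
next
  case False
  then have "insert i (set_decode c) - {i} = set_decode c" by auto
  then show ?thesis
    using False assms
    by (simp add: koszul_ins_def koszul_del_def koszul_sign_insert_self koszul_sign_involution)
qed

lemma koszul_ins_lin:
  assumes "i \<in> {1..n}"
  shows "koszul_ins i \<in> lin_maps R (coeff_module R (koszul_codes n k)) (coeff_module R (koszul_codes n (k - 1)))"
proof (rule lin_mapsI)
  fix v assume "v \<in> carrier (coeff_module R (koszul_codes n k))"
  then have v: "v c \<in> carrier R" "c \<notin> koszul_codes n k \<Longrightarrow> v c = \<zero>" for c
    by (auto simp: coeff_carrier_iff)
  have "koszul_ins i v c = \<zero>" if "c \<notin> koszul_codes n (k - 1)" for c
  proof (cases "i \<in> set_decode c")
    case True
    then have "card (set_decode c) = Suc (card (set_decode c - {i}))"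
      using card.remove[of "set_decode c" i] by simp
    then have "set_encode (set_decode c - {i}) \<notin> koszul_codes n k"
      using that True assms by (auto simp: koszul_codes_def)
    then show ?thesis using v by (simp add: koszul_ins_def koszul_sign_zero)
  qed (simp add: koszul_ins_def)
  then show "koszul_ins i v \<in> carrier (coeff_module R (koszul_codes n (k - 1)))"
    using v by (simp add: coeff_carrier_iff koszul_ins_def koszul_sign_closed)
next
  fix u v assume "u \<in> carrier (coeff_module R (koszul_codes n k))" "v \<in> carrier (coeff_module R (koszul_codes n k))"
  then show "koszul_ins i (u \<oplus>\<^bsub>coeff_module R (koszul_codes n k)\<^esub> v) =
    koszul_ins i u \<oplus>\<^bsub>coeff_module R (koszul_codes n (k - 1))\<^esub> koszul_ins i v"
    by (auto simp: coeff_carrier_iff coeff_simps koszul_ins_def koszul_sign_add fun_eq_iff)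
next
  fix r v assume "r \<in> carrier R" "v \<in> carrier (coeff_module R (koszul_codes n k))"
  then show "koszul_ins i (r \<odot>\<^bsub>coeff_module R (koszul_codes n k)\<^esub> v) =
    r \<odot>\<^bsub>coeff_module R (koszul_codes n (k - 1))\<^esub> koszul_ins i v"
    by (auto simp: coeff_carrier_iff coeff_simps koszul_ins_def koszul_sign_mult fun_eq_iff)
qed

lemma koszul_del_lin:
  assumes "i \<in> {1..n}"
  shows "koszul_del i \<in> lin_maps R (coeff_module R (koszul_codes n k)) (coeff_module R (koszul_codes n (k + 1)))"
proof (rule lin_mapsI)
  fix v assume "v \<in> carrier (coeff_module R (koszul_codes n k))"
  then have v: "v c \<in> carrier R" "c \<notin> koszul_codes n k \<Longrightarrow> v c = \<zero>" for c
    by (auto simp: coeff_carrier_iff)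
  have "koszul_del i v c = \<zero>" if "c \<notin> koszul_codes n (k + 1)" for c
  proof (cases "i \<in> set_decode c")
    case False
    then have "card (insert i (set_decode c)) = Suc (card (set_decode c))" by simp
    then have "set_encode (insert i (set_decode c)) \<notin> koszul_codes n k"
      using that False by (auto simp: koszul_codes_def)
    then show ?thesis using v by (simp add: koszul_del_def koszul_sign_zero)
  qed (simp add: koszul_del_def)
  then show "koszul_del i v \<in> carrier (coeff_module R (koszul_codes n (k + 1)))"
    using v by (simp add: coeff_carrier_iff koszul_del_def koszul_sign_closed)
next
  fix u v assume "u \<in> carrier (coeff_module R (koszul_codes n k))" "v \<in> carrier (coeff_module R (koszul_codes n k))"
  then show "koszul_del i (u \<oplus>\<^bsub>coeff_module R (koszul_codes n k)\<^esub> v) =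
    koszul_del i u \<oplus>\<^bsub>coeff_module R (koszul_codes n (k + 1))\<^esub> koszul_del i v"
    by (auto simp: coeff_carrier_iff coeff_simps koszul_del_def koszul_sign_add fun_eq_iff)
next
  fix r v assume "r \<in> carrier R" "v \<in> carrier (coeff_module R (koszul_codes n k))"
  then show "koszul_del i (r \<odot>\<^bsub>coeff_module R (koszul_codes n k)\<^esub> v) =
    r \<odot>\<^bsub>coeff_module R (koszul_codes n (k + 1))\<^esub> koszul_del i v"
    by (auto simp: coeff_carrier_iff coeff_simps koszul_del_def koszul_sign_mult fun_eq_iff)
qed

text \<open>The definition sums, for each coefficient \<open>c\<close>, over the indices outside the
  coded set. Padding with zeros makes the range independent of \<open>c\<close> and turns the
  differential into one combination of operators.\<close>

lemma dif_koszul_algebra: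
  assumes "f \<in> {1..n} \<rightarrow> carrier R" "v \<in> carrier (coeff_module R (koszul_codes n k))"
  shows "dif (koszul_algebra R n f) k v = finsum (coeff_module R (koszul_codes n (k + 1)))
    (\<lambda>i. f i \<odot>\<^bsub>coeff_module R (koszul_codes n (k + 1))\<^esub> koszul_del i v) {1..n}"
proof
  fix c
  note fc = funcset_mem[OF assms(1)]
  interpret M: module R "coeff_module R (koszul_codes n (k + 1))" by (rule module_coeff)
  have v: "v c \<in> carrier R" for c using assms(2) by (auto simp: coeff_carrier_iff)
  have "dif (koszul_algebra R n f) k v c = finsum R (\<lambda>i. f i \<otimes> koszul_del i v c) ({1..n} - set_decode c)"
    unfolding koszul_algebra_def kdg.simps using fc v
    by (intro finsum_cong') (auto simp: koszul_del_def koszul_sign_mult koszul_sign_closed)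
  also have "\<dots> = finsum R (\<lambda>i. f i \<otimes> koszul_del i v c) {1..n}"
    using fc v
    by (intro add.finprod_mono_neutral_cong_left) (auto simp: koszul_del_def koszul_sign_closed)
  also have "\<dots> = finsum (coeff_module R (koszul_codes n (k + 1)))
    (\<lambda>i. f i \<odot>\<^bsub>coeff_module R (koszul_codes n (k + 1))\<^esub> koszul_del i v) {1..n} c"
    using fc lin_closed[OF koszul_del_lin assms(2)] M.smult_closed
    by (subst coeff_finsum) (simp_all add: coeff_simps(3)[of "koszul_codes n (k + 1)", symmetric] Pi_iff, simp add: coeff_simps)
  finally show "dif (koszul_algebra R n f) k v c = \<dots>" .
qed

lemma dif_koszul_algebra_lin:
  assumes "f \<in> {1..n} \<rightarrow> carrier R"
  shows "dif (koszul_algebra R n f) k \<in>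
    lin_maps R (coeff_module R (koszul_codes n k)) (coeff_module R (koszul_codes n (k + 1)))"
proof -
  let ?M = "coeff_module R (koszul_codes n k)" and ?N = "coeff_module R (koszul_codes n (k + 1))"
  interpret M: module R ?M by (rule module_coeff)
  interpret N: module R ?N by (rule module_coeff)
  note fc = funcset_mem[OF assms]
  note cl = lin_closed[OF koszul_del_lin]
  show ?thesis
  proof (rule lin_mapsI)
    fix v assume v: "v \<in> carrier ?M"
    show "dif (koszul_algebra R n f) k v \<in> carrier ?N"
      unfolding dif_koszul_algebra[OF assms v] using fc cl[OF _ v]
      by (intro N.finsum_closed) auto
    fix r assume r: "r \<in> carrier R"
    have rv: "r \<odot>\<^bsub>?M\<^esub> v \<in> carrier ?M" using r v by simp
    have "f i \<odot>\<^bsub>?N\<^esub> koszul_del i (r \<odot>\<^bsub>?M\<^esub> v) = r \<odot>\<^bsub>?N\<^esub> (f i \<odot>\<^bsub>?N\<^esub> koszul_del i v)" if "i \<in> {1..n}" for i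
      using fc[OF that] r cl[OF that v] lin_smult[OF koszul_del_lin[OF that] r v]
      by (simp add: N.smult_assoc1[symmetric] m_comm)
    then have "dif (koszul_algebra R n f) k (r \<odot>\<^bsub>?M\<^esub> v) =
      finsum ?N (\<lambda>i. r \<odot>\<^bsub>?N\<^esub> (f i \<odot>\<^bsub>?N\<^esub> koszul_del i v)) {1..n}"
      unfolding dif_koszul_algebra[OF assms rv] using fc r cl[OF _ v]
      by (intro N.finsum_cong') auto
    then show "dif (koszul_algebra R n f) k (r \<odot>\<^bsub>?M\<^esub> v) = r \<odot>\<^bsub>?N\<^esub> dif (koszul_algebra R n f) k v"
      unfolding dif_koszul_algebra[OF assms v] using fc r cl[OF _ v]
      by (subst N.finsum_smult_ldistr) auto
  next
    fix u v assume u: "u \<in> carrier ?M" and v: "v \<in> carrier ?M"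
    have uv: "u \<oplus>\<^bsub>?M\<^esub> v \<in> carrier ?M" using u v by simp
    have "f i \<odot>\<^bsub>?N\<^esub> koszul_del i (u \<oplus>\<^bsub>?M\<^esub> v) =
        f i \<odot>\<^bsub>?N\<^esub> koszul_del i u \<oplus>\<^bsub>?N\<^esub> f i \<odot>\<^bsub>?N\<^esub> koszul_del i v" if "i \<in> {1..n}" for i
      using fc[OF that] cl[OF that u] cl[OF that v] lin_add[OF koszul_del_lin[OF that] u v]
      by (simp add: N.smult_r_distr)
    then have "dif (koszul_algebra R n f) k (u \<oplus>\<^bsub>?M\<^esub> v) =
      finsum ?N (\<lambda>i. f i \<odot>\<^bsub>?N\<^esub> koszul_del i u \<oplus>\<^bsub>?N\<^esub> f i \<odot>\<^bsub>?N\<^esub> koszul_del i v) {1..n}"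
      unfolding dif_koszul_algebra[OF assms uv] using fc cl[OF _ u] cl[OF _ v]
      by (intro N.finsum_cong') auto
    then show "dif (koszul_algebra R n f) k (u \<oplus>\<^bsub>?M\<^esub> v) =
        dif (koszul_algebra R n f) k u \<oplus>\<^bsub>?N\<^esub> dif (koszul_algebra R n f) k v"
      unfolding dif_koszul_algebra[OF assms u] dif_koszul_algebra[OF assms v]
      using fc cl[OF _ u] cl[OF _ v]
      by (subst N.finsum_addf[symmetric]) auto
  qed
qed

text \<open>With the differential written as
  \<open>\<Sum>i. f\<^sub>i \<partial>/\<partial>\<epsilon>\<^sub>i\<close>, its square is a double
  sum that is alternating in the two indices, and its anticommutator with
  \<open>\<epsilon>\<^sub>j\<close> reduces to the single term \<open>f\<^sub>j\<close>.\<close>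

lemma koszul_dg_module_koszul_algebra:
  assumes "f \<in> {1..n} \<rightarrow> carrier R"
  shows "koszul_dg_module R n f (koszul_algebra R n f)"
proof (rule koszul_dg_moduleI)
  note fc = funcset_mem[OF assms]
  let ?C = "\<lambda>k. coeff_module R (koszul_codes n k)"
  let ?K = "koszul_algebra R n f"
  have idx: "k + 1 + 1 = k + 2" "k - 1 + 1 = k" "k + 1 - 1 = k" "k - 1 - 1 = k - 2" for k :: int by auto
  show "module R (deg ?K k)" for k unfolding deg_koszul_algebra by (rule module_coeff)
  show "dif ?K k \<in> lin_maps R (deg ?K k) (deg ?K (k + 1))" for k
    unfolding deg_koszul_algebra using assms by (rule dif_koszul_algebra_lin)
  show "eps ?K i k \<in> lin_maps R (deg ?K k) (deg ?K (k - 1))" if "i \<in> {1..n}" for i k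
    unfolding deg_koszul_algebra eps_koszul_algebra using that by (rule koszul_ins_lin)
  fix k v assume "v \<in> carrier (deg ?K k)"
  then have v: "v \<in> carrier (?C k)" by (simp only: deg_koszul_algebra)
  then have vc: "v c \<in> carrier R" for c by (simp add: coeff_carrier_iff)
  interpret C0: module R "?C k" by (rule module_coeff)
  interpret C1: module R "?C (k + 1)" by (rule module_coeff)
  interpret C2: module R "?C (k + 2)" by (rule module_coeff)
  have del1: "koszul_del i v \<in> carrier (?C (k + 1))" if "i \<in> {1..n}" for i
    by (rule lin_closed[OF koszul_del_lin[OF that] v])
  have del2: "koszul_del i (koszul_del j v) \<in> carrier (?C (k + 2))"
    if "i \<in> {1..n}" "j \<in> {1..n}" for i j
    using lin_closed[OF koszul_del_lin[OF that(1)] del1[OF that(2)]] by (simp only: idx)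
  have "koszul_del i (dif ?K k v) =
      finsum (?C (k + 2)) (\<lambda>j. f j \<odot>\<^bsub>?C (k + 2)\<^esub> koszul_del i (koszul_del j v)) {1..n}"
    if i: "i \<in> {1..n}" for i
  proof -
    have "koszul_del i (dif ?K k v) =
        finsum (?C (k + 1 + 1)) (\<lambda>j. koszul_del i (f j \<odot>\<^bsub>?C (k + 1)\<^esub> koszul_del j v)) {1..n}"
      unfolding dif_koszul_algebra[OF assms v] using fc del1
      by (intro lin_finsum[OF module_coeff module_coeff koszul_del_lin[OF i]]) auto
    also have "\<dots> = finsum (?C (k + 2)) (\<lambda>j. f j \<odot>\<^bsub>?C (k + 2)\<^esub> koszul_del i (koszul_del j v)) {1..n}"
      unfolding idx using fc del2[OF i] lin_smult[OF koszul_del_lin[OF i] _ del1, unfolded idx]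
      by (intro C2.finsum_cong') auto
    finally show ?thesis .
  qed
  moreover have dv: "dif ?K k v \<in> carrier (?C (k + 1))"
    using lin_closed[OF dif_koszul_algebra_lin[OF assms] v] .
  ultimately have "dif ?K (k + 1) (dif ?K k v) = finsum (?C (k + 2)) (\<lambda>i. f i \<odot>\<^bsub>?C (k + 2)\<^esub>
      finsum (?C (k + 2)) (\<lambda>j. f j \<odot>\<^bsub>?C (k + 2)\<^esub> koszul_del i (koszul_del j v)) {1..n}) {1..n}"
    using dif_koszul_algebra[OF assms dv] assms del2
    by (simp only: idx) (intro C2.finsum_cong', auto intro!: C2.smult_closed C2.finsum_closed)
  also have "\<dots> = finsum (?C (k + 2)) (\<lambda>i. finsum (?C (k + 2))
      (\<lambda>j. (f i \<otimes> f j) \<odot>\<^bsub>?C (k + 2)\<^esub> koszul_del i (koszul_del j v)) {1..n}) {1..n}"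
  proof (intro C2.finsum_cong')
    fix i assume i: "i \<in> {1..n}"
    have "f i \<odot>\<^bsub>?C (k + 2)\<^esub> finsum (?C (k + 2)) (\<lambda>j. f j \<odot>\<^bsub>?C (k + 2)\<^esub> koszul_del i (koszul_del j v)) {1..n}
      = finsum (?C (k + 2)) (\<lambda>j. f i \<odot>\<^bsub>?C (k + 2)\<^esub> (f j \<odot>\<^bsub>?C (k + 2)\<^esub> koszul_del i (koszul_del j v))) {1..n}"
      using fc i del2 by (intro C2.finsum_smult_ldistr) auto
    also have "\<dots> = finsum (?C (k + 2)) (\<lambda>j. (f i \<otimes> f j) \<odot>\<^bsub>?C (k + 2)\<^esub> koszul_del i (koszul_del j v)) {1..n}"
      using fc i del2 by (intro C2.finsum_cong') (auto simp: C2.smult_assoc1)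
    finally show "f i \<odot>\<^bsub>?C (k + 2)\<^esub> finsum (?C (k + 2)) (\<lambda>j. f j \<odot>\<^bsub>?C (k + 2)\<^esub> koszul_del i (koszul_del j v)) {1..n}
      = finsum (?C (k + 2)) (\<lambda>j. (f i \<otimes> f j) \<odot>\<^bsub>?C (k + 2)\<^esub> koszul_del i (koszul_del j v)) {1..n}" .
  qed (use fc del2 in \<open>auto intro!: C2.finsum_closed\<close>)
  also have "\<dots> = \<zero>\<^bsub>?C (k + 2)\<^esub>"
  proof (rule C2.finsum_antisymmetric)
    fix i j assume i: "i \<in> {1..n}" and j: "j \<in> {1..n}"
    show "(f i \<otimes> f j) \<odot>\<^bsub>?C (k + 2)\<^esub> koszul_del i (koszul_del j v) \<in> carrier (?C (k + 2))"
      using fc i j del2 by auto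
    have "(f i \<otimes> f j) \<odot>\<^bsub>?C (k + 2)\<^esub> koszul_del i (koszul_del j v) \<oplus>\<^bsub>?C (k + 2)\<^esub>
        (f i \<otimes> f j) \<odot>\<^bsub>?C (k + 2)\<^esub> koszul_del j (koszul_del i v) =
      (f i \<otimes> f j) \<odot>\<^bsub>?C (k + 2)\<^esub> (koszul_del i (koszul_del j v) \<oplus>\<^bsub>?C (k + 2)\<^esub> koszul_del j (koszul_del i v))"
      using fc i j del2 by (simp add: C2.smult_r_distr)
    moreover have "koszul_del i (koszul_del j v) \<oplus>\<^bsub>?C (k + 2)\<^esub> koszul_del j (koszul_del i v) = \<zero>\<^bsub>?C (k + 2)\<^esub>"
      using koszul_del_del[OF vc] by (simp add: coeff_simps)
    ultimately show "(f i \<otimes> f j) \<odot>\<^bsub>?C (k + 2)\<^esub> koszul_del i (koszul_del j v) \<oplus>\<^bsub>?C (k + 2)\<^esub>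
        (f j \<otimes> f i) \<odot>\<^bsub>?C (k + 2)\<^esub> koszul_del j (koszul_del i v) = \<zero>\<^bsub>?C (k + 2)\<^esub>"
      using fc i j by (simp add: m_comm[of "f j"])
  next
    fix i assume i: "i \<in> {1..n}"
    have "koszul_del i (koszul_del i v) = \<zero>\<^bsub>?C (k + 2)\<^esub>"
      by (simp add: coeff_simps koszul_del_del_self fun_eq_iff)
    then show "(f i \<otimes> f i) \<odot>\<^bsub>?C (k + 2)\<^esub> koszul_del i (koszul_del i v) = \<zero>\<^bsub>?C (k + 2)\<^esub>"
      using fc i by simp
  qed simp
  finally show "dif ?K (k + 1) (dif ?K k v) = \<zero>\<^bsub>deg ?K (k + 2)\<^esub>"
    by (simp only: deg_koszul_algebra)
  {
    fix i j assume i: "i \<in> {1..n}" and j: "j \<in> {1..n}"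
    show "eps ?K i (k - 1) (eps ?K i k v) = \<zero>\<^bsub>deg ?K (k - 2)\<^esub>"
      by (simp add: deg_koszul_algebra eps_koszul_algebra coeff_simps koszul_ins_ins_self fun_eq_iff)
    show "eps ?K i (k - 1) (eps ?K j k v) \<oplus>\<^bsub>deg ?K (k - 2)\<^esub> eps ?K j (k - 1) (eps ?K i k v)
        = \<zero>\<^bsub>deg ?K (k - 2)\<^esub>"
      using koszul_ins_ins[OF vc] by (simp add: deg_koszul_algebra eps_koszul_algebra coeff_simps)
  }
  {
    fix j assume j: "j \<in> {1..n}"
    have ins: "koszul_ins j v \<in> carrier (?C (k - 1))"
      by (rule lin_closed[OF koszul_ins_lin[OF j] v])
    have di: "koszul_del i (koszul_ins j v) \<in> carrier (?C k)" if "i \<in> {1..n}" for i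
      using lin_closed[OF koszul_del_lin[OF that] ins] by (simp only: idx)
    have id: "koszul_ins j (koszul_del i v) \<in> carrier (?C k)" if "i \<in> {1..n}" for i
      using lin_closed[OF koszul_ins_lin[OF j] del1[OF that]] by (simp only: idx)
    have "dif ?K (k - 1) (koszul_ins j v) =
        finsum (?C k) (\<lambda>i. f i \<odot>\<^bsub>?C k\<^esub> koszul_del i (koszul_ins j v)) {1..n}"
      using dif_koszul_algebra[OF assms ins] by (simp only: idx)
    moreover have "koszul_ins j (dif ?K k v) =
        finsum (?C k) (\<lambda>i. f i \<odot>\<^bsub>?C k\<^esub> koszul_ins j (koszul_del i v)) {1..n}"
    proof -
      have "koszul_ins j (dif ?K k v) =
          finsum (?C (k + 1 - 1)) (\<lambda>i. koszul_ins j (f i \<odot>\<^bsub>?C (k + 1)\<^esub> koszul_del i v)) {1..n}"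
        unfolding dif_koszul_algebra[OF assms v] using fc del1
        by (intro lin_finsum[OF module_coeff module_coeff koszul_ins_lin[OF j]]) auto
      also have "\<dots> = finsum (?C k) (\<lambda>i. f i \<odot>\<^bsub>?C k\<^esub> koszul_ins j (koszul_del i v)) {1..n}"
        unfolding idx using fc id lin_smult[OF koszul_ins_lin[OF j] _ del1, unfolded idx]
        by (intro C0.finsum_cong') auto
      finally show ?thesis .
    qed
    ultimately have "dif ?K (k - 1) (koszul_ins j v) \<oplus>\<^bsub>?C k\<^esub> koszul_ins j (dif ?K k v) =
      finsum (?C k) (\<lambda>i. f i \<odot>\<^bsub>?C k\<^esub> koszul_del i (koszul_ins j v) \<oplus>\<^bsub>?C k\<^esub>
        f i \<odot>\<^bsub>?C k\<^esub> koszul_ins j (koszul_del i v)) {1..n}"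
      using fc di id by (simp add: C0.finsum_addf Pi_iff)
    also have "\<dots> = finsum (?C k) (\<lambda>i. if j = i then f i \<odot>\<^bsub>?C k\<^esub> v else \<zero>\<^bsub>?C k\<^esub>) {1..n}"
    proof (intro C0.finsum_cong')
      fix i assume i: "i \<in> {1..n}"
      have "koszul_del i (koszul_ins j v) \<oplus>\<^bsub>?C k\<^esub> koszul_ins j (koszul_del i v) =
          (if j = i then v else \<zero>\<^bsub>?C k\<^esub>)"
        using koszul_del_ins[OF vc] koszul_del_ins_self[OF vc] by (auto simp: coeff_simps fun_eq_iff)
      then have "f i \<odot>\<^bsub>?C k\<^esub> (koszul_del i (koszul_ins j v) \<oplus>\<^bsub>?C k\<^esub> koszul_ins j (koszul_del i v)) =
          (if j = i then f i \<odot>\<^bsub>?C k\<^esub> v else \<zero>\<^bsub>?C k\<^esub>)"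
        using fc[OF i] by simp
      then show "f i \<odot>\<^bsub>?C k\<^esub> koszul_del i (koszul_ins j v) \<oplus>\<^bsub>?C k\<^esub>
          f i \<odot>\<^bsub>?C k\<^esub> koszul_ins j (koszul_del i v) = (if j = i then f i \<odot>\<^bsub>?C k\<^esub> v else \<zero>\<^bsub>?C k\<^esub>)"
        using fc[OF i] di[OF i] id[OF i] by (simp add: C0.smult_r_distr)
    qed (use fc v in auto)
    also have "\<dots> = f j \<odot>\<^bsub>?C k\<^esub> v"
      using fc v j by (intro C0.finsum_singleton) auto
    finally show "dif ?K (k - 1) (eps ?K j k v) \<oplus>\<^bsub>deg ?K k\<^esub> eps ?K j (k + 1) (dif ?K k v)
        = f j \<odot>\<^bsub>deg ?K k\<^esub> v"
      by (simp only: deg_koszul_algebra eps_koszul_algebra)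
  }
qed

end

section \<open>Maps out of the Koszul algebra\<close>

text \<open>The operator \<open>eps X i\<close> takes its source degree as an argument; for
  \<open>x\<close> in degree 0 this is minus the number of letters already applied.\<close>

primrec eps_word :: "'b kdg \<Rightarrow> (nat \<Rightarrow> 'b) \<Rightarrow> nat list \<Rightarrow> (nat \<Rightarrow> 'b)" where
  "eps_word X x [] = x"
| "eps_word X x (i # l) = eps X i (- int (length l)) (eps_word X x l)"

text \<open>The product \<open>\<epsilon>\<^sub>I x\<close> for \<open>x\<close> in degree 0.\<close>

definition eps_act :: "'b kdg \<Rightarrow> (nat \<Rightarrow> 'b) \<Rightarrow> nat set \<Rightarrow> (nat \<Rightarrow> 'b)" where
  "eps_act X x I = eps_word X x (sorted_list_of_set I)"

lemma eps_act_empty: "eps_act X x {} = x"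
  by (simp add: eps_act_def)

text \<open>A new minimum becomes the head of the sorted word, so no sign arises. The inductions
  below therefore build sets by inserting minima.\<close>

lemma eps_act_insert:
  assumes "finite I" "\<forall>j\<in>I. i < j"
  shows "eps_act X x (insert i I) = eps X i (- int (card I)) (eps_act X x I)"
proof -
  have "i \<notin> I" using assms(2) by blast
  then have "sorted_list_of_set (insert i I) = insort i (sorted_list_of_set I)"
    using assms(1) by simp
  also have "\<dots> = i # sorted_list_of_set I"
    using assms by (intro insort_is_Cons) auto
  finally show ?thesis using assms(1) by (simp add: eps_act_def)
qed

lemma koszul_sign_min: "\<forall>j\<in>I. i < j \<Longrightarrow> koszul_sign R i I b = b"
proof -
  assume "\<forall>j\<in>I. i < j"
  then have "{j \<in> I. j < i} = {}" by auto
  then show ?thesis by (simp only: koszul_sign_def card.empty even_zero if_True)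
qed

context cring
begin

lemma eps_act_closed:
  assumes X: "koszul_dg_module R n f X" and x: "x \<in> carrier (deg X 0)" and I: "I \<subseteq> {1..n}"
  shows "eps_act X x I \<in> carrier (deg X (- int (card I)))"
proof -
  have "finite I" using I finite_subset by blast
  then show ?thesis using I
  proof (induction I rule: finite_linorder_min_induct)
    case (insert m I)
    then have m: "m \<in> {1..n}" and "m \<notin> I" by auto
    then have "- int (card (insert m I)) = - int (card I) - 1" using insert.hyps by simp
    then show ?case
      using insert lin_closed[OF koszul_dg_moduleD(4)[OF X m]] by (simp add: eps_act_insert)
  qed (simp add: eps_act_empty x)
qed

text \<open>\<open>\<epsilon>\<^sub>i\<close> is moved past the smaller letters by anticommutation
  until it meets itself and squares to zero.\<close>

lemma eps_eps_act_mem: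
  assumes X: "koszul_dg_module R n f X" and x: "x \<in> carrier (deg X 0)" and I: "I \<subseteq> {1..n}"
    and "i \<in> I"
  shows "eps X i (- int (card I)) (eps_act X x I) = \<zero>\<^bsub>deg X (- int (card I) - 1)\<^esub>"
proof -
  note D = koszul_dg_moduleD[OF X]
  have "finite I" using I finite_subset by blast
  then show ?thesis using I \<open>i \<in> I\<close>
  proof (induction I rule: finite_linorder_min_induct)
    case (insert m I)
    define k where "k = - int (card I)"
    have m: "m \<in> {1..n}" and mI: "m \<notin> I" and i: "i \<in> {1..n}" using insert by auto
    have card: "- int (card (insert m I)) = k - 1" using insert.hyps mI by (simp add: k_def)
    define y where "y = eps_act X x I"
    have y: "y \<in> carrier (deg X k)"
      unfolding y_def k_def using insert.prems by (intro eps_act_closed[OF X x]) auto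
    have act: "eps_act X x (insert m I) = eps X m k y"
      using eps_act_insert[OF insert.hyps] by (simp add: k_def y_def)
    have "eps X i (k - 1) (eps X m k y) = \<zero>\<^bsub>deg X (k - 2)\<^esub>"
    proof (cases "i = m")
      case True
      then show ?thesis using D(5)[OF m y] by simp
    next
      case False
      then have "eps X i k y = \<zero>\<^bsub>deg X (k - 1)\<^esub>"
        using insert by (simp add: k_def y_def)
      then have "eps X m (k - 1) (eps X i k y) = \<zero>\<^bsub>deg X (k - 2)\<^esub>"
        using lin_zero[OF D(1) D(1) D(4)[OF m, of "k - 1"]] by simp
      moreover have "eps X i (k - 1) (eps X m k y) \<in> carrier (deg X (k - 2))"
        using lin_closed[OF D(4)[OF i] lin_closed[OF D(4)[OF m] y]] by simp
      ultimately show ?thesis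
        using D(7)[OF i m y] by (simp add: module_group_rules[OF D(1)])
    qed
    then show ?case unfolding act card by simp
  qed simp
qed

text \<open>Each smaller letter that \<open>\<epsilon>\<^sub>i\<close> passes costs a factor -1, and
  \<open>koszul_sign\<close> counts exactly these. The sign is written as a scalar since
  \<open>X\<close> is an arbitrary dg module.\<close>

lemma eps_eps_act:
  assumes X: "koszul_dg_module R n f X" and x: "x \<in> carrier (deg X 0)" and I: "I \<subseteq> {1..n}"
    and i: "i \<in> {1..n}" "i \<notin> I"
  shows "eps X i (- int (card I)) (eps_act X x I) =
    koszul_sign R i I \<one> \<odot>\<^bsub>deg X (- int (card I) - 1)\<^esub> eps_act X x (insert i I)"
proof -
  note D = koszul_dg_moduleD[OF X]
  have cl: "eps_act X x (insert i I) \<in> carrier (deg X (- int (card I) - 1))" if "I \<subseteq> {1..n}" "i \<notin> I" for I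
  proof -
    have "finite I" using that finite_subset by blast
    then have "- int (card (insert i I)) = - int (card I) - 1" using that by simp
    then show ?thesis using eps_act_closed[OF X x, of "insert i I"] that i by simp
  qed
  have fin: "finite I" using I finite_subset by blast
  then show ?thesis using I \<open>i \<notin> I\<close>
  proof (induction I rule: finite_linorder_min_induct)
    case empty
    interpret M: module R "deg X (- 1)" by (rule D)
    show ?case
      using cl[of "{}"] eps_act_insert[of "{}" i X x] by (simp add: koszul_sign_min)
  next
    case (insert m I)
    define k where "k = - int (card I)"
    have m: "m \<in> {1..n}" and mI: "m \<notin> I" and im: "i \<noteq> m" and I: "I \<subseteq> {1..n}" and iI: "i \<notin> I"
      using insert by auto
    have card: "- int (card (insert m I)) = k - 1" "- int (card (insert i I)) = k - 1"
      using insert.hyps mI iI by (simp_all add: k_def)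
    interpret M: module R "deg X (k - 2)" by (rule D)
    define y where "y = eps_act X x I"
    have y: "y \<in> carrier (deg X k)"
      unfolding y_def k_def using I by (rule eps_act_closed[OF X x])
    have act: "eps_act X x (insert m I) = eps X m k y"
      using eps_act_insert[OF insert.hyps(1,2)] by (simp add: k_def y_def)
    have cl': "eps_act X x (insert i (insert m I)) \<in> carrier (deg X (k - 2))"
      using cl[of "insert m I"] insert.prems unfolding card by simp
    have "eps X i (k - 1) (eps X m k y) =
      koszul_sign R i (insert m I) \<one> \<odot>\<^bsub>deg X (k - 2)\<^esub> eps_act X x (insert i (insert m I))"
    proof (cases "i < m")
      case True
      then have min: "\<forall>j\<in>insert m I. i < j" using insert.hyps by auto
      show ?thesis
        using eps_act_insert[OF _ min, of X x] insert.hyps card cl' act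
        by (simp add: koszul_sign_min[OF min])
    next
      case False
      then have mi: "m < i" using im by simp
      then have min: "\<forall>j\<in>insert i I. m < j" using insert.hyps by auto
      define s where "s = koszul_sign R i I \<one>"
      have s: "s \<in> carrier R" by (simp add: s_def koszul_sign_closed)
      have z: "eps_act X x (insert i I) \<in> carrier (deg X (k - 1))"
        using cl[OF I iI] by (simp add: k_def)
      have ey: "eps X i k y = s \<odot>\<^bsub>deg X (k - 1)\<^esub> eps_act X x (insert i I)"
        using insert.IH[OF I iI] by (simp add: k_def y_def s_def)
      have "eps X m (k - 1) (eps X i k y) =
          s \<odot>\<^bsub>deg X (k - 2)\<^esub> eps X m (k - 1) (eps_act X x (insert i I))"
        unfolding ey using lin_smult[OF D(4)[OF m] s z] by simp
      also have "eps X m (k - 1) (eps_act X x (insert i I)) = eps_act X x (insert i (insert m I))"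
        using eps_act_insert[OF _ min, of X x] insert.hyps card(2) by (simp add: insert_commute)
      finally have 1: "eps X m (k - 1) (eps X i k y) = s \<odot>\<^bsub>deg X (k - 2)\<^esub> eps_act X x (insert i (insert m I))" .
      have "eps X i (k - 1) (eps X m k y) \<in> carrier (deg X (k - 2))"
        using lin_closed[OF D(4)[OF i(1)] lin_closed[OF D(4)[OF m] y]] by simp
      then have "\<ominus>\<^bsub>deg X (k - 2)\<^esub> eps X m (k - 1) (eps X i k y) = eps X i (k - 1) (eps X m k y)"
        using D(7)[OF i(1) m y] s cl' unfolding 1 by (intro M.minus_equality) auto
      moreover have "koszul_sign R i (insert m I) \<one> = \<ominus> s"
        using insert.hyps mI mi by (simp add: koszul_sign_insert s_def)
      ultimately show ?thesis using s cl' 1 by (simp add: M.smult_l_minus)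
    qed
    then show ?case unfolding act card by simp
  qed
qed

text \<open>The Leibniz rule for a cycle \<open>x\<close>, from \<open>d \<epsilon>\<^sub>m y =
  f\<^sub>m y - \<epsilon>\<^sub>m d y\<close> with \<open>m\<close> the minimum. The sum runs over
  \<open>{1..n}\<close>, padded with zeros, to match \<open>dif_koszul_algebra\<close>.\<close>

lemma dif_eps_act:
  assumes X: "koszul_dg_module R n f X" and x: "x \<in> carrier (deg X 0)" and I: "I \<subseteq> {1..n}"
    and f: "f \<in> {1..n} \<rightarrow> carrier R" and dx: "dif X 0 x = \<zero>\<^bsub>deg X 1\<^esub>"
  shows "dif X (- int (card I)) (eps_act X x I) =
    finsum (deg X (1 - int (card I)))
      (\<lambda>i. f i \<odot>\<^bsub>deg X (1 - int (card I))\<^esub>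
        (if i \<in> I then koszul_sign R i I \<one> \<odot>\<^bsub>deg X (1 - int (card I))\<^esub> eps_act X x (I - {i})
         else \<zero>\<^bsub>deg X (1 - int (card I))\<^esub>)) {1..n}"
proof -
  note D = koszul_dg_moduleD[OF X]
  note fc = funcset_mem[OF f]
  define t where "t = (\<lambda>I i. if i \<in> I
    then koszul_sign R i I \<one> \<odot>\<^bsub>deg X (1 - int (card I))\<^esub> eps_act X x (I - {i})
    else \<zero>\<^bsub>deg X (1 - int (card I))\<^esub>)"
  have act_rem: "eps_act X x (I - {i}) \<in> carrier (deg X (1 - int (card I)))"
    "- int (card (I - {i})) = 1 - int (card I)"
    if "I \<subseteq> {1..n}" "i \<in> I" for I i
  proof -
    have "finite I" using that finite_subset by blast
    then have "int (card I) = int (card (I - {i})) + 1" using that card.remove[of I i] by simp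
    then show "- int (card (I - {i})) = 1 - int (card I)" by simp
    then show "eps_act X x (I - {i}) \<in> carrier (deg X (1 - int (card I)))"
      using eps_act_closed[OF X x, of "I - {i}"] that by (metis Diff_subset subset_trans)
  qed
  have t: "t I i \<in> carrier (deg X (1 - int (card I)))" if "I \<subseteq> {1..n}" for I i
    using act_rem(1)[OF that] module.smult_closed[OF D(1)] koszul_sign_closed
    by (auto simp: t_def module_group_rules[OF D(1)])
  have fin: "finite I" using I finite_subset by blast
  have "dif X (- int (card I)) (eps_act X x I) = finsum (deg X (1 - int (card I)))
      (\<lambda>i. f i \<odot>\<^bsub>deg X (1 - int (card I))\<^esub> t I i) {1..n}"
    using fin I
  proof (induction I rule: finite_linorder_min_induct)
    case empty
    interpret M: module R "deg X 1" by (rule D)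
    have "finsum (deg X 1) (\<lambda>i. f i \<odot>\<^bsub>deg X 1\<^esub> t {} i) {1..n} = \<zero>\<^bsub>deg X 1\<^esub>"
      using fc by (intro M.add.finprod_one_eqI) (auto simp: t_def)
    then show ?case using dx by (simp add: eps_act_empty)
  next
    case (insert m I)
    define k where "k = - int (card I)"
    have m: "m \<in> {1..n}" and mI: "m \<notin> I" and I: "I \<subseteq> {1..n}"
      using insert by auto
    have card: "- int (card (insert m I)) = k - 1" "1 - int (card (insert m I)) = k" "1 - int (card I) = k + 1"
      "- int (card I) = k"
      using insert.hyps mI by (simp_all add: k_def)
    interpret M: module R "deg X k" by (rule D)
    interpret M1: module R "deg X (k + 1)" by (rule D)
    define y where "y = eps_act X x I"
    have y: "y \<in> carrier (deg X k)"
      unfolding y_def k_def using I by (rule eps_act_closed[OF X x])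
    have act: "eps_act X x (insert m I) = eps X m k y"
      using eps_act_insert[OF insert.hyps(1,2)] by (simp add: k_def y_def)
    have em: "eps X m (k + 1) \<in> lin_maps R (deg X (k + 1)) (deg X k)"
      using D(4)[OF m, of "k + 1"] by simp
    have tI: "t I i \<in> carrier (deg X (k + 1))" for i using t[OF I, of i] by (simp only: card)
    have tmI: "t (insert m I) i \<in> carrier (deg X k)" for i
      using t[OF insert.prems, of i] by (simp only: card)
    \<comment> \<open>These are the terms of \<open>\<epsilon>\<^sub>m d y\<close>, where
      \<open>y\<close> is \<open>\<epsilon>\<^sub>I x\<close>.\<close>
    define u where "u = (\<lambda>i. eps X m (k + 1) (t I i))"
    have u: "u i \<in> carrier (deg X k)" for i unfolding u_def by (rule lin_closed[OF em tI])
    have "eps X m (k + 1) (dif X k y) =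
        finsum (deg X k) (\<lambda>i. eps X m (k + 1) (f i \<odot>\<^bsub>deg X (k + 1)\<^esub> t I i)) {1..n}"
      using insert.IH[OF I] fc tI unfolding card y_def[symmetric]
      by (simp only:) (intro lin_finsum[OF D(1) D(1) em], auto)
    also have "\<dots> = finsum (deg X k) (\<lambda>i. f i \<odot>\<^bsub>deg X k\<^esub> u i) {1..n}"
      unfolding u_def using fc tI lin_closed[OF em tI] lin_smult[OF em _ tI]
      by (intro M.finsum_cong') auto
    finally have edy: "eps X m (k + 1) (dif X k y) = finsum (deg X k) (\<lambda>i. f i \<odot>\<^bsub>deg X k\<^esub> u i) {1..n}" .
    \<comment> \<open>For \<open>i\<close> in \<open>I\<close>, adding the smaller letter
      \<open>m\<close> to the set flips the sign of \<open>i\<close>, so \<open>t\<close> and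
      \<open>u\<close> cancel. At \<open>i = m\<close> the term \<open>t\<close> is \<open>y\<close>
      itself and \<open>u\<close> vanishes.\<close>
    have tu: "t (insert m I) i \<oplus>\<^bsub>deg X k\<^esub> u i = (if m = i then y else \<zero>\<^bsub>deg X k\<^esub>)" for i
    proof (cases "m = i")
      case True
      then have "u i = \<zero>\<^bsub>deg X k\<^esub>"
        using mI lin_zero[OF D(1) D(1) em] by (simp add: u_def t_def card)
      moreover have "t (insert m I) i = y"
        using True mI insert.hyps y
        by (simp add: t_def card y_def koszul_sign_insert_self koszul_sign_min)
      ultimately show ?thesis using True y by simp
    next
      case False
      show ?thesis
      proof (cases "i \<in> I")
        case True
        define s where "s = koszul_sign R i I \<one>"
        have s: "s \<in> carrier R" by (simp add: s_def koszul_sign_closed)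
        have min: "\<forall>j\<in>I - {i}. m < j" using insert.hyps by auto
        have mi: "m < i" using True insert.hyps by auto
        have z: "eps_act X x (I - {i}) \<in> carrier (deg X (k + 1))"
          using act_rem(1)[OF I True] by (simp only: card)
        have ez: "eps X m (k + 1) (eps_act X x (I - {i})) = eps_act X x (insert m (I - {i}))"
          using eps_act_insert[OF _ min, of X x] insert.hyps act_rem(2)[OF I True] by (simp add: card)
        then have a: "eps_act X x (insert m (I - {i})) \<in> carrier (deg X k)"
          using lin_closed[OF em z] by simp
        have "u i = s \<odot>\<^bsub>deg X k\<^esub> eps_act X x (insert m (I - {i}))"
          using True lin_smult[OF em s z] ez by (simp add: u_def t_def card s_def)
        moreover have "insert m I - {i} = insert m (I - {i})" using False by auto
        moreover have "koszul_sign R i (insert m I) \<one> = \<ominus> s"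
          using insert.hyps mI mi by (simp add: koszul_sign_insert s_def)
        ultimately show ?thesis
          using True False s a by (simp add: t_def card M.smult_l_minus M.l_neg)
      next
        case False
        then show ?thesis
          using \<open>m \<noteq> i\<close> lin_zero[OF D(1) D(1) em] by (simp add: u_def t_def card)
      qed
    qed
    let ?T = "finsum (deg X k) (\<lambda>i. f i \<odot>\<^bsub>deg X k\<^esub> t (insert m I) i) {1..n}"
    let ?U = "finsum (deg X k) (\<lambda>i. f i \<odot>\<^bsub>deg X k\<^esub> u i) {1..n}"
    have "?T \<oplus>\<^bsub>deg X k\<^esub> ?U =
        finsum (deg X k) (\<lambda>i. f i \<odot>\<^bsub>deg X k\<^esub> t (insert m I) i \<oplus>\<^bsub>deg X k\<^esub> f i \<odot>\<^bsub>deg X k\<^esub> u i) {1..n}"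
      using fc tmI u by (intro M.finsum_addf[symmetric]) auto
    also have "\<dots> = finsum (deg X k) (\<lambda>i. if m = i then f i \<odot>\<^bsub>deg X k\<^esub> y else \<zero>\<^bsub>deg X k\<^esub>) {1..n}"
    proof (intro M.finsum_cong')
      fix i assume i: "i \<in> {1..n}"
      have "f i \<odot>\<^bsub>deg X k\<^esub> (t (insert m I) i \<oplus>\<^bsub>deg X k\<^esub> u i) = (if m = i then f i \<odot>\<^bsub>deg X k\<^esub> y else \<zero>\<^bsub>deg X k\<^esub>)"
        using tu fc[OF i] by simp
      then show "f i \<odot>\<^bsub>deg X k\<^esub> t (insert m I) i \<oplus>\<^bsub>deg X k\<^esub> f i \<odot>\<^bsub>deg X k\<^esub> u i =
          (if m = i then f i \<odot>\<^bsub>deg X k\<^esub> y else \<zero>\<^bsub>deg X k\<^esub>)"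
        using fc[OF i] tmI u by (simp add: M.smult_r_distr)
    qed (use fc y in auto)
    also have "\<dots> = f m \<odot>\<^bsub>deg X k\<^esub> y"
      using fc y m by (intro M.finsum_singleton) auto
    finally have TU: "?T \<oplus>\<^bsub>deg X k\<^esub> ?U = f m \<odot>\<^bsub>deg X k\<^esub> y" .
    \<comment> \<open>The claimed formula is compared with the relation for \<open>f m\<close> after
      adding \<open>?U\<close> to both sides, and \<open>?U\<close> is then cancelled.\<close>
    have eq: "dif X (k - 1) (eps X m k y) \<oplus>\<^bsub>deg X k\<^esub> ?U = ?T \<oplus>\<^bsub>deg X k\<^esub> ?U"
      using D(6)[OF m y] by (simp only: edy TU)
    have "dif X (k - 1) (eps X m k y) \<in> carrier (deg X k)"
      using lin_closed[OF D(2) lin_closed[OF D(4)[OF m] y]] by simp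
    moreover have "?T \<in> carrier (deg X k)" and "?U \<in> carrier (deg X k)"
      using fc tmI u by (auto intro!: M.finsum_closed)
    ultimately have "dif X (k - 1) (eps X m k y) = ?T"
      using eq M.add.right_cancel by blast
    then show ?case unfolding act card .
  qed
  then show ?thesis unfolding t_def .
qed

section \<open>The map from the Koszul algebra determined by a cycle of degree 0\<close>

lemma lin_maps_coeff_eqI:
  fixes N :: "'a bmod"
  assumes "finite D" "module R N" "g \<in> lin_maps R (coeff_module R D) N"
    "h \<in> lin_maps R (coeff_module R D) N" "\<And>c. c \<in> D \<Longrightarrow> g (unit_coeff c) = h (unit_coeff c)"
    "v \<in> carrier (coeff_module R D)"
  shows "g v = h v"
proof -
  interpret N: module R N by fact
  have v: "v c \<in> carrier R" for c using assms(6) by (simp add: coeff_carrier_iff)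
  have "g v = lin_comb D N (\<lambda>c. g (unit_coeff c)) v"
    by (rule lin_maps_coeff_eq[OF assms(1,2,3,6)])
  also have "\<dots> = lin_comb D N (\<lambda>c. h (unit_coeff c)) v"
    unfolding lin_comb_def
    using v assms(5) lin_closed[OF assms(4) unit_coeff_closed]
    by (intro N.finsum_cong') auto
  also have "\<dots> = h v"
    by (rule lin_maps_coeff_eq[OF assms(1,2,4,6), symmetric])
  finally show ?thesis .
qed

lemma koszul_ins_unit_coeff:
  "koszul_ins i (unit_coeff c) = (if i \<in> set_decode c then (\<lambda>c. \<zero>)
    else (\<lambda>c'. koszul_sign R i (set_decode c) \<one> \<otimes> unit_coeff (set_encode (insert i (set_decode c))) c'))"
proof
  fix c'
  have 1: "set_encode (set_decode c' - {i}) = c \<longleftrightarrow> set_decode c' - {i} = set_decode c"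
    by (metis finite_Diff finite_set_decode set_decode_inverse set_encode_inverse)
  have 2: "c' = set_encode (insert i (set_decode c)) \<longleftrightarrow> set_decode c' = insert i (set_decode c)"
    by (metis finite_insert finite_set_decode set_decode_inverse set_encode_inverse)
  show "koszul_ins i (unit_coeff c) c' = (if i \<in> set_decode c then (\<lambda>c. \<zero>)
    else (\<lambda>c'. koszul_sign R i (set_decode c) \<one> \<otimes> unit_coeff (set_encode (insert i (set_decode c))) c')) c'"
  proof (cases "i \<notin> set_decode c \<and> set_decode c' = insert i (set_decode c)")
    case True
    then show ?thesis
      using 1 2 by (simp add: koszul_ins_def unit_coeff_def koszul_sign_insert_self koszul_sign_closed)
  next
    case False
    then have "\<not> (i \<in> set_decode c' \<and> set_decode c' - {i} = set_decode c)" by auto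
    then show ?thesis
      using 1 2 False by (auto simp: koszul_ins_def unit_coeff_def koszul_sign_zero koszul_sign_closed)
  qed
qed

lemma koszul_del_unit_coeff:
  "koszul_del i (unit_coeff c) = (if i \<in> set_decode c
    then (\<lambda>c'. koszul_sign R i (set_decode c) \<one> \<otimes> unit_coeff (set_encode (set_decode c - {i})) c')
    else (\<lambda>c. \<zero>))"
proof
  fix c'
  have 1: "set_encode (insert i (set_decode c')) = c \<longleftrightarrow> insert i (set_decode c') = set_decode c"
    by (metis finite_insert finite_set_decode set_decode_inverse set_encode_inverse)
  have 2: "c' = set_encode (set_decode c - {i}) \<longleftrightarrow> set_decode c' = set_decode c - {i}"
    by (metis finite_Diff finite_set_decode set_decode_inverse set_encode_inverse)
  show "koszul_del i (unit_coeff c) c' = (if i \<in> set_decode c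
    then (\<lambda>c'. koszul_sign R i (set_decode c) \<one> \<otimes> unit_coeff (set_encode (set_decode c - {i})) c')
    else (\<lambda>c. \<zero>)) c'"
  proof (cases "i \<in> set_decode c \<and> set_decode c' = set_decode c - {i}")
    case True
    then show ?thesis
      using 1 2 by (auto simp: koszul_del_def unit_coeff_def koszul_sign_remove_self koszul_sign_closed)
  next
    case False
    then have "\<not> (i \<notin> set_decode c' \<and> insert i (set_decode c') = set_decode c)" by auto
    then show ?thesis
      using 1 2 False by (auto simp: koszul_del_def unit_coeff_def koszul_sign_zero koszul_sign_closed)
  qed
qed

text \<open>The map of dg modules with \<open>1\<close> going to \<open>x\<close>: the monomial
  \<open>\<epsilon>\<^sub>I\<close> is sent to \<open>\<epsilon>\<^sub>I x\<close>.\<close>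

definition koszul_map :: "nat \<Rightarrow> 'a kdg \<Rightarrow> (nat \<Rightarrow> 'a) \<Rightarrow> int \<Rightarrow> (nat \<Rightarrow> 'a) \<Rightarrow> (nat \<Rightarrow> 'a)" where
  "koszul_map n X x k = lin_comb (koszul_codes n k) (deg X k) (\<lambda>c. eps_act X x (set_decode c))"

text \<open>Both compatibilities are equalities of linear maps on a free module, hence checked on
  monomials. There they are the multiplication rules for \<open>eps_act\<close> and the Leibniz
  rule.\<close>

lemma koszul_map_closed:
  assumes X: "koszul_dg_module R n f X" and x: "x \<in> carrier (deg X 0)"
    and f: "f \<in> {1..n} \<rightarrow> carrier R" and dx: "dif X 0 x = \<zero>\<^bsub>deg X 1\<^esub>"
  shows "koszul_map n X x \<in> closed_maps R n (koszul_algebra R n f) X"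
proof -
  let ?K = "koszul_algebra R n f" and ?C = "\<lambda>k. coeff_module R (koszul_codes n k)"
  let ?\<psi> = "koszul_map n X x"
  note D = koszul_dg_moduleD[OF X]
  note fc = funcset_mem[OF f]
  have K: "koszul_dg_module R n f ?K" by (rule koszul_dg_module_koszul_algebra[OF f])
  have act: "eps_act X x (set_decode c) \<in> carrier (deg X k)" if "c \<in> koszul_codes n k" for c k
    using that eps_act_closed[OF X x, of "set_decode c"] by (simp add: koszul_codes_def)
  have lin: "?\<psi> k \<in> lin_maps R (?C k) (deg X k)" for k
    unfolding koszul_map_def by (rule lin_comb_lin[OF D(1) finite_koszul_codes act])
  have unit: "?\<psi> k (unit_coeff c) = eps_act X x (set_decode c)" if "c \<in> koszul_codes n k" for c k
    unfolding koszul_map_def using lin_comb_unit_coeff[OF D(1) finite_koszul_codes _ that] act by simp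
  have unit_smult: "?\<psi> k (\<lambda>c'. b \<otimes> unit_coeff c c') = b \<odot>\<^bsub>deg X k\<^esub> eps_act X x (set_decode c)"
    if "c \<in> koszul_codes n k" "b \<in> carrier R" for b c k
    using lin_smult[OF lin that(2) unit_coeff_closed[OF that(1)]] unit[OF that(1)]
    by (simp add: coeff_simps)
  have zero: "?\<psi> k (\<lambda>c. \<zero>) = \<zero>\<^bsub>deg X k\<^esub>" for k
    using lin_zero[OF module_coeff D(1) lin] by (simp add: coeff_simps)
  show ?thesis
  proof (rule closed_mapsI[OF K X])
    show "?\<psi> k \<in> lin_maps R (deg ?K k) (deg X k)" for k
      unfolding deg_koszul_algebra by (rule lin)
    fix k v assume "v \<in> carrier (deg ?K k)"
    then have v: "v \<in> carrier (?C k)" by (simp only: deg_koszul_algebra)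
    show "?\<psi> (k - 1) (eps ?K i k v) = eps X i k (?\<psi> k v)" if i: "i \<in> {1..n}" for i
      unfolding eps_koszul_algebra
    proof (rule lin_maps_coeff_eqI[OF finite_koszul_codes D(1) lin_comp[OF koszul_ins_lin[OF i] lin]
          lin_comp[OF lin D(4)[OF i]] _ v])
      fix c assume c: "c \<in> koszul_codes n k"
      then have I: "set_decode c \<subseteq> {1..n}" and k: "- int (card (set_decode c)) = k"
        by (auto simp: koszul_codes_def)
      show "?\<psi> (k - 1) (koszul_ins i (unit_coeff c)) = eps X i k (?\<psi> k (unit_coeff c))"
      proof (cases "i \<in> set_decode c")
        case True
        then show ?thesis
          using eps_eps_act_mem[OF X x I True] zero
          by (simp add: koszul_ins_unit_coeff unit[OF c] k)
      next
        case False
        then have "set_encode (insert i (set_decode c)) \<in> koszul_codes n (k - 1)"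
          using I k i by (simp add: koszul_codes_def)
        then show ?thesis
          using False eps_eps_act[OF X x I i False] unit_smult
          by (simp add: koszul_ins_unit_coeff unit[OF c] k koszul_sign_closed)
      qed
    qed
    show "dif X k (?\<psi> k v) = ?\<psi> (k + 1) (dif ?K k v)"
    proof (rule lin_maps_coeff_eqI[OF finite_koszul_codes D(1) lin_comp[OF lin D(2)]
          lin_comp[OF dif_koszul_algebra_lin[OF f] lin] _ v])
      fix c assume c: "c \<in> koszul_codes n k"
      then have I: "set_decode c \<subseteq> {1..n}" and k: "- int (card (set_decode c)) = k"
        by (auto simp: koszul_codes_def)
      then have k': "1 - int (card (set_decode c)) = k + 1" by simp
      interpret N: module R "deg X (k + 1)" by (rule D)
      interpret C: module R "?C (k + 1)" by (rule module_coeff)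
      note uc = unit_coeff_closed[OF c]
      have del: "koszul_del i (unit_coeff c) \<in> carrier (?C (k + 1))" if "i \<in> {1..n}" for i
        by (rule lin_closed[OF koszul_del_lin[OF that] uc])
      have \<psi>del: "?\<psi> (k + 1) (koszul_del i (unit_coeff c)) =
        (if i \<in> set_decode c then koszul_sign R i (set_decode c) \<one> \<odot>\<^bsub>deg X (k + 1)\<^esub> eps_act X x (set_decode c - {i})
         else \<zero>\<^bsub>deg X (k + 1)\<^esub>)" for i
      proof (cases "i \<in> set_decode c")
        case True
        then have "card (set_decode c) = Suc (card (set_decode c - {i}))"
          using card.remove[of "set_decode c" i] by simp
        then have "int (card (set_decode c - {i})) = - (k + 1)" using k by linarith
        moreover have "set_decode c - {i} \<subseteq> {1..n}" using I by blast
        ultimately have "set_encode (set_decode c - {i}) \<in> koszul_codes n (k + 1)"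
          unfolding koszul_codes_def mem_Collect_eq by (simp only: set_encode_inverse finite_Diff finite_set_decode)
        then show ?thesis
          using True unit_smult by (simp add: koszul_del_unit_coeff koszul_sign_closed)
      qed (simp add: koszul_del_unit_coeff zero)
      have "?\<psi> (k + 1) (dif ?K k (unit_coeff c)) =
          finsum (deg X (k + 1)) (\<lambda>i. ?\<psi> (k + 1) (f i \<odot>\<^bsub>?C (k + 1)\<^esub> koszul_del i (unit_coeff c))) {1..n}"
        unfolding dif_koszul_algebra[OF f uc] using fc del
        by (intro lin_finsum[OF module_coeff D(1) lin]) auto
      also have "\<dots> = finsum (deg X (k + 1))
          (\<lambda>i. f i \<odot>\<^bsub>deg X (k + 1)\<^esub> ?\<psi> (k + 1) (koszul_del i (unit_coeff c))) {1..n}"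
        using fc del lin_smult[OF lin fc del] lin_closed[OF lin del]
        by (intro N.finsum_cong') auto
      also have "\<dots> = dif X k (eps_act X x (set_decode c))"
        using dif_eps_act[OF X x I f dx] unfolding \<psi>del k k' by simp
      finally show "dif X k (?\<psi> k (unit_coeff c)) = ?\<psi> (k + 1) (dif ?K k (unit_coeff c))"
        by (simp only: unit[OF c])
    qed
  qed
qed

lemma koszul_map_one:
  assumes "koszul_dg_module R n f X" "x \<in> carrier (deg X 0)"
  shows "\<exists>v\<in>carrier (deg (koszul_algebra R n f) 0). koszul_map n X x 0 v = x"
proof -
  \<comment> \<open>The number 0 codes the empty set, so \<open>unit_coeff 0\<close> is the unit of
    the Koszul algebra.\<close>
  have c: "0 \<in> koszul_codes n 0" by (simp add: koszul_codes_def)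
  have "eps_act X x (set_decode c) \<in> carrier (deg X 0)" if "c \<in> koszul_codes n 0" for c
    using that eps_act_closed[OF assms, of "set_decode c"] by (simp add: koszul_codes_def)
  then have "koszul_map n X x 0 (unit_coeff 0) = x"
    unfolding koszul_map_def
    using lin_comb_unit_coeff[OF koszul_dg_moduleD(1)[OF assms(1)] finite_koszul_codes _ c]
    by (simp add: eps_act_empty)
  then show ?thesis
    using unit_coeff_closed[OF c] by (intro bexI) (auto simp: deg_koszul_algebra)
qed

end

section \<open>Shortening a dg module in the Verdier quotient\<close>

text \<open>Only the carriers shrink while the operators stay, so the inclusion is the identity on
  elements.\<close>

definition sub_dg :: "'b kdg \<Rightarrow> (int \<Rightarrow> (nat \<Rightarrow> 'b) set) \<Rightarrow> 'b kdg" where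
  "sub_dg E Z = \<lparr>deg = \<lambda>k. (deg E k)\<lparr>carrier := Z k\<rparr>, dif = dif E, eps = eps E\<rparr>"

text \<open>The family of maps inverted in \<open>verdier_quotient_s\<close>, given a name.\<close>

definition verdier_maps ::
  "('b, 'x) ring_scheme \<Rightarrow> nat \<Rightarrow> (nat \<Rightarrow> 'b) \<Rightarrow> 'b kdg \<Rightarrow> 'b kdg
     \<Rightarrow> (int \<Rightarrow> (nat \<Rightarrow> 'b) \<Rightarrow> (nat \<Rightarrow> 'b)) set set" where
  "verdier_maps R n f = (\<lambda>E F. {\<alpha> \<in> closed_maps R n E F // homotopic R n E F.
     \<exists>s\<in>\<alpha>. cone_dg E F s \<in> perf_s R n f})"

text \<open>Generation of the cokernel of the last differential without forming a quotient module.
  For empty \<open>S\<close> it expresses surjectivity of that differential.\<close>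

definition generates_coker ::
  "('b, 'x) ring_scheme \<Rightarrow> 'b kdg \<Rightarrow> int \<Rightarrow> (nat \<Rightarrow> 'b) set \<Rightarrow> bool" where
  "generates_coker R X b S \<longleftrightarrow> finite S \<and> S \<subseteq> carrier (deg X b) \<and>
     (\<forall>H. submodule H R (deg X b) \<and> dif X (b - 1) ` carrier (deg X (b - 1)) \<subseteq> H \<and> S \<subseteq> H \<longrightarrow>
        H = carrier (deg X b))"

context cring
begin

section \<open>Cones, shifts and the Koszul algebra as strictly perfect modules\<close>

lemma concentrated_in_cone:
  assumes "concentrated_in E S" "concentrated_in F T" "\<And>k. k \<notin> U \<Longrightarrow> k + 1 \<notin> S \<and> k \<notin> T"
  shows "concentrated_in (cone_dg E F s) U"
  unfolding concentrated_in_def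
proof (intro allI impI)
  fix k assume "k \<notin> U"
  then have "carrier (deg E (k + 1)) = {\<zero>\<^bsub>deg E (k + 1)\<^esub>}" "carrier (deg F k) = {\<zero>\<^bsub>deg F k\<^esub>}"
    using assms unfolding concentrated_in_def by blast+
  then show "carrier (deg (cone_dg E F s) k) = {\<zero>\<^bsub>deg (cone_dg E F s) k\<^esub>}"
    unfolding cone_simps dsum_simps
    by (auto simp: dsum_carrier_iff seq_eq_iff[of _ "interleave _ _"])
qed

lemma strictly_perfect_cone:
  assumes "strictly_perfect R E" "strictly_perfect R F"
  shows "strictly_perfect R (cone_dg E F s)"
proof -
  obtain a b c d where "concentrated_in E {a..b}" "concentrated_in F {c..d}"
    using assms unfolding strictly_perfect_def by blast
  then have "concentrated_in (cone_dg E F s) {min (a - 1) c..max (b - 1) d}"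
    by (rule concentrated_in_cone) auto
  then show ?thesis
    using assms fin_gen_module_dsum projective_module_dsum
    unfolding strictly_perfect_def cone_simps by blast
qed

lemma cone_in_coh_s:
  assumes "E \<in> coh_s R n f" "F \<in> coh_s R n f" "s \<in> closed_maps R n E F"
  shows "cone_dg E F s \<in> coh_s R n f"
  using assms koszul_dg_module_cone strictly_perfect_cone unfolding coh_s_def by blast

lemma concentrated_in_shift:
  assumes "concentrated_in E {a..b}"
  shows "concentrated_in (shift_dg m E) {a - m..b - m}"
  using assms unfolding concentrated_in_def by (auto simp: shift_dg_def)

lemma shift_in_coh_s:
  assumes "E \<in> coh_s R n f"
  shows "shift_dg m E \<in> coh_s R n f"
proof -
  obtain a b where "concentrated_in E {a..b}"
    using assms unfolding coh_s_def strictly_perfect_def by blast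
  then have "concentrated_in (shift_dg m E) {a - m..b - m}" by (rule concentrated_in_shift)
  moreover have "deg (shift_dg m E) k = deg E (k + m)" for k by (simp add: shift_dg_def)
  ultimately show ?thesis
    using assms koszul_dg_module_shift[of n f E m] unfolding coh_s_def strictly_perfect_def by auto
qed

lemma concentrated_in_koszul_algebra:
  "concentrated_in (koszul_algebra R n f) {- int n..0}"
  unfolding concentrated_in_def
proof (intro allI impI)
  fix k assume k: "k \<notin> {- int n..0}"
  have "koszul_codes n k = {}"
  proof (rule equals0I)
    fix c assume "c \<in> koszul_codes n k"
    then have "set_decode c \<subseteq> {1..n}" "int (card (set_decode c)) = - k"
      by (simp_all add: koszul_codes_def)
    then show False using k card_mono[of "{1..n}" "set_decode c"] by simp
  qed
  then show "carrier (deg (koszul_algebra R n f) k) = {\<zero>\<^bsub>deg (koszul_algebra R n f) k\<^esub>}"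
    unfolding deg_koszul_algebra
    by (auto simp: coeff_carrier_iff coeff_simps)
qed

lemma koszul_algebra_in_coh_s:
  assumes "f \<in> {1..n} \<rightarrow> carrier R"
  shows "koszul_algebra R n f \<in> coh_s R n f"
  using koszul_dg_module_koszul_algebra[OF assms] concentrated_in_koszul_algebra
    fin_gen_module_coeff[OF finite_koszul_codes] projective_module_coeff[OF finite_koszul_codes]
  unfolding coh_s_def strictly_perfect_def mem_Collect_eq deg_koszul_algebra by blast

text \<open>A map with perfect cone is inverted in the quotient, so each end is a retract of the
  other. That the cone is strictly perfect, as \<open>perf_s\<close> also demands, follows from the
  two ends.\<close>

lemma zigzag_retract_verdier:
  assumes "E \<in> coh_s R n f" "F \<in> coh_s R n f" "s \<in> closed_maps R n E F"
    and "perfect_dg R n f (cone_dg E F s)"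
  shows "zigzag_retract (homotopy_cat R n (coh_s R n f)) (verdier_maps R n f) E F"
    and "zigzag_retract (homotopy_cat R n (coh_s R n f)) (verdier_maps R n f) F E"
proof -
  have EF: "koszul_dg_module R n f E" "koszul_dg_module R n f F"
    using assms(1,2) by (simp_all add: coh_s_def)
  note cls = homotopy_class_rules[OF EF assms(3)]
  have "cone_dg E F s \<in> perf_s R n f"
    using cone_in_coh_s[OF assms(1-3)] assms(4) by (simp add: perf_s_def)
  then have "homotopic R n E F `` {s} \<in> verdier_maps R n f E F"
    using cls unfolding verdier_maps_def by blast
  then show "zigzag_retract (homotopy_cat R n (coh_s R n f)) (verdier_maps R n f) E F"
    and "zigzag_retract (homotopy_cat R n (coh_s R n f)) (verdier_maps R n f) F E"
    using assms(1,2) cls(1)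
    by (auto simp: homotopy_cat_def
        intro: zigzag_retract_forward[where w = "homotopic R n E F `` {s}"]
          zigzag_retract_backward[where w = "homotopic R n E F `` {s}"])
qed


subsection \<open>Killing the cokernel of the last differential\<close>

text \<open>A generator \<open>x\<close> in the top degree \<open>b\<close> is killed by the cone of the map
  \<open>K[-b] \<rightarrow> X\<close>, \<open>1 \<mapsto> x\<close>. As \<open>K[-b]\<close> lives in degrees \<open>b - n..b\<close>, this cone does not leave the degrees
  \<open>a..b\<close> as long as \<open>b - a > n\<close>.\<close>

lemma attach_generator:
  assumes f: "f \<in> {1..n} \<rightarrow> carrier R" and X: "X \<in> coh_s R n f"
    and conc: "concentrated_in X {a..b}" and ab: "b - a > int n"
    and gen: "generates_coker R X b (insert x S)"
  obtains C where "C \<in> coh_s R n f" "concentrated_in C {a..b}"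
    "generates_coker R C b (interleave \<zero>\<^bsub>deg (koszul_algebra R n f) 1\<^esub> ` S)"
    "zigzag_retract (homotopy_cat R n (coh_s R n f)) (verdier_maps R n f) X C"
proof -
  let ?K = "koszul_algebra R n f"
  define L where "L = shift_dg (- b) ?K"
  \<comment> \<open>In \<open>shift_dg b X\<close> the element \<open>x\<close> has degree 0, where
    \<open>koszul_map\<close> applies; reindexing gives a map from \<open>L\<close> to
    \<open>X\<close>.\<close>
  define \<phi> where "\<phi> = (\<lambda>j. koszul_map n (shift_dg b X) x (j - b))"
  define C where "C = cone_dg L X \<phi>"
  have Kcoh: "?K \<in> coh_s R n f" by (rule koszul_algebra_in_coh_s[OF f])
  then have Lcoh: "L \<in> coh_s R n f" unfolding L_def by (rule shift_in_coh_s)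
  have K: "koszul_dg_module R n f ?K" and L: "koszul_dg_module R n f L"
    and X': "koszul_dg_module R n f X"
    using Kcoh Lcoh X by (simp_all add: coh_s_def)
  have bX: "koszul_dg_module R n f (shift_dg b X)" by (rule koszul_dg_module_shift[OF X'])
  note DL = koszul_dg_moduleD[OF L] and DX = koszul_dg_moduleD[OF X']
  have Ldeg: "deg L k = deg ?K (k - b)" for k by (simp add: L_def shift_dg_def)
  have "concentrated_in L {- int n - (- b)..0 - (- b)}"
    unfolding L_def by (rule concentrated_in_shift[OF concentrated_in_koszul_algebra])
  then have Lconc: "concentrated_in L {b - int n..b}" by (simp add: algebra_simps)
  have x: "x \<in> carrier (deg X b)" using gen by (simp add: generates_coker_def)
  have Xtop: "carrier (deg X (b + 1)) = {\<zero>\<^bsub>deg X (b + 1)\<^esub>}"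
    using conc by (simp add: concentrated_in_def)
  have bx: "x \<in> carrier (deg (shift_dg b X) 0)" using x by (simp add: shift_dg_def)
  have "dif X b x = \<zero>\<^bsub>deg X (b + 1)\<^esub>" using lin_closed[OF DX(2) x] Xtop by simp
  then have bdx: "dif (shift_dg b X) 0 x = \<zero>\<^bsub>deg (shift_dg b X) 1\<^esub>"
    using mod_sign_zero[OF DX(1)] by (simp add: shift_dg_def add.commute)
  have \<phi>: "\<phi> \<in> closed_maps R n L X"
    unfolding \<phi>_def L_def
    by (rule closed_maps_unshift[OF K X' koszul_map_closed[OF bX bx f bdx]])
  note D\<phi> = closed_mapsD[OF L X' \<phi>]
  obtain v where v: "v \<in> carrier (deg L b)" "\<phi> b v = x"
    using koszul_map_one[OF bX bx] by (auto simp: Ldeg \<phi>_def)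
  have Ccoh: "C \<in> coh_s R n f" unfolding C_def by (rule cone_in_coh_s[OF Lcoh X \<phi>])
  have Cconc: "concentrated_in C {a..b}"
    \<comment> \<open>\<open>L\<close> contributes in degrees \<open>b - n - 1\<close> to
      \<open>b - 1\<close>, and \<open>a \<le> b - n - 1\<close> is the hypothesis
      \<open>ab\<close>.\<close>
    unfolding C_def by (rule concentrated_in_cone[OF Lconc conc]) (use ab in auto)
  have "perfect_dg R n f L" unfolding L_def by (intro perfect_dg.shift perfect_dg.koszul)
  then have "perfect_dg R n f (cone_dg X C (cone_inr L))"
    unfolding C_def by (rule perfect_dg_cone_cone_inr[OF L X' \<phi>])
  then have zz: "zigzag_retract (homotopy_cat R n (coh_s R n f)) (verdier_maps R n f) X C"
    using zigzag_retract_verdier(1)[OF X Ccoh] closed_maps_cone_inr[OF L X' \<phi>] by (simp add: C_def)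
  \<comment> \<open>Degree \<open>b + 1\<close> of \<open>L\<close> is degree 1 of the Koszul
    algebra, hence trivial: elements of \<open>C\<close> in degree \<open>b\<close> are elements of
    \<open>X\<close> preceded by \<open>?z\<close>.\<close>
  let ?z = "\<zero>\<^bsub>deg L (b + 1)\<^esub>"
  have Ltop: "carrier (deg L (b + 1)) = {?z}" using Lconc by (simp add: concentrated_in_def)
  have idx: "b - 1 + 1 = b" "b - 1 + 2 = b + 1" by simp_all
  have Cb: "deg C b = dsum (deg L (b + 1)) (deg X b)" "deg C (b - 1) = dsum (deg L b) (deg X (b - 1))"
    by (simp_all add: C_def cone_simps)
  have Cdif: "dif C (b - 1) (interleave u y) = interleave ?z (\<phi> b u \<oplus>\<^bsub>deg X b\<^esub> dif X (b - 1) y)"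
    if "u \<in> carrier (deg L b)" for u y
  proof -
    have "\<ominus>\<^bsub>deg L (b + 1)\<^esub> dif L b u \<in> carrier (deg L (b + 1))"
      using lin_closed[OF DL(2) that] by (simp add: module_group_rules[OF DL(1)])
    then show ?thesis using Ltop by (simp add: C_def cone_simps idx)
  qed
  have Sgen: "finite S" "S \<subseteq> carrier (deg X b)"
    and gen': "\<And>H. submodule H R (deg X b) \<Longrightarrow> dif X (b - 1) ` carrier (deg X (b - 1)) \<subseteq> H \<Longrightarrow>
      insert x S \<subseteq> H \<Longrightarrow> H = carrier (deg X b)"
    using gen unfolding generates_coker_def by auto
  have "H = carrier (deg C b)"
    if H: "submodule H R (deg C b)" "dif C (b - 1) ` carrier (deg C (b - 1)) \<subseteq> H"
      "interleave ?z ` S \<subseteq> H" for H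
  proof -
    \<comment> \<open>The submodule is moved back to \<open>X\<close>. It contains the old
      boundaries, by taking \<open>u\<close> zero, and \<open>x\<close> itself, by taking
      \<open>u = v\<close> and \<open>y\<close> zero; so \<open>x\<close> is no longer needed as a
      generator.\<close>
    let ?H = "{y \<in> carrier (deg X b). interleave ?z y \<in> H}"
    have dH: "interleave ?z (\<phi> b u \<oplus>\<^bsub>deg X b\<^esub> dif X (b - 1) y) \<in> H"
      if u: "u \<in> carrier (deg L b)" and y: "y \<in> carrier (deg X (b - 1))" for u y
    proof -
      have "interleave u y \<in> carrier (deg C (b - 1))" using u y by (simp add: Cb dsum_carrier_iff)
      then show ?thesis using H(2) Cdif[OF u, of y] by (metis imageI subsetD)
    qed
    have dX: "dif X (b - 1) y \<in> carrier (deg X b)" if "y \<in> carrier (deg X (b - 1))" for y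
      using lin_closed[OF DX(2) that] by (simp only: idx)
    have "?H = carrier (deg X b)"
    proof (rule gen')
      show "submodule ?H R (deg X b)"
        using H(1) unfolding Cb(1)
        by (rule submodule_vimage[OF DX(1) module_dsum[OF DL(1) DX(1)] lin_inr[OF DL(1)]])
      show "dif X (b - 1) ` carrier (deg X (b - 1)) \<subseteq> ?H"
      proof
        fix w assume "w \<in> dif X (b - 1) ` carrier (deg X (b - 1))"
        then obtain y where y: "y \<in> carrier (deg X (b - 1))" "w = dif X (b - 1) y" by blast
        then have "interleave ?z (\<phi> b \<zero>\<^bsub>deg L b\<^esub> \<oplus>\<^bsub>deg X b\<^esub> w) \<in> H"
          using dH module_group_rules(1)[OF DL(1)] by blast
        then show "w \<in> ?H"
          using dX[OF y(1)] y(2) lin_zero[OF DL(1) DX(1) D\<phi>(1)]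
          by (simp add: module_group_rules[OF DX(1)])
      qed
      have "interleave ?z (x \<oplus>\<^bsub>deg X b\<^esub> dif X (b - 1) \<zero>\<^bsub>deg X (b - 1)\<^esub>) \<in> H"
        using dH[OF v(1)] module_group_rules(1)[OF DX(1)] v(2) by blast
      then have "interleave ?z x \<in> H"
        using lin_zero[OF DX(1) DX(1) DX(2)[of "b - 1"]] x
        by (simp add: module_group_rules[OF DX(1)])
      then show "insert x S \<subseteq> ?H" using x Sgen H(3) by auto
    qed
    moreover have "w = interleave ?z (seq_snd w) \<and> seq_snd w \<in> carrier (deg X b)"
      if "w \<in> carrier (deg C b)" for w
      using that Ltop by (auto simp: Cb dsum_carrier_iff seq_eq_iff[of w])
    ultimately have "carrier (deg C b) \<subseteq> H" by (metis (lifting) mem_Collect_eq subsetI)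
    moreover have "H \<subseteq> carrier (deg C b)"
      using Ccoh module.submoduleE(1)[OF koszul_dg_moduleD(1) H(1)] unfolding coh_s_def by blast
    ultimately show ?thesis by blast
  qed
  then have "generates_coker R C b (interleave ?z ` S)"
    unfolding generates_coker_def
    using Sgen Ltop by (auto simp: Cb dsum_carrier_iff)
  then show ?thesis
    using that Ccoh Cconc zz by (simp add: Ldeg)
qed

text \<open>Each attached cell removes one generator but replaces the module and transports the
  remaining generators, so the induction on \<open>card S\<close> keeps both \<open>X\<close> and
  \<open>S\<close> general.\<close>

lemma surjective_top_differential:
  assumes f: "f \<in> {1..n} \<rightarrow> carrier R" and ab: "b - a > int n"
    and "X \<in> coh_s R n f" "concentrated_in X {a..b}" "generates_coker R X b S"
  shows "\<exists>C\<in>coh_s R n f. concentrated_in C {a..b} \<and>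
    dif C (b - 1) ` carrier (deg C (b - 1)) = carrier (deg C b) \<and>
    zigzag_retract (homotopy_cat R n (coh_s R n f)) (verdier_maps R n f) X C"
  using assms(3-5)
proof (induction "card S" arbitrary: X S rule: less_induct)
  case less
  have fin: "finite S" using less.prems by (simp add: generates_coker_def)
  show ?case
  proof (cases "S = {}")
    case True
    have X: "koszul_dg_module R n f X" using less.prems by (simp add: coh_s_def)
    have "dif X (b - 1) \<in> lin_maps R (deg X (b - 1)) (deg X b)"
      using koszul_dg_moduleD(2)[OF X, of "b - 1"] by simp
    then have "submodule (dif X (b - 1) ` carrier (deg X (b - 1))) R (deg X b)"
      by (intro submodule_image koszul_dg_moduleD(1)[OF X])
    then have "dif X (b - 1) ` carrier (deg X (b - 1)) = carrier (deg X b)"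
      using less.prems(3) True by (simp add: generates_coker_def)
    moreover have "zigzag_retract (homotopy_cat R n (coh_s R n f)) (verdier_maps R n f) X X"
      using less.prems(1) by (intro zigzag_retract_refl) (simp add: homotopy_cat_def)
    ultimately show ?thesis using less.prems by blast
  next
    case False
    then obtain x where x: "x \<in> S" by blast
    have gen: "generates_coker R X b (insert x (S - {x}))"
      using less.prems(3) x by (simp add: insert_absorb)
    obtain C where C: "C \<in> coh_s R n f" "concentrated_in C {a..b}"
      "generates_coker R C b (interleave \<zero>\<^bsub>deg (koszul_algebra R n f) 1\<^esub> ` (S - {x}))"
      "zigzag_retract (homotopy_cat R n (coh_s R n f)) (verdier_maps R n f) X C"
      using attach_generator[OF f less.prems(1,2) ab gen] by blast
    have "card (interleave \<zero>\<^bsub>deg (koszul_algebra R n f) 1\<^esub> ` (S - {x})) \<le> card (S - {x})"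
      using fin by (intro card_image_le) simp
    also have "\<dots> < card S" using fin x by (rule card_Diff1_less)
    finally obtain C' where "C' \<in> coh_s R n f" "concentrated_in C' {a..b}"
      "dif C' (b - 1) ` carrier (deg C' (b - 1)) = carrier (deg C' b)"
      "zigzag_retract (homotopy_cat R n (coh_s R n f)) (verdier_maps R n f) C C'"
      using less.hyps[OF _ C(1-3)] by blast
    then show ?thesis
      using zigzag_retract_trans[OF C(4)] by blast
  qed
qed


subsection \<open>Truncation\<close>

lemma sub_dg_simps:
  "deg (sub_dg E Z) k = (deg E k)\<lparr>carrier := Z k\<rparr>" "dif (sub_dg E Z) = dif E" "eps (sub_dg E Z) = eps E"
  by (simp_all add: sub_dg_def)

lemma koszul_dg_module_sub:
  assumes "koszul_dg_module R n f E" "\<And>k. submodule (Z k) R (deg E k)"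
    and "\<And>k x. x \<in> Z k \<Longrightarrow> dif E k x \<in> Z (k + 1)"
    and "\<And>i k x. i \<in> {1..n} \<Longrightarrow> x \<in> Z k \<Longrightarrow> eps E i k x \<in> Z (k - 1)"
  shows "koszul_dg_module R n f (sub_dg E Z)"
proof -
  note E = koszul_dg_moduleD[OF assms(1)]
  have Z: "x \<in> carrier (deg E k)" if "x \<in> Z k" for x k
    using module.submoduleE(1)[OF E(1) assms(2)] that by blast
  show ?thesis
  proof (rule koszul_dg_moduleI)
    show "module R (deg (sub_dg E Z) k)" for k
      unfolding sub_dg_simps by (rule submodule.submodule_is_module[OF assms(2) E(1)])
    show "dif (sub_dg E Z) k \<in> lin_maps R (deg (sub_dg E Z) k) (deg (sub_dg E Z) (k + 1))" for k
      unfolding sub_dg_simps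
      by (rule lin_mapsI) (auto simp: assms(3) Z lin_add[OF E(2)] lin_smult[OF E(2)])
    show "eps (sub_dg E Z) i k \<in> lin_maps R (deg (sub_dg E Z) k) (deg (sub_dg E Z) (k - 1))"
      if "i \<in> {1..n}" for i k
      unfolding sub_dg_simps
      by (rule lin_mapsI) (use that in \<open>auto simp: assms(4) Z lin_add[OF E(4)] lin_smult[OF E(4)]\<close>)
  qed (simp_all add: sub_dg_simps Z E(3,5,6,7))
qed

lemma closed_maps_sub:
  assumes "koszul_dg_module R n f E" "koszul_dg_module R n f (sub_dg E Z)"
    and "\<And>k. Z k \<subseteq> carrier (deg E k)"
  shows "(\<lambda>j x. x) \<in> closed_maps R n (sub_dg E Z) E"
  by (rule closed_mapsI[OF assms(2,1)])
     (use subsetD[OF assms(3)] in \<open>auto simp: sub_dg_simps intro!: lin_mapsI\<close>)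

text \<open>A section of \<open>p\<close> makes its kernel a direct summand of \<open>M\<close>.\<close>

lemma split_kernel:
  fixes M N :: "'a bmod"
  assumes "fin_gen_module R M" "projective_module R M" "projective_module R N"
    and p: "p \<in> lin_maps R M N" "p ` carrier M = carrier N"
    and sub: "submodule {x \<in> carrier M. p x = \<zero>\<^bsub>N\<^esub>} R M"
  defines "Z \<equiv> M\<lparr>carrier := {x \<in> carrier M. p x = \<zero>\<^bsub>N\<^esub>}\<rparr>"
  shows "fin_gen_module R Z" "projective_module R Z"
proof -
  have M: "module R M" and N: "module R N"
    using assms(2,3) by (simp_all add: projective_module_def)
  interpret M: module R M by (rule M)
  interpret N: module R N by (rule N)
  have Z: "module R Z" unfolding Z_def by (rule submodule.submodule_is_module[OF sub M])
  obtain \<sigma> where \<sigma>: "\<sigma> \<in> lin_maps R N M" "\<And>y. y \<in> carrier N \<Longrightarrow> p (\<sigma> y) = y"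
    using projective_moduleD[OF assms(3) M N p lin_id] by blast
  \<comment> \<open>The projection of \<open>M\<close> onto the kernel of \<open>p\<close> along the
    image of the section.\<close>
  let ?r = "\<lambda>x. x \<oplus>\<^bsub>M\<^esub> \<ominus>\<^bsub>M\<^esub> \<sigma> (p x)"
  have pc: "p x \<in> carrier N" if "x \<in> carrier M" for x by (rule lin_closed[OF p(1) that])
  have \<sigma>c: "\<sigma> (p x) \<in> carrier M" if "x \<in> carrier M" for x
    by (rule lin_closed[OF \<sigma>(1) pc[OF that]])
  have lin: "?r \<in> lin_maps R M M"
    by (intro lin_plus_map lin_neg_map lin_id M lin_comp[OF p(1) \<sigma>(1)])
  have pr: "p (?r x) = \<zero>\<^bsub>N\<^esub>" if x: "x \<in> carrier M" for x
    using lin_add[OF p(1) x M.a_inv_closed[OF \<sigma>c[OF x]]] lin_neg[OF M N p(1) \<sigma>c[OF x]]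
      \<sigma>(2)[OF pc[OF x]] pc[OF x] by (simp add: N.r_neg)
  have r: "?r \<in> lin_maps R M Z"
    unfolding Z_def
    by (rule lin_mapsI) (use pr lin_closed[OF lin] lin_add[OF lin] lin_smult[OF lin] in auto)
  have id: "?r x = x" if "x \<in> carrier Z" for x
    using that lin_zero[OF N M \<sigma>(1)] by (auto simp: Z_def)
  have i: "(\<lambda>x. x) \<in> lin_maps R Z M"
    by (rule lin_mapsI) (auto simp: Z_def)
  show "projective_module R Z"
    by (rule projective_module_retract[OF assms(2) Z i r id])
  have "carrier Z \<subseteq> ?r ` carrier M"
  proof
    fix x assume x: "x \<in> carrier Z"
    then have "x \<in> carrier M" by (simp add: Z_def)
    then have "?r x \<in> ?r ` carrier M" by (rule imageI)
    then show "x \<in> ?r ` carrier M" by (simp only: id[OF x])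
  qed
  moreover have "?r ` carrier M \<subseteq> carrier Z" using lin_closed[OF r] by blast
  ultimately show "fin_gen_module R Z"
    by (intro fin_gen_module_image[OF assms(1) Z r]) blast
qed

text \<open>Below degree \<open>b\<close> the cycles and boundaries are unchanged, and surjectivity
  kills the cohomology in degree \<open>b\<close>. The truncation is stable under the
  \<open>\<epsilon>\<^sub>i\<close>: from degree \<open>b - 1\<close> they land in degree
  \<open>b - 2\<close>, kept whole, and degree \<open>b\<close>, the only one mapping into the
  kernel term, has become zero.\<close>

lemma truncate_top:
  assumes f: "f \<in> {1..n} \<rightarrow> carrier R" and C: "C \<in> coh_s R n f" "concentrated_in C {a..b}"
    and surj: "dif C (b - 1) ` carrier (deg C (b - 1)) = carrier (deg C b)"
  shows "\<exists>E\<in>coh_s R n f. concentrated_in E {a..b - 1} \<and>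
    zigzag_retract (homotopy_cat R n (coh_s R n f)) (verdier_maps R n f) C E"
proof -
  have C': "koszul_dg_module R n f C" and fg: "\<And>k. fin_gen_module R (deg C k)"
    and proj: "\<And>k. projective_module R (deg C k)"
    using C(1) by (simp_all add: coh_s_def strictly_perfect_def)
  note D = koszul_dg_moduleD[OF C']
  define Z where "Z = (\<lambda>k. if k < b - 1 then carrier (deg C k)
    else if k = b - 1 then {x \<in> carrier (deg C k). dif C k x = \<zero>\<^bsub>deg C (k + 1)\<^esub>}
    else {\<zero>\<^bsub>deg C k\<^esub>})"
  define E where "E = sub_dg C Z"
  have zero: "\<zero>\<^bsub>deg C k\<^esub> \<in> carrier (deg C k)" for k by (rule module_group_rules(1)[OF D(1)])
  have d0: "dif C k \<zero>\<^bsub>deg C k\<^esub> = \<zero>\<^bsub>deg C (k + 1)\<^esub>" for k by (rule lin_zero[OF D(1) D(1) D(2)])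
  have Zsub: "Z k \<subseteq> carrier (deg C k)" for k using zero by (auto simp: Z_def)
  have Z0: "\<zero>\<^bsub>deg C k\<^esub> \<in> Z k" for k using zero d0 by (auto simp: Z_def)
  have Zmod: "submodule (Z k) R (deg C k)" for k
  proof (rule submoduleI'[OF D(1) Zsub Z0])
    show "x \<oplus>\<^bsub>deg C k\<^esub> y \<in> Z k" if "x \<in> Z k" "y \<in> Z k" for x y
      using that lin_add[OF D(2), of x k y]
      by (auto simp: Z_def module_group_rules[OF D(1)] split: if_splits)
    show "r \<odot>\<^bsub>deg C k\<^esub> x \<in> Z k" if "r \<in> carrier R" "x \<in> Z k" for r x
      using that lin_smult[OF D(2), of r x k] module.smult_closed[OF D(1)]
      by (auto simp: Z_def module_group_rules[OF D(1)] split: if_splits)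
  qed
  have Ekdg: "koszul_dg_module R n f E"
    unfolding E_def
  proof (rule koszul_dg_module_sub[OF C' Zmod])
    fix k x assume x: "x \<in> Z k"
    then have xC: "x \<in> carrier (deg C k)" using Zsub by blast
    show "dif C k x \<in> Z (k + 1)"
    proof (cases "k < b - 1")
      case True
      then show ?thesis
        using lin_closed[OF D(2) xC] D(3)[OF xC] by (auto simp: Z_def add.assoc)
    next
      case False
      then have "dif C k x = \<zero>\<^bsub>deg C (k + 1)\<^esub>" using x d0 by (auto simp: Z_def split: if_splits)
      then show ?thesis using Z0 by simp
    qed
    fix i assume i: "i \<in> {1..n}"
    show "eps C i k x \<in> Z (k - 1)"
    proof (cases "k < b")
      case True
      then show ?thesis using lin_closed[OF D(4)[OF i] xC] by (simp add: Z_def)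
    next
      case False
      then have "eps C i k x = \<zero>\<^bsub>deg C (k - 1)\<^esub>"
        using x lin_zero[OF D(1) D(1) D(4)[OF i]] by (simp add: Z_def)
      then show ?thesis using Z0 by simp
    qed
  qed
  have deg_E: "deg E k = (deg C k)\<lparr>carrier := Z k\<rparr>" for k by (simp add: E_def sub_dg_simps)
  have "dif C (b - 1) \<in> lin_maps R (deg C (b - 1)) (deg C b)" using D(2)[of "b - 1"] by simp
  moreover have "submodule {x \<in> carrier (deg C (b - 1)). dif C (b - 1) x = \<zero>\<^bsub>deg C b\<^esub>} R (deg C (b - 1))"
    using Zmod[of "b - 1"] by (simp add: Z_def)
  ultimately have "fin_gen_module R (deg E (b - 1)) \<and> projective_module R (deg E (b - 1))"
    using split_kernel[OF fg proj proj _ surj] by (simp add: deg_E Z_def)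
  moreover have "fin_gen_module R (deg E k) \<and> projective_module R (deg E k)" if "k < b - 1" for k
    using that fg proj by (simp add: deg_E Z_def)
  moreover have "fin_gen_module R (deg E k) \<and> projective_module R (deg E k)" if "k > b - 1" for k
    using that module_trivial[OF koszul_dg_moduleD(1)[OF Ekdg, of k]] by (simp add: deg_E Z_def)
  ultimately have fgproj: "fin_gen_module R (deg E k) \<and> projective_module R (deg E k)" for k
    by (metis linorder_neqE)
  have conc: "concentrated_in E {a..b - 1}"
    unfolding concentrated_in_def
  proof (intro allI impI)
    fix k assume k: "k \<notin> {a..b - 1}"
    have "Z k = {\<zero>\<^bsub>deg C k\<^esub>}"
    proof (cases "k > b - 1")
      case False
      then have "carrier (deg C k) = {\<zero>\<^bsub>deg C k\<^esub>}" using k C(2) by (simp add: concentrated_in_def)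
      then show ?thesis using Zsub[of k] Z0[of k] by auto
    qed (simp add: Z_def)
    then show "carrier (deg E k) = {\<zero>\<^bsub>deg E k\<^esub>}" by (simp add: deg_E)
  qed
  have Ecoh: "E \<in> coh_s R n f"
    using Ekdg conc fgproj unfolding coh_s_def strictly_perfect_def by blast
  have incl: "(\<lambda>j x. x) \<in> closed_maps R n E C"
    unfolding E_def by (rule closed_maps_sub[OF C' Ekdg[unfolded E_def] Zsub])
  have "quasi_iso E C (\<lambda>j x. x)"
    unfolding quasi_iso_def
  proof (intro allI conjI ballI impI)
    fix k x assume x: "x \<in> carrier (deg E k)"
      and a: "dif E k x = \<zero>\<^bsub>deg E (k + 1)\<^esub> \<and> (\<exists>y\<in>carrier (deg C (k - 1)). x = dif C (k - 1) y)"
    show "\<exists>z\<in>carrier (deg E (k - 1)). x = dif E (k - 1) z"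
    proof (cases "k < b")
      case True
      \<comment> \<open>Here \<open>k - 1 < b - 1\<close>, where nothing was removed, so the
        primitive in \<open>C\<close> already lies in \<open>E\<close>.\<close>
      then show ?thesis using a by (auto simp: deg_E E_def sub_dg_simps Z_def)
    next
      case False
      then have "x = dif E (k - 1) \<zero>\<^bsub>deg C (k - 1)\<^esub>"
        using x d0[of "k - 1"] by (simp add: deg_E E_def sub_dg_simps Z_def)
      moreover have "\<zero>\<^bsub>deg C (k - 1)\<^esub> \<in> carrier (deg E (k - 1))" using Z0 by (simp add: deg_E)
      ultimately show ?thesis by blast
    qed
  next
    fix k y assume y: "y \<in> carrier (deg C k)" and dy: "dif C k y = \<zero>\<^bsub>deg C (k + 1)\<^esub>"
    have cyc: "\<exists>x\<in>carrier (deg E k). dif E k x = \<zero>\<^bsub>deg E (k + 1)\<^esub> \<and>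
        (\<exists>z\<in>carrier (deg C (k - 1)). y = x \<oplus>\<^bsub>deg C k\<^esub> dif C (k - 1) z)"
      if "x \<in> Z k" "dif C k x = \<zero>\<^bsub>deg C (k + 1)\<^esub>" "z \<in> carrier (deg C (k - 1))"
        "y = x \<oplus>\<^bsub>deg C k\<^esub> dif C (k - 1) z" for x z
      using that by (intro bexI[of _ x] conjI bexI[of _ z]) (simp_all add: deg_E E_def sub_dg_simps)
    show "\<exists>x\<in>carrier (deg E k). dif E k x = \<zero>\<^bsub>deg E (k + 1)\<^esub> \<and>
        (\<exists>z\<in>carrier (deg C (k - 1)). y = x \<oplus>\<^bsub>deg C k\<^esub> dif C (k - 1) z)"
    proof (cases "k < b")
      case True
      then have yZ: "y \<in> Z k" using y dy by (simp add: Z_def)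
      have "dif C (k - 1) \<zero>\<^bsub>deg C (k - 1)\<^esub> = \<zero>\<^bsub>deg C k\<^esub>" using d0[of "k - 1"] by simp
      then have "y \<oplus>\<^bsub>deg C k\<^esub> dif C (k - 1) \<zero>\<^bsub>deg C (k - 1)\<^esub> = y"
        using module_group_rules(5)[OF D(1) y] by (simp only:)
      from cyc[OF yZ dy zero this[symmetric]] show ?thesis .
    next
      case False
      \<comment> \<open>At \<open>k = b\<close> every element is a boundary by surjectivity, and
        above \<open>b\<close> there is only zero; the cycle is represented by zero.\<close>
      obtain z where z: "z \<in> carrier (deg C (k - 1))" "y = dif C (k - 1) z"
      proof (cases "k = b")
        case True
        then show ?thesis using that y surj by (metis imageE)
      next
        case False
        then have "carrier (deg C k) = {\<zero>\<^bsub>deg C k\<^esub>}"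
          using \<open>\<not> k < b\<close> C(2) by (simp add: concentrated_in_def)
        then show ?thesis using that[OF zero] y d0[of "k - 1"] by simp
      qed
      then show ?thesis
        using y by (intro cyc[OF Z0 d0 z(1)]) (simp add: module_group_rules[OF D(1)])
    qed
  qed
  then have "acyclic_dg (cone_dg E C (\<lambda>j x. x))"
    by (rule cone_acyclic[OF Ekdg C' incl])
  then have "perfect_dg R n f (cone_dg E C (\<lambda>j x. x))"
    by (intro perfect_dg_acyclic koszul_dg_module_koszul_algebra f koszul_dg_module_cone[OF Ekdg C' incl])
  then show ?thesis
    using zigzag_retract_verdier(2)[OF Ecoh C(1) incl] Ecoh conc by blast
qed

text \<open>The lower end \<open>a\<close> stays fixed while \<open>b\<close> drops by one in each
  round, until \<open>b - a\<close> is at most \<open>n\<close>.\<close>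

lemma shorten:
  assumes f: "f \<in> {1..n} \<rightarrow> carrier R" and "X \<in> coh_s R n f" "concentrated_in X {a..b}"
  shows "\<exists>E m. E \<in> coh_s R n f \<and> concentrated_in E {m..m + int n} \<and>
    zigzag_retract (homotopy_cat R n (coh_s R n f)) (verdier_maps R n f) X E"
  using assms(2,3)
proof (induction "nat (b - a)" arbitrary: X b rule: less_induct)
  case less
  show ?case
  proof (cases "b - a > int n")
    case False
    then have "concentrated_in X {a..a + int n}"
      using less.prems(2) by (auto simp: concentrated_in_def)
    moreover have "zigzag_retract (homotopy_cat R n (coh_s R n f)) (verdier_maps R n f) X X"
      using less.prems(1) by (intro zigzag_retract_refl) (simp add: homotopy_cat_def)
    ultimately show ?thesis using less.prems(1) by blast
  next
    case True
    have "fin_gen_module R (deg X b)"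
      using less.prems(1) by (simp add: coh_s_def strictly_perfect_def)
    then obtain S where "finite S" "S \<subseteq> carrier (deg X b)"
      "\<And>H. submodule H R (deg X b) \<Longrightarrow> S \<subseteq> H \<Longrightarrow> H = carrier (deg X b)"
      unfolding fin_gen_module_def by blast
    then have "generates_coker R X b S"
      unfolding generates_coker_def by (intro conjI allI impI) simp_all
    from surjective_top_differential[OF f True less.prems this]
    obtain C where C: "C \<in> coh_s R n f" "concentrated_in C {a..b}"
      "dif C (b - 1) ` carrier (deg C (b - 1)) = carrier (deg C b)"
      "zigzag_retract (homotopy_cat R n (coh_s R n f)) (verdier_maps R n f) X C"
      by blast
    obtain E where E: "E \<in> coh_s R n f" "concentrated_in E {a..b - 1}"
      "zigzag_retract (homotopy_cat R n (coh_s R n f)) (verdier_maps R n f) C E"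
      using truncate_top[OF f C(1-3)] by blast
    have "nat (b - 1 - a) < nat (b - a)" using True by linarith
    then obtain F m where F: "F \<in> coh_s R n f" "concentrated_in F {m..m + int n}"
      "zigzag_retract (homotopy_cat R n (coh_s R n f)) (verdier_maps R n f) E F"
      using less.hyps[OF _ E(1,2)] by blast
    then show ?thesis
      using zigzag_retract_trans[OF zigzag_retract_trans[OF C(4) E(3)] F(3)]
      by (intro exI[of _ F] exI[of _ m] conjI)
  qed
qed

end

theorem theorem2p7:
  fixes A :: "('a, 'x) ring_scheme" and B :: "('a, 'b) module"
    and f :: "nat \<Rightarrow> 'b" and n :: nat
  assumes "n \<ge> 1"
    and "regular_local_ring A"
    and "affine_LG_model A n B f"
  shows "\<forall>X\<in>Obj (sing_cat B n f). \<exists>Y E m.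
    E \<in> coh_s B n f \<and> concentrated_in E {m..m + int n} \<and>
    represented_by B n f Y E \<and> retract_of (sing_cat B n f) X Y"
proof
  have "algebra A B" and f: "f \<in> {1..n} \<rightarrow> carrier B"
    using assms(3) by (auto simp: affine_LG_model_def)
  then interpret B: cring B by (simp add: algebra_def)
  have sing: "sing_cat B n f =
      idem_completion (localization (homotopy_cat B n (coh_s B n f)) (verdier_maps B n f))"
    by (simp add: sing_cat_def verdier_quotient_s_def verdier_maps_def)
  fix X assume "X \<in> Obj (sing_cat B n f)"
  \<comment> \<open>Only the underlying module \<open>X0\<close> is shortened; the idempotent
    \<open>e\<close> is absorbed at the end by the section and the retraction.\<close>
  then obtain X0 e where X: "X = (X0, e)"
    "(X0, e) \<in> Obj (idem_completion (localization (homotopy_cat B n (coh_s B n f)) (verdier_maps B n f)))"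
    unfolding sing by (metis surj_pair)
  then have X0: "X0 \<in> coh_s B n f"
    by (simp add: idem_completion_def Obj_localization homotopy_cat_def)
  then obtain a b where "concentrated_in X0 {a..b}"
    unfolding coh_s_def strictly_perfect_def by blast
  then obtain E m where E: "E \<in> coh_s B n f" "concentrated_in E {m..m + int n}"
    "zigzag_retract (homotopy_cat B n (coh_s B n f)) (verdier_maps B n f) X0 E"
    using B.shorten[OF f X0] by blast
  let ?Y = "(E, Ident (verdier_quotient_s B n f) E)"
  have vq: "verdier_quotient_s B n f = localization (homotopy_cat B n (coh_s B n f)) (verdier_maps B n f)"
    by (simp add: verdier_quotient_s_def verdier_maps_def)
  have "represented_by B n f ?Y E"
    unfolding represented_by_def sing vq using E(1)
    by (intro conjI isomorphic_idem_completion_refl) (simp_all add: homotopy_cat_def)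
  moreover have "retract_of (sing_cat B n f) X ?Y"
    unfolding sing vq X(1) by (rule retract_of_idem_completion[OF E(3) X(2)])
  ultimately show "\<exists>Y E m. E \<in> coh_s B n f \<and> concentrated_in E {m..m + int n} \<and>
      represented_by B n f Y E \<and> retract_of (sing_cat B n f) X Y"
    using E(1,2) by blast
qed

end
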